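(* Consider the Gaussian MAC with noisy feedback $Y=X_1+X_2+Z$, $Y_{F_k}=Y+Z_k$, $k=1,2$, where $Z,Z_1,Z_2$ are independent zero-mean Gaussian random variables with variances $\sigma_Z^2,\sigma_{Z_1}^2,\sigma_{Z_2}^2$, with average power constraints $E[X_1^2]\le P_1$, $E[X_2^2]\le P_2$, and its dependence balance outer bound $$\mathcal{DB}=\bigcup_{Q}\Big\{(R_1,R_2):\ R_1\le\tfrac12\log\Big(1+\tfrac{f_1(Q)}{\sigma_Z^2}\Big),\ R_2\le\tfrac12\log\Big(1+\tfrac{f_2(Q)}{\sigma_Z^2}\Big),\ R_1+R_2\le\tfrac12\log\Big(1+\tfrac{f_3(Q)}{\sigma_Z^2}\Big)\Big\},$$ where the union is over all $3\times3$ covariance matrices $Q$ of $(X_1,X_2,T)$ with variances $P_1,P_2,P_T$ and correlation coefficients $\rho_{12},\rho_{1T},\rho_{2T}\in[-1,1]$ that satisfy the constraint $$f_3(Q)\le f_1(Q)+f_2(Q)+\frac{f_1(Q)f_2(Q)}{\sigma_Z^2+\frac{\sigma_{Z_1}^2\sigma_{Z_2}^2}{\sigma_{Z_1}^2+\sigma_{Z_2}^2}}.$$ In the limit $\sigma_{Z_1}^2,\sigma_{Z_2}^2\to\infty$, in which this constraint becomes $f_3(Q)\le f_1(Q)+f_2(Q)$, the outer bound $\mathcal{DB}$ collapses to the capacity region of the Gaussian MAC without feedback.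
   Context: Here $$f_1(Q)=\frac{\Delta P_1}{1-\rho_{2T}^2},\qquad f_2(Q)=\frac{\Delta P_2}{1-\rho_{1T}^2},$$ $$f_3(Q)=(1-\rho_{1T}^2)P_1+(1-\rho_{2T}^2)P_2+2(\rho_{12}-\rho_{1T}\rho_{2T})\sqrt{P_1P_2},$$ $$\Delta=1-\rho_{12}^2-\rho_{1T}^2-\rho_{2T}^2+2\rho_{12}\rho_{1T}\rho_{2T},$$ and validity of the covariance matrix requires $\Delta\ge0$. For jointly Gaussian $(X_1,X_2,T)$ with covariance $Q$ these are $f_1(Q)=\mathrm{Var}(X_1|X_2,T)$, $f_2(Q)=\mathrm{Var}(X_2|X_1,T)$, $f_3(Q)=\mathrm{Var}(X_1|T)+\mathrm{Var}(X_2|T)+2\,\mathrm{Cov}(X_1,X_2|T)$. Rates are nonnegative and logarithms are natural. The Gaussian MAC without feedback is the channel $Y=X_1+X_2+Z$ with the same power constraints in which each transmitter's inputs depend only on its own message. The set $\mathcal{DB}$ is called an outer bound because it contains the capacity region of the channel with noisy feedback, where the $i$-th input of transmitter $k$ may depend on its message and on its past feedback $Y_{F_k}^{i-1}$. *)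

theory Defs
  imports "HOL-Probability.Probability"
begin

section \<open>The dependence balance bound\<close>

text \<open>The indices 1, 2, 3 of a covariance matrix refer to \<open>X\<^sub>1\<close>, \<open>X\<^sub>2\<close>, \<open>T\<close>.\<close>

definition covariance_matrix :: "real^3^3 \<Rightarrow> bool" where
  "covariance_matrix Q \<longleftrightarrow> transpose Q = Q \<and> (\<forall>x. 0 \<le> x \<bullet> (Q *v x))"

definition corr :: "real^3^3 \<Rightarrow> 3 \<Rightarrow> 3 \<Rightarrow> real" where
  "corr Q i j = Q $ i $ j / sqrt (Q $ i $ i * Q $ j $ j)"

text \<open>The variance of \<open>T\<close> is left free, but positive so that its correlation coefficients are
  meaningful.  That the correlation coefficients lie in \<open>[-1, 1]\<close> and that \<open>\<Delta> \<ge> 0\<close> both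
  follow from positive semidefiniteness.\<close>

definition admissible :: "real \<Rightarrow> real \<Rightarrow> real^3^3 \<Rightarrow> bool" where
  "admissible P1 P2 Q \<longleftrightarrow>
     covariance_matrix Q \<and> Q $ 1 $ 1 = P1 \<and> Q $ 2 $ 2 = P2 \<and> 0 < Q $ 3 $ 3"

definition corr_Delta :: "real^3^3 \<Rightarrow> real" where
  "corr_Delta Q = 1 - (corr Q 1 2)\<^sup>2 - (corr Q 1 3)\<^sup>2 - (corr Q 2 3)\<^sup>2
                    + 2 * corr Q 1 2 * corr Q 1 3 * corr Q 2 3"

text \<open>\<open>f1 Q\<close> and \<open>f2 Q\<close> are the conditional variances \<open>Var(X\<^sub>1 | X\<^sub>2, T)\<close> and
  \<open>Var(X\<^sub>2 | X\<^sub>1, T)\<close> of jointly Gaussian variables.  If \<open>X\<^sub>2\<close> and \<open>T\<close> are perfectly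
  correlated, the usual formula for \<open>f1\<close> is 0/0; the conditional variance is then
  \<open>Var(X\<^sub>1 | T)\<close>, and symmetrically for \<open>f2\<close>.\<close>

definition f1 :: "real^3^3 \<Rightarrow> real" where
  "f1 Q = (if (corr Q 2 3)\<^sup>2 = 1 then (1 - (corr Q 1 3)\<^sup>2) * Q $ 1 $ 1
           else corr_Delta Q * Q $ 1 $ 1 / (1 - (corr Q 2 3)\<^sup>2))"

definition f2 :: "real^3^3 \<Rightarrow> real" where
  "f2 Q = (if (corr Q 1 3)\<^sup>2 = 1 then (1 - (corr Q 2 3)\<^sup>2) * Q $ 2 $ 2
           else corr_Delta Q * Q $ 2 $ 2 / (1 - (corr Q 1 3)\<^sup>2))"

definition f3 :: "real^3^3 \<Rightarrow> real" where
  "f3 Q = (1 - (corr Q 1 3)\<^sup>2) * Q $ 1 $ 1 + (1 - (corr Q 2 3)\<^sup>2) * Q $ 2 $ 2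
          + 2 * (corr Q 1 2 - corr Q 1 3 * corr Q 2 3) * sqrt (Q $ 1 $ 1 * Q $ 2 $ 2)"

text \<open>Throughout, \<open>N\<close>, \<open>N1\<close>, \<open>N2\<close> are the variances of \<open>Z\<close>, \<open>Z\<^sub>1\<close>, \<open>Z\<^sub>2\<close>.\<close>

definition db_rhs :: "real \<Rightarrow> real \<Rightarrow> real \<Rightarrow> real^3^3 \<Rightarrow> real" where
  "db_rhs N N1 N2 Q = f1 Q + f2 Q + f1 Q * f2 Q / (N + N1 * N2 / (N1 + N2))"

definition rate_union :: "real \<Rightarrow> real \<Rightarrow> real \<Rightarrow> (real^3^3 \<Rightarrow> bool) \<Rightarrow> (real \<times> real) set" where
  "rate_union P1 P2 N C = (\<Union>Q \<in> {Q. admissible P1 P2 Q \<and> C Q}.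
     {(R1, R2). 0 \<le> R1 \<and> 0 \<le> R2 \<and>
        R1 \<le> 1/2 * ln (1 + f1 Q / N) \<and>
        R2 \<le> 1/2 * ln (1 + f2 Q / N) \<and>
        R1 + R2 \<le> 1/2 * ln (1 + f3 Q / N)})"

definition DB :: "real \<Rightarrow> real \<Rightarrow> real \<Rightarrow> real \<Rightarrow> real \<Rightarrow> (real \<times> real) set" where
  "DB P1 P2 N N1 N2 = rate_union P1 P2 N (\<lambda>Q. f3 Q \<le> db_rhs N N1 N2 Q)"

definition DB_limit :: "real \<Rightarrow> real \<Rightarrow> real \<Rightarrow> (real \<times> real) set" where
  "DB_limit P1 P2 N = rate_union P1 P2 N (\<lambda>Q. f3 Q \<le> f1 Q + f2 Q)"

text \<open>Convergence in Hausdorff distance.\<close>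

definition hausdorff_tendsto :: "('b \<Rightarrow> 'a::metric_space set) \<Rightarrow> 'a set \<Rightarrow> 'b filter \<Rightarrow> bool" where
  "hausdorff_tendsto D S F \<longleftrightarrow> (\<forall>\<epsilon>>0. \<forall>\<^sub>F p in F.
     (\<forall>x\<in>D p. \<exists>y\<in>S. dist x y < \<epsilon>) \<and> (\<forall>y\<in>S. \<exists>x\<in>D p. dist x y < \<epsilon>))"

section \<open>The Gaussian multiple access channel without feedback\<close>

definition noise :: "nat \<Rightarrow> real \<Rightarrow> (nat \<Rightarrow> real) measure" where
  "noise n N = PiM {..<n} (\<lambda>_. density lborel (normal_density 0 (sqrt N)))"

text \<open>An encoder \<open>x\<close> maps a message \<open>w\<close> and a time \<open>i\<close> to the channel input \<open>x w i\<close>; messages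
  are independent and uniform.  The power constraint bounds \<open>E[X\<^sub>i\<^sup>2]\<close> averaged over the block.\<close>

definition power_constraint :: "nat \<Rightarrow> nat \<Rightarrow> real \<Rightarrow> (nat \<Rightarrow> nat \<Rightarrow> real) \<Rightarrow> bool" where
  "power_constraint n M P x \<longleftrightarrow> (\<Sum>i<n. (\<Sum>w<M. (x w i)\<^sup>2) / real M) \<le> real n * P"

definition channel_output ::
    "nat \<Rightarrow> (nat \<Rightarrow> real) \<Rightarrow> (nat \<Rightarrow> real) \<Rightarrow> (nat \<Rightarrow> real) \<Rightarrow> nat \<Rightarrow> real" where
  "channel_output n a b z = (\<lambda>i\<in>{..<n}. a i + b i + z i)"

definition error_prob :: "nat \<Rightarrow> real \<Rightarrow> nat \<Rightarrow> nat \<Rightarrow> (nat \<Rightarrow> nat \<Rightarrow> real) \<Rightarrow> (nat \<Rightarrow> nat \<Rightarrow> real)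
    \<Rightarrow> ((nat \<Rightarrow> real) \<Rightarrow> nat \<times> nat) \<Rightarrow> real" where
  "error_prob n N M1 M2 x1 x2 g =
     (\<Sum>w1<M1. \<Sum>w2<M2. measure (noise n N)
        {z \<in> space (noise n N). g (channel_output n (x1 w1) (x2 w2) z) \<noteq> (w1, w2)})
     / (real M1 * real M2)"

definition mac_code :: "real \<Rightarrow> real \<Rightarrow> nat \<Rightarrow> nat \<Rightarrow> nat \<Rightarrow> (nat \<Rightarrow> nat \<Rightarrow> real) \<Rightarrow> (nat \<Rightarrow> nat \<Rightarrow> real)
    \<Rightarrow> ((nat \<Rightarrow> real) \<Rightarrow> nat \<times> nat) \<Rightarrow> bool" where
  "mac_code P1 P2 n M1 M2 x1 x2 g \<longleftrightarrow>
     power_constraint n M1 P1 x1 \<and> power_constraint n M2 P2 x2 \<and>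
     g \<in> measurable (PiM {..<n} (\<lambda>_. borel)) (count_space UNIV)"

definition message_count :: "nat \<Rightarrow> real \<Rightarrow> nat" where
  "message_count n R = nat \<lceil>exp (real n * R)\<rceil>"

definition mac_achievable :: "real \<Rightarrow> real \<Rightarrow> real \<Rightarrow> real \<Rightarrow> real \<Rightarrow> bool" where
  "mac_achievable P1 P2 N R1 R2 \<longleftrightarrow> 0 \<le> R1 \<and> 0 \<le> R2 \<and>
     (\<exists>x1 x2 g.
        (\<forall>n. mac_code P1 P2 n (message_count n R1) (message_count n R2) (x1 n) (x2 n) (g n)) \<and>
        (\<lambda>n. error_prob n N (message_count n R1) (message_count n R2) (x1 n) (x2 n) (g n))
          \<longlonglongrightarrow> 0)"

definition mac_capacity_region :: "real \<Rightarrow> real \<Rightarrow> real \<Rightarrow> (real \<times> real) set" where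
  "mac_capacity_region P1 P2 N = closure {(R1, R2). mac_achievable P1 P2 N R1 R2}"

end

(*
The capacity region of the Gaussian MAC is the pentagon cut out by R1 <= C(P1), R2 <= C(P2) and
R1 + R2 <= C(P1 + P2), where C(P) = ln (1 + P/N) / 2.

Dependence balance bound: always f1 <= P1 and f2 <= P2, so f3 <= f1 + f2 forces f3 <= P1 + P2, and
independent inputs attain all three values.  Off the limit, f3 can exceed P1 + P2 only by
P1 P2 / (N + N1 N2 / (N1 + N2)).

Converse: compare the output law given both messages with a Gaussian law of larger variance whose
mean does not depend on the message to be bounded.  Guessing is hopeless under the latter, so the
average relative entropy between the two laws, which the power constraint bounds by n C, is at
least about ln M.  For the sum rate the reference mean is the sum of the two average codewords;
centring removes the cross terms, since the messages are independent.

Achievability: Gaussian random codebooks of slightly reduced power, decoded by testing likelihood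
ratios against the Gaussian laws of variance P1 + N, P2 + N and P1 + P2 + N.  Averaged over a
wrong codeword such a ratio is 1, so Markov's inequality bounds the probability of confusion;
Chebyshev's inequality for the squared norm shows that the true pair passes all tests.  Codewords
violating the power constraint are replaced by 0.
*)

theory Submission
  imports Defs
begin

section \<open>Gaussian vectors\<close>

text \<open>In the converse the inequality \<open>ln t \<le> t - 1\<close> compares the reference
  law directly with the output law given both messages, so the entropy of the output mixture over
  the messages never has to be handled. The reference variance \<open>S + N\<close> is chosen so
  that, under the averaged power constraint, the quadratic part of the relative entropy cancels and
  only n C(S) is left. In the achievability part the obstacle is that a Gaussian codeword may exceed
  the power constraint. The power check is therefore part of the typicality event, and the decoder
  tests the untruncated codewords: whenever the sent pair is typical, truncation has changed
  nothing, and the random coding average can be taken over exact product laws. The log density of a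
  centred Gaussian vector depends only on its squared norm, so typicality is a statement about six
  norms, and second moments suffice. For the outer bound, every \<open>DB\<close> with a positive
  denominator already contains the pentagon. Only the distance from outside needs an estimate, and
  it is linear in the excess because \<open>ln\<close> is 1-Lipschitz beyond 1.\<close>

definition gauss1 :: "real \<Rightarrow> real \<Rightarrow> real measure" where
  "gauss1 m V = density lborel (normal_density m (sqrt V))"

definition gauss :: "nat \<Rightarrow> (nat \<Rightarrow> real) \<Rightarrow> real \<Rightarrow> (nat \<Rightarrow> real) measure" where
  "gauss n m V = PiM {..<n} (\<lambda>i. gauss1 (m i) V)"

abbreviation vec_space :: "nat \<Rightarrow> (nat \<Rightarrow> real) measure" where
  "vec_space n \<equiv> PiM {..<n} (\<lambda>_. borel)"

lemma sets_gauss1 [simp, measurable_cong]: "sets (gauss1 m V) = sets borel"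
  by (simp add: gauss1_def)

lemma space_gauss1 [simp]: "space (gauss1 m V) = UNIV"
  by (simp add: gauss1_def)

lemma sets_gauss [simp, measurable_cong]: "sets (gauss n m V) = sets (vec_space n)"
  unfolding gauss_def by (intro sets_PiM_cong) auto

lemma space_gauss: "space (gauss n m V) = space (vec_space n)"
  by (rule sets_eq_imp_space_eq) simp

lemma prob_space_gauss1: "0 < V \<Longrightarrow> prob_space (gauss1 m V)"
  unfolding gauss1_def by (rule prob_space_normal_density) simp

lemma product_prob_space_gauss1: "0 < V \<Longrightarrow> product_prob_space (\<lambda>i. gauss1 (m i) V)"
  by (intro product_prob_spaceI prob_space_gauss1)

lemma prob_space_gauss: "0 < V \<Longrightarrow> prob_space (gauss n m V)"
  unfolding gauss_def by (intro prob_space_PiM prob_space_gauss1)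

lemma noise_eq_gauss: "noise n N = gauss n (\<lambda>_. 0) N"
  by (simp add: noise_def gauss_def gauss1_def)

lemma channel_output_eq: "channel_output n a b = (\<lambda>z. \<lambda>i\<in>{..<n}. (a i + b i) + z i)"
  by (auto simp: channel_output_def fun_eq_iff)

lemma nn_integral_gauss_prod:
  assumes "0 < V" "\<And>i. i < n \<Longrightarrow> f i \<in> borel_measurable borel"
  shows "(\<integral>\<^sup>+x. (\<Prod>i<n. f i (x i)) \<partial>gauss n m V) = (\<Prod>i<n. \<integral>\<^sup>+x. f i x \<partial>gauss1 (m i) V)"
proof -
  interpret product_prob_space "\<lambda>i. gauss1 (m i) V" UNIV
    by (rule product_prob_space_gauss1) fact
  show ?thesis
    unfolding gauss_def by (rule product_nn_integral_prod) (use assms in auto)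
qed

text \<open>Boxes are closed under intersection and generate the product sigma-algebra, so they
  determine the law. Translation, convolution and change of density are reduced through this to one
  computation per coordinate.\<close>

lemma gauss_eqI:
  assumes V: "0 < V" and sets: "sets P = sets (vec_space n)"
    and eq: "\<And>A. (\<And>i. i < n \<Longrightarrow> A i \<in> sets borel) \<Longrightarrow>
      emeasure P (Pi\<^sub>E {..<n} A) = (\<Prod>i<n. emeasure (gauss1 (m i) V) (A i))"
  shows "P = gauss n m V"
proof -
  interpret product_prob_space "\<lambda>i. gauss1 (m i) V" UNIV
    by (rule product_prob_space_gauss1) fact
  have [simp]: "sets (vec_space n) = sets (PiM {..<n} (\<lambda>i. gauss1 (m i) V))"
    by (intro sets_PiM_cong) auto
  show ?thesis
    unfolding gauss_def by (rule PiM_eqI) (auto simp: sets eq)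
qed

section \<open>Translation and convolution of Gaussian laws\<close>

lemma distr_gauss1_translate:
  assumes "0 < V"
  shows "distr (gauss1 m V) borel (\<lambda>x. a + x) = gauss1 (a + m) V"
proof -
  interpret prob_space "gauss1 m V" by (rule prob_space_gauss1) fact
  have "distributed (gauss1 m V) lborel (\<lambda>x. x) (normal_density m (sqrt V))"
    by (auto simp: distributed_def gauss1_def distr_id2)
  from normal_density_affine[OF this, of 1 a]
  have "distributed (gauss1 m V) lborel (\<lambda>x. a + x) (normal_density (a + m) (sqrt V))"
    using assms by simp
  hence "distr (gauss1 m V) lborel (\<lambda>x. a + x) = gauss1 (a + m) V"
    by (simp add: distributed_def gauss1_def)
  thus ?thesis by (simp cong: distr_cong)
qed

lemma distr_gauss_translate:
  assumes V: "0 < V"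
  shows "distr (gauss n m V) (vec_space n) (\<lambda>x. \<lambda>i\<in>{..<n}. a i + x i) = gauss n (\<lambda>i. a i + m i) V"
proof (rule gauss_eqI[OF V])
  fix A assume A: "\<And>i. i < n \<Longrightarrow> A i \<in> sets (borel :: real measure)"
  interpret product_prob_space "\<lambda>i. gauss1 (m i) V" UNIV
    by (rule product_prob_space_gauss1) fact
  have "(\<lambda>x. \<lambda>i\<in>{..<n}. a i + x i) -` Pi\<^sub>E {..<n} A \<inter> space (gauss n m V)
      = Pi\<^sub>E {..<n} (\<lambda>i. (\<lambda>x. a i + x) -` A i)"
    by (auto simp: space_gauss space_PiM PiE_iff)
  moreover have "(\<lambda>x. a i + x) -` A i \<in> sets borel" if "i < n" for i
    using measurable_sets[of "\<lambda>x. a i + x" borel borel "A i"] A[OF that] by simp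
  ultimately show "emeasure (distr (gauss n m V) (vec_space n) (\<lambda>x. \<lambda>i\<in>{..<n}. a i + x i)) (Pi\<^sub>E {..<n} A)
      = (\<Prod>i<n. emeasure (gauss1 (a i + m i) V) (A i))"
    using A V
    apply (subst emeasure_distr)
      apply (auto simp: distr_gauss1_translate[symmetric] intro!: sets_PiM_I_finite)
    apply (subst gauss_def)
    apply (subst emeasure_PiM)
      apply (auto intro!: prod.cong simp: emeasure_distr)
    done
qed simp

text \<open>Read one way, this is the density of a codeword letter plus noise; read the other way,
  it is the likelihood of a received letter \<open>u\<close> averaged over an independent wrong
  letter. The second reading feeds Markov's inequality in the achievability part.\<close>

lemma nn_integral_gauss1_conv_density:
  assumes "0 < P" "0 < N"
  shows "(\<integral>\<^sup>+v. ennreal (normal_density 0 (sqrt N) (u - v)) \<partial>gauss1 0 P)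
    = ennreal (normal_density 0 (sqrt (P + N)) u)"
proof -
  have "(\<integral>\<^sup>+v. ennreal (normal_density 0 (sqrt N) (u - v)) \<partial>gauss1 0 P)
     = (\<integral>\<^sup>+v. ennreal (normal_density 0 (sqrt N) (u - v) * normal_density 0 (sqrt P) v) \<partial>lborel)"
    unfolding gauss1_def
    by (subst nn_integral_density) (auto simp: ennreal_mult' mult.commute)
  also have "\<dots> = normal_density 0 (sqrt (P + N)) u"
    using fun_cong[OF conv_normal_density_zero_mean[of "sqrt N" "sqrt P"], of u] assms
    by (simp add: add.commute)
  finally show ?thesis .
qed

lemma nn_integral_gauss1_conv:
  assumes P: "0 < P" and N: "0 < N" and [measurable]: "f \<in> borel_measurable borel"
  shows "(\<integral>\<^sup>+x. \<integral>\<^sup>+z. f (x + z) \<partial>gauss1 0 N \<partial>gauss1 0 P) = (\<integral>\<^sup>+y. f y \<partial>gauss1 0 (P + N))"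
proof -
  interpret P: prob_space "gauss1 0 P" by (rule prob_space_gauss1) fact
  interpret pair_sigma_finite "gauss1 0 P" lborel
    by unfold_locales
  \<comment> \<open>The shift by \<open>x\<close> moves from \<open>f\<close> into the density, so
    that after the exchange of integrals \<open>x\<close> can be integrated out of the density
    alone.\<close>
  have "(\<integral>\<^sup>+z. f (x + z) \<partial>gauss1 0 N) = (\<integral>\<^sup>+y. ennreal (normal_density 0 (sqrt N) (y - x)) * f y \<partial>lborel)" for x
  proof -
    have "(\<integral>\<^sup>+z. f (x + z) \<partial>gauss1 0 N) = (\<integral>\<^sup>+y. f y \<partial>gauss1 x N)"
      using N by (subst distr_gauss1_translate[where m = 0, simplified, symmetric])
        (auto simp: nn_integral_distr)
    also have "\<dots> = (\<integral>\<^sup>+y. ennreal (normal_density x (sqrt N) y) * f y \<partial>lborel)"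
      unfolding gauss1_def by (subst nn_integral_density) auto
    finally show ?thesis by (simp add: normal_density_def)
  qed
  hence "(\<integral>\<^sup>+x. \<integral>\<^sup>+z. f (x + z) \<partial>gauss1 0 N \<partial>gauss1 0 P)
    = (\<integral>\<^sup>+x. \<integral>\<^sup>+y. ennreal (normal_density 0 (sqrt N) (y - x)) * f y \<partial>lborel \<partial>gauss1 0 P)" by simp
  also have "\<dots> = (\<integral>\<^sup>+y. \<integral>\<^sup>+x. ennreal (normal_density 0 (sqrt N) (y - x)) * f y \<partial>gauss1 0 P \<partial>lborel)"
    by (rule Fubini'[symmetric]) measurable
  also have "\<dots> = (\<integral>\<^sup>+y. ennreal (normal_density 0 (sqrt (P + N)) y) * f y \<partial>lborel)"
    using P N by (simp add: nn_integral_multc nn_integral_gauss1_conv_density)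
  also have "\<dots> = (\<integral>\<^sup>+y. f y \<partial>gauss1 0 (P + N))"
    unfolding gauss1_def by (subst nn_integral_density) auto
  finally show ?thesis .
qed

lemma distr_gauss_conv:
  assumes P: "0 < P" and N: "0 < N"
  shows "distr (gauss n (\<lambda>_. 0) P \<Otimes>\<^sub>M gauss n (\<lambda>_. 0) N) (vec_space n) (\<lambda>(x, z). \<lambda>i\<in>{..<n}. x i + z i)
    = gauss n (\<lambda>_. 0) (P + N)" (is "distr (?X \<Otimes>\<^sub>M ?Z) _ ?f = _")
proof (rule gauss_eqI)
  show "0 < P + N" using P N by simp
  fix A assume A: "\<And>i. i < n \<Longrightarrow> A i \<in> sets (borel :: real measure)"
  interpret X: prob_space ?X by (rule prob_space_gauss) fact
  interpret Z: prob_space ?Z by (rule prob_space_gauss) fact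
  interpret N1: prob_space "gauss1 0 N" by (rule prob_space_gauss1) fact
  have [measurable]: "A i \<in> sets borel" if "i \<in> {..<n}" for i using A that by auto
  have [measurable]: "Pi\<^sub>E {..<n} A \<in> sets (vec_space n)"
    using A by (auto intro!: sets_PiM_I_finite)
  have "emeasure (distr (?X \<Otimes>\<^sub>M ?Z) (vec_space n) ?f) (Pi\<^sub>E {..<n} A)
    = (\<integral>\<^sup>+y. indicator (Pi\<^sub>E {..<n} A) y \<partial>distr (?X \<Otimes>\<^sub>M ?Z) (vec_space n) ?f)"
    by simp
  also have "\<dots> = (\<integral>\<^sup>+xz. indicator (Pi\<^sub>E {..<n} A) (?f xz) \<partial>(?X \<Otimes>\<^sub>M ?Z))"
    by (rule nn_integral_distr) measurable
  also have "\<dots> = (\<integral>\<^sup>+x. \<integral>\<^sup>+z. indicator (Pi\<^sub>E {..<n} A) (?f (x, z)) \<partial>?Z \<partial>?X)"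
    by (rule Z.nn_integral_fst[symmetric]) measurable
  \<comment> \<open>The indicator of a box is the product of the indicators of its sides; this lets
    both integrals factor over the coordinates.\<close>
  also have "\<dots> = (\<integral>\<^sup>+x. \<integral>\<^sup>+z. (\<Prod>i<n. indicator (A i) (x i + z i)) \<partial>?Z \<partial>?X)"
    by (intro nn_integral_cong) (auto simp: indicator_def PiE_iff prod_zero_iff)
  also have "\<dots> = (\<integral>\<^sup>+x. (\<Prod>i<n. \<integral>\<^sup>+z. indicator (A i) (x i + z) \<partial>gauss1 0 N) \<partial>?X)"
    using N A by (intro nn_integral_cong nn_integral_gauss_prod) auto
  also have "\<dots> = (\<Prod>i<n. \<integral>\<^sup>+x. \<integral>\<^sup>+z. indicator (A i) (x + z) \<partial>gauss1 0 N \<partial>gauss1 0 P)"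
    using P A by (intro nn_integral_gauss_prod) auto
  also have "\<dots> = (\<Prod>i<n. emeasure (gauss1 0 (P + N)) (A i))"
    using P N A by (intro prod.cong refl) (subst nn_integral_gauss1_conv, auto)
  finally show "emeasure (distr (?X \<Otimes>\<^sub>M ?Z) (vec_space n) ?f) (Pi\<^sub>E {..<n} A)
     = (\<Prod>i<n. emeasure (gauss1 0 (P + N)) (A i))" .
qed simp

section \<open>Moments, likelihood ratios and relative entropy\<close>

lemma distr_gauss_component:
  assumes "0 < V" "i < n"
  shows "distr (gauss n m V) (gauss1 (m i) V) (\<lambda>x. x i) = gauss1 (m i) V"
  unfolding gauss_def
  using distr_PiM_component[of "{..<n}" "\<lambda>i. gauss1 (m i) V" i] assms prob_space_gauss1 by auto

lemma measurable_component_gauss: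
  assumes "i < n" shows "(\<lambda>x. x i) \<in> borel_measurable (gauss n m V)"
  using assms by (simp add: measurable_cong_sets[OF sets_gauss refl] measurable_component_singleton)

lemma has_bochner_integral_gauss_component:
  fixes f :: "real \<Rightarrow> real"
  assumes V: "0 < V" and i: "i < n" and f: "has_bochner_integral (gauss1 (m i) V) f c"
  shows "has_bochner_integral (gauss n m V) (\<lambda>x. f (x i)) c"
proof -
  have [measurable]: "f \<in> borel_measurable borel"
    using f by (auto simp: has_bochner_integral_iff dest!: borel_measurable_integrable)
  have [measurable]: "(\<lambda>x. x i) \<in> gauss n m V \<rightarrow>\<^sub>M gauss1 (m i) V"
    using measurable_component_gauss[OF i] by (simp add: measurable_cong_sets[OF refl sets_gauss1])
  have f': "integrable (gauss1 (m i) V) f" "integral\<^sup>L (gauss1 (m i) V) f = c"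
    using f by (auto simp: has_bochner_integral_iff)
  have "integrable (distr (gauss n m V) (gauss1 (m i) V) (\<lambda>x. x i)) f"
    using f' V i by (simp add: distr_gauss_component)
  moreover have "integral\<^sup>L (distr (gauss n m V) (gauss1 (m i) V) (\<lambda>x. x i)) f = c"
    using f' V i by (simp add: distr_gauss_component)
  ultimately show ?thesis
    by (simp add: has_bochner_integral_iff integrable_distr_eq integral_distr)
qed

lemma has_bochner_integral_gauss1_square:
  assumes V: "0 < V"
  shows "has_bochner_integral (gauss1 a V) (\<lambda>y. (y - b)\<^sup>2) (V + (a - b)\<^sup>2)"
proof -
  \<comment> \<open>\<open>(x - b)\<^sup>2\<close> is expanded about the mean \<open>a\<close>; the
    cross term carries the first central moment, which is 0.\<close>
  have "has_bochner_integral lborel (\<lambda>x. normal_density a (sqrt V) x * (x - a)\<^sup>2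
      + (2 * (a - b)) * (normal_density a (sqrt V) x * (x - a))
      + (a - b)\<^sup>2 * normal_density a (sqrt V) x) (V + (2 * (a - b)) * 0 + (a - b)\<^sup>2 * 1)"
    using normal_moment_even[of "sqrt V" a 1] normal_moment_odd[of "sqrt V" a 0] V
      integral_normal_density[of "sqrt V" a] integrable_normal_density[of "sqrt V" a]
    by (intro has_bochner_integral_add has_bochner_integral_mult_right)
       (auto simp: fact_numeral has_bochner_integral_iff)
  moreover have "(\<lambda>x. normal_density a (sqrt V) x * (x - a)\<^sup>2
      + (2 * (a - b)) * (normal_density a (sqrt V) x * (x - a))
      + (a - b)\<^sup>2 * normal_density a (sqrt V) x) = (\<lambda>x. normal_density a (sqrt V) x *\<^sub>R (x - b)\<^sup>2)"
    by (auto simp: fun_eq_iff power2_eq_square algebra_simps)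
  ultimately show ?thesis
    unfolding gauss1_def by (intro has_bochner_integral_density) auto
qed

text \<open>Both laws are products, so the likelihood ratio is the product of the coordinate ratios.
  It turns probabilities under the reference law into integrals under the true law, where the two
  can be compared pointwise.\<close>

lemma gauss_eq_density_gauss:
  assumes N: "0 < N" and V: "0 < V"
  shows "gauss n b V = density (gauss n a N)
    (\<lambda>y. ennreal (\<Prod>i<n. normal_density (b i) (sqrt V) (y i) / normal_density (a i) (sqrt N) (y i)))"
    (is "_ = density _ (\<lambda>y. ennreal (\<Prod>i<n. ?r i (y i)))")
proof (rule gauss_eqI[OF V, symmetric])
  fix A assume A: "\<And>i. i < n \<Longrightarrow> A i \<in> sets (borel :: real measure)"
  have [measurable]: "A i \<in> sets borel" if "i \<in> {..<n}" for i using A that by auto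
  have [measurable]: "Pi\<^sub>E {..<n} A \<in> sets (vec_space n)"
    using A by (auto intro!: sets_PiM_I_finite)
  have "emeasure (density (gauss n a N) (\<lambda>y. ennreal (\<Prod>i<n. ?r i (y i)))) (Pi\<^sub>E {..<n} A)
    = (\<integral>\<^sup>+y. ennreal (\<Prod>i<n. ?r i (y i)) * indicator (Pi\<^sub>E {..<n} A) y \<partial>gauss n a N)"
    by (rule emeasure_density) auto
  also have "\<dots> = (\<integral>\<^sup>+y. (\<Prod>i<n. ennreal (?r i (y i)) * indicator (A i) (y i)) \<partial>gauss n a N)"
    by (intro nn_integral_cong)
       (auto simp: indicator_def PiE_iff prod_zero_iff prod_ennreal space_gauss space_PiM prod.distrib)
  also have "\<dots> = (\<Prod>i<n. \<integral>\<^sup>+y. ennreal (?r i y) * indicator (A i) y \<partial>gauss1 (a i) N)"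
    using N A by (intro nn_integral_gauss_prod) auto
  also have "\<dots> = (\<Prod>i<n. emeasure (gauss1 (b i) V) (A i))"
  proof (intro prod.cong refl)
    fix i assume "i \<in> {..<n}"
    hence [measurable]: "A i \<in> sets borel" using A by auto
    have "(\<integral>\<^sup>+y. ennreal (?r i y) * indicator (A i) y \<partial>gauss1 (a i) N)
      = (\<integral>\<^sup>+y. ennreal (normal_density (a i) (sqrt N) y) * (ennreal (?r i y) * indicator (A i) y) \<partial>lborel)"
      unfolding gauss1_def by (subst nn_integral_density) auto
    also have "\<dots> = (\<integral>\<^sup>+y. ennreal (normal_density (b i) (sqrt V) y) * indicator (A i) y \<partial>lborel)"
      using normal_density_pos[of "sqrt N" "a i"] N
      by (intro nn_integral_cong)
         (auto simp: indicator_def ennreal_mult'[symmetric] less_imp_neq[symmetric])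
    also have "\<dots> = emeasure (gauss1 (b i) V) (A i)"
      unfolding gauss1_def by (subst emeasure_density) auto
    finally show "(\<integral>\<^sup>+y. ennreal (?r i y) * indicator (A i) y \<partial>gauss1 (a i) N)
        = emeasure (gauss1 (b i) V) (A i)" .
  qed
  finally show "emeasure (density (gauss n a N) (\<lambda>y. ennreal (\<Prod>i<n. ?r i (y i)))) (Pi\<^sub>E {..<n} A)
    = (\<Prod>i<n. emeasure (gauss1 (b i) V) (A i))" .
qed simp

lemma ln_normal_density:
  assumes "0 < V"
  shows "ln (normal_density m (sqrt V) y) = - ln (2 * pi * V) / 2 - (y - m)\<^sup>2 / (2 * V)"
proof -
  define X where "X = 2 * pi * V"
  have "0 < X" using assms by (simp add: X_def)
  hence "ln (1 / sqrt X * exp (- (y - m)\<^sup>2 / (2 * V))) = - ln X / 2 - (y - m)\<^sup>2 / (2 * V)"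
    by (subst ln_mult) (auto simp: ln_div ln_sqrt)
  thus ?thesis using assms by (simp add: normal_density_def X_def)
qed

text \<open>The data processing inequality for relative entropy, with the event \<open>B\<close> weighted by \<open>ln K\<close>;
  it is the integral of \<open>ln t \<le> t - 1\<close> at \<open>t = K * dQ/dP\<close> on \<open>B\<close> and \<open>t = dQ/dP\<close> off \<open>B\<close>.\<close>

lemma ln_measure_gauss_le:
  assumes N: "0 < N" and V: "0 < V" and K: "0 < K" and B [measurable]: "B \<in> sets (vec_space n)"
  shows "ln K * measure (gauss n a N) B
    \<le> (\<Sum>i<n. ln (V / N) / 2 + (N + (a i - b i)\<^sup>2) / (2 * V) - 1 / 2)
       + (K - 1) * measure (gauss n b V) B"
proof -
  define P where "P = gauss n a N"
  define r where "r = (\<lambda>y. \<Prod>i<n. normal_density (b i) (sqrt V) (y i) / normal_density (a i) (sqrt N) (y i))"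
  interpret P: prob_space P unfolding P_def by (rule prob_space_gauss) fact
  interpret Q: prob_space "gauss n b V" by (rule prob_space_gauss) fact
  have sets_P [measurable_cong]: "sets P = sets (vec_space n)" by (simp add: P_def)
  have r_meas [measurable]: "r \<in> borel_measurable P"
    unfolding r_def by measurable
  have r_pos: "0 < r y" for y
    unfolding r_def using N V by (intro prod_pos divide_pos_pos normal_density_pos) auto
  have Q: "gauss n b V = density P (\<lambda>y. ennreal (r y))"
    unfolding P_def r_def by (rule gauss_eq_density_gauss) fact+
  have hb: "has_bochner_integral P (\<lambda>y. r y * indicator S y) (measure (gauss n b V) S)"
    if [measurable]: "S \<in> sets (vec_space n)" for S
  proof (rule has_bochner_integral_nn_integral)
    have "ennreal (measure (gauss n b V) S) = emeasure (gauss n b V) S"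
      by (simp add: Q.emeasure_eq_measure)
    also have "\<dots> = (\<integral>\<^sup>+y. ennreal (r y) * indicator S y \<partial>P)"
      unfolding Q by (rule emeasure_density) auto
    finally show "(\<integral>\<^sup>+y. ennreal (r y * indicator S y) \<partial>P) = ennreal (measure (gauss n b V) S)"
      by (auto intro!: nn_integral_cong simp: indicator_def)
  qed (auto intro!: AE_I2 simp: less_imp_le[OF r_pos])
  have r1: "has_bochner_integral P r 1"
  proof -
    have "has_bochner_integral P (\<lambda>y. r y * indicator (space (vec_space n)) y)
       (measure (gauss n b V) (space (gauss n b V)))"
      using hb[of "space (vec_space n)"] by (simp add: space_gauss)
    hence "has_bochner_integral P (\<lambda>y. r y * indicator (space (vec_space n)) y) 1"
      using Q.prob_space by simp
    thus ?thesis
      by (rule has_bochner_integral_cong[THEN iffD1, rotated -1]) (auto simp: P_def space_gauss)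
  qed
  have ln_r: "ln (r y) = (\<Sum>i<n. ((- ln (V / N) / 2) + (1 / (2 * N)) * (y i - a i)\<^sup>2)
      - (1 / (2 * V)) * (y i - b i)\<^sup>2)" for y
  proof -
    have pos: "normal_density (b i) (sqrt V) (y i) > 0" "normal_density (a i) (sqrt N) (y i) > 0" for i
      using N V by (auto intro: normal_density_pos)
    have nz: "normal_density (b i) (sqrt V) (y i) \<noteq> 0" "normal_density (a i) (sqrt N) (y i) \<noteq> 0" for i
      using pos[of i] by linarith+
    have "ln (r y) = (\<Sum>i<n. ln (normal_density (b i) (sqrt V) (y i) / normal_density (a i) (sqrt N) (y i)))"
      unfolding r_def by (rule ln_prod) (auto simp: nz)
    also have "\<dots> = (\<Sum>i<n. ((- ln (V / N) / 2) + (1 / (2 * N)) * (y i - a i)\<^sup>2)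
      - (1 / (2 * V)) * (y i - b i)\<^sup>2)"
      using N V
      by (intro sum.cong refl) (simp add: ln_div nz ln_normal_density ln_mult field_simps)
    finally show ?thesis .
  qed
  have "has_bochner_integral P (\<lambda>y. ln (r y)) (\<Sum>i<n. ((- ln (V / N) / 2) + (1 / (2 * N)) * (N + (a i - a i)\<^sup>2))
      - (1 / (2 * V)) * (N + (a i - b i)\<^sup>2))"
    unfolding ln_r P_def
  proof (intro has_bochner_integral_sum has_bochner_integral_diff has_bochner_integral_add
      has_bochner_integral_mult_right)
    fix i assume "i \<in> {..<n}"
    thus "has_bochner_integral (gauss n a N) (\<lambda>y. (y i - a i)\<^sup>2) (N + (a i - a i)\<^sup>2)"
      "has_bochner_integral (gauss n a N) (\<lambda>y. (y i - b i)\<^sup>2) (N + (a i - b i)\<^sup>2)"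
      by (intro has_bochner_integral_gauss_component[OF N, where m = a]
          has_bochner_integral_gauss1_square[OF N]; simp)+
  qed (auto simp: P_def[symmetric] has_bochner_integral_iff P.prob_space)
  \<comment> \<open>\<open>?D\<close> is the relative entropy of \<open>gauss n a N\<close> with
    respect to \<open>gauss n b V\<close>. Its \<open>1 / 2\<close> per coordinate is the mean of
    the squared deviation from \<open>a\<close>, divided by \<open>2 * N\<close>.\<close>
  moreover have "(\<Sum>i<n. ((- ln (V / N) / 2) + (1 / (2 * N)) * (N + (a i - a i)\<^sup>2))
      - (1 / (2 * V)) * (N + (a i - b i)\<^sup>2))
    = - (\<Sum>i<n. ln (V / N) / 2 + (N + (a i - b i)\<^sup>2) / (2 * V) - 1 / 2)" (is "_ = - ?D")
    unfolding sum_negf[symmetric] using N by (intro sum.cong refl) (simp add: add_divide_distrib algebra_simps)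
  ultimately have lnr: "has_bochner_integral P (\<lambda>y. ln (r y)) (- ?D)" by simp
  have I: "has_bochner_integral P (\<lambda>y. indicator B y) (measure P B)"
    by (rule has_bochner_integral_real_indicator) (auto simp: P.emeasure_finite less_top[symmetric])
  have lhs: "has_bochner_integral P (\<lambda>y. ln K * indicator B y + ln (r y)) (ln K * measure P B + - ?D)"
    by (intro has_bochner_integral_add has_bochner_integral_mult_right I lnr)
  have rhs: "has_bochner_integral P (\<lambda>y. (r y - 1) + (K - 1) * (r y * indicator B y))
     ((1 - 1) + (K - 1) * measure (gauss n b V) B)"
    by (intro has_bochner_integral_add has_bochner_integral_diff has_bochner_integral_mult_right r1 hb)
       (auto simp: has_bochner_integral_iff P.prob_space)
  have "ln K * indicator B y + ln (r y) \<le> (r y - 1) + (K - 1) * (r y * indicator B y)" for y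
    using ln_le_minus_one[of "K * r y"] ln_le_minus_one[of "r y"] r_pos[of y] K
    by (auto simp: indicator_def ln_mult algebra_simps)
  hence "integral\<^sup>L P (\<lambda>y. ln K * indicator B y + ln (r y))
      \<le> integral\<^sup>L P (\<lambda>y. (r y - 1) + (K - 1) * (r y * indicator B y))"
    using lhs rhs by (intro integral_mono) (auto simp: has_bochner_integral_iff)
  hence "ln K * measure P B + - ?D \<le> (1 - 1) + (K - 1) * measure (gauss n b V) B"
    using lhs rhs by (simp only: has_bochner_integral_integral_eq)
  thus ?thesis by (simp add: P_def)
qed

section \<open>The dependence balance bound\<close>

definition mac_pentagon :: "real \<Rightarrow> real \<Rightarrow> real \<Rightarrow> (real \<times> real) set" where
  "mac_pentagon P1 P2 N = {(R1, R2). 0 \<le> R1 \<and> 0 \<le> R2 \<and> R1 \<le> ln (1 + P1 / N) / 2 \<and>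
     R2 \<le> ln (1 + P2 / N) / 2 \<and> R1 + R2 \<le> ln (1 + (P1 + P2) / N) / 2}"

lemma closed_mac_pentagon: "closed (mac_pentagon P1 P2 N)"
proof -
  have "mac_pentagon P1 P2 N = {p. 0 \<le> fst p} \<inter> {p. 0 \<le> snd p} \<inter> {p. fst p \<le> ln (1 + P1 / N) / 2}
     \<inter> {p. snd p \<le> ln (1 + P2 / N) / 2} \<inter> {p. fst p + snd p \<le> ln (1 + (P1 + P2) / N) / 2}"
    by (auto simp: mac_pentagon_def)
  also have "closed \<dots>"
    by (intro closed_Int closed_Collect_le continuous_intros)
  finally show ?thesis .
qed


section \<open>Bounds on the conditional variances from positive semidefiniteness\<close>

lemma admissible_corr_form_nonneg:
  fixes u v w :: real
  assumes Q: "admissible P1 P2 Q" and P: "0 < P1" "0 < P2"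
  shows "0 \<le> u\<^sup>2 + v\<^sup>2 + w\<^sup>2 + 2 * corr Q 1 2 * (u * v) + 2 * corr Q 1 3 * (u * w) + 2 * corr Q 2 3 * (v * w)"
proof -
  define s1 s2 s3 where "s1 = sqrt (Q $ 1 $ 1)" and "s2 = sqrt (Q $ 2 $ 2)" and "s3 = sqrt (Q $ 3 $ 3)"
  have pos: "0 < s1" "0 < s2" "0 < s3" using Q P by (auto simp: s1_def s2_def s3_def admissible_def)
  have sq: "Q $ 1 $ 1 = s1\<^sup>2" "Q $ 2 $ 2 = s2\<^sup>2" "Q $ 3 $ 3 = s3\<^sup>2"
    using Q P by (auto simp: s1_def s2_def s3_def admissible_def)
  have sym: "Q $ i $ j = Q $ j $ i" for i j
  proof -
    have "transpose Q = Q" using Q by (simp add: admissible_def covariance_matrix_def)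
    moreover have "transpose Q $ j $ i = Q $ i $ j" by (simp add: transpose_def)
    ultimately show ?thesis by simp
  qed
  have corr: "Q $ 1 $ 2 = corr Q 1 2 * s1 * s2" "Q $ 1 $ 3 = corr Q 1 3 * s1 * s3"
    "Q $ 2 $ 3 = corr Q 2 3 * s2 * s3"
    using pos by (auto simp: corr_def real_sqrt_mult s1_def s2_def s3_def)
  \<comment> \<open>Dividing the test vector by the standard deviations turns the quadratic form of
    the covariance matrix into that of the correlation matrix.\<close>
  define u' v' w' where "u' = u / s1" and "v' = v / s2" and "w' = w / s3"
  have uvw: "u = s1 * u'" "v = s2 * v'" "w = s3 * w'"
    using pos by (auto simp: u'_def v'_def w'_def)
  define x :: "real^3" where "x = vector [u', v', w']"
  have "0 \<le> x \<bullet> (Q *v x)" using Q by (auto simp: admissible_def covariance_matrix_def)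
  also have "x \<bullet> (Q *v x) = u' * (s1\<^sup>2 * u' + Q $ 1 $ 2 * v' + Q $ 1 $ 3 * w')
     + v' * (Q $ 1 $ 2 * u' + s2\<^sup>2 * v' + Q $ 2 $ 3 * w')
     + w' * (Q $ 1 $ 3 * u' + Q $ 2 $ 3 * v' + s3\<^sup>2 * w')"
    by (simp add: x_def inner_vec_def matrix_vector_mult_def sum_3 vector_3 sq
        sym[of 2 1] sym[of 3 1] sym[of 3 2])
  also have "\<dots> = u\<^sup>2 + v\<^sup>2 + w\<^sup>2 + 2 * corr Q 1 2 * (u * v) + 2 * corr Q 1 3 * (u * w) + 2 * corr Q 2 3 * (v * w)"
    unfolding corr uvw by algebra
  finally show ?thesis .
qed

text \<open>The test vector is one standardised input minus its regression on \<open>T\<close>; the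
  form returns the residual variance, one minus the squared correlation.\<close>

lemma admissible_corr_le_1:
  assumes "admissible P1 P2 Q" "0 < P1" "0 < P2"
  shows "(corr Q 1 3)\<^sup>2 \<le> 1" "(corr Q 2 3)\<^sup>2 \<le> 1"
  using admissible_corr_form_nonneg[OF assms, of 1 0 "- corr Q 1 3"]
    admissible_corr_form_nonneg[OF assms, of 0 1 "- corr Q 2 3"]
  by (simp_all add: power2_eq_square)

text \<open>The test vector is a row of the adjugate of the correlation matrix, on which the quadratic form
  equals a principal minor times the determinant.\<close>

lemma admissible_corr_Delta:
  assumes "admissible P1 P2 Q" "0 < P1" "0 < P2"
  shows "0 \<le> (1 - (corr Q 2 3)\<^sup>2) * corr_Delta Q" "0 \<le> (1 - (corr Q 1 3)\<^sup>2) * corr_Delta Q"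
proof -
  define r a b where "r = corr Q 1 2" and "a = corr Q 1 3" and "b = corr Q 2 3"
  note form = admissible_corr_form_nonneg[OF assms, folded r_def a_def b_def]
  have "(1 - b\<^sup>2) * (1 - r\<^sup>2 - a\<^sup>2 - b\<^sup>2 + 2 * r * a * b) = (1 - b\<^sup>2)\<^sup>2 + (a * b - r)\<^sup>2 + (r * b - a)\<^sup>2
    + 2 * r * ((1 - b\<^sup>2) * (a * b - r)) + 2 * a * ((1 - b\<^sup>2) * (r * b - a))
    + 2 * b * ((a * b - r) * (r * b - a))"
    by (simp add: power2_eq_square algebra_simps)
  with form[of "1 - b\<^sup>2" "a * b - r" "r * b - a"]
  show "0 \<le> (1 - (corr Q 2 3)\<^sup>2) * corr_Delta Q"
    by (simp only: corr_Delta_def r_def[symmetric] a_def[symmetric] b_def[symmetric])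
  have "(1 - a\<^sup>2) * (1 - r\<^sup>2 - a\<^sup>2 - b\<^sup>2 + 2 * r * a * b) = (a * b - r)\<^sup>2 + (1 - a\<^sup>2)\<^sup>2 + (r * a - b)\<^sup>2
    + 2 * r * ((a * b - r) * (1 - a\<^sup>2)) + 2 * a * ((a * b - r) * (r * a - b))
    + 2 * b * ((1 - a\<^sup>2) * (r * a - b))"
    by (simp add: power2_eq_square algebra_simps)
  with form[of "a * b - r" "1 - a\<^sup>2" "r * a - b"]
  show "0 \<le> (1 - (corr Q 1 3)\<^sup>2) * corr_Delta Q"
    by (simp only: corr_Delta_def r_def[symmetric] a_def[symmetric] b_def[symmetric])
qed

lemma f1_bounds:
  assumes Q: "admissible P1 P2 Q" and P: "0 < P1" "0 < P2"
  shows "0 \<le> f1 Q" "f1 Q \<le> P1"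
proof -
  note le = admissible_corr_le_1[OF Q P]
  have Q11: "Q $ 1 $ 1 = P1" using Q by (simp add: admissible_def)
  have "0 \<le> f1 Q \<and> f1 Q \<le> P1"
  proof (cases "(corr Q 2 3)\<^sup>2 = 1")
    case True
    thus ?thesis using le P by (auto simp: f1_def Q11 mult_le_cancel_right1)
  next
    case False
    hence pos: "0 < 1 - (corr Q 2 3)\<^sup>2" using le by simp
    have "0 \<le> corr_Delta Q" using admissible_corr_Delta(1)[OF Q P] pos by (simp add: zero_le_mult_iff)
    \<comment> \<open>Up to the factor \<open>P1 / (1 - (corr Q 2 3)\<^sup>2)\<close> this is
      \<open>P1 - f1 Q\<close>, the part of the variance of the first input explained by the second
      input and \<open>T\<close>. It is nonnegative as a weighted sum of squares.\<close>
    moreover have "1 - (corr Q 2 3)\<^sup>2 - corr_Delta Q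
      = (corr Q 1 2 - corr Q 1 3 * corr Q 2 3)\<^sup>2 + (corr Q 1 3)\<^sup>2 * (1 - (corr Q 2 3)\<^sup>2)"
      by (simp add: corr_Delta_def power2_eq_square algebra_simps)
    hence "corr_Delta Q \<le> 1 - (corr Q 2 3)\<^sup>2"
      using mult_nonneg_nonneg[OF zero_le_power2[of "corr Q 1 3"] less_imp_le[OF pos]]
        zero_le_power2[of "corr Q 1 2 - corr Q 1 3 * corr Q 2 3"] by linarith
    ultimately show ?thesis
      using pos P False by (simp add: f1_def Q11 divide_le_eq mult.commute)
  qed
  thus "0 \<le> f1 Q" "f1 Q \<le> P1" by auto
qed

lemma f2_bounds:
  assumes Q: "admissible P1 P2 Q" and P: "0 < P1" "0 < P2"
  shows "0 \<le> f2 Q" "f2 Q \<le> P2"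
proof -
  note le = admissible_corr_le_1[OF Q P]
  have Q22: "Q $ 2 $ 2 = P2" using Q by (simp add: admissible_def)
  have "0 \<le> f2 Q \<and> f2 Q \<le> P2"
  proof (cases "(corr Q 1 3)\<^sup>2 = 1")
    case True
    thus ?thesis using le P by (auto simp: f2_def Q22 mult_le_cancel_right1)
  next
    case False
    hence pos: "0 < 1 - (corr Q 1 3)\<^sup>2" using le by simp
    have "0 \<le> corr_Delta Q" using admissible_corr_Delta(2)[OF Q P] pos by (simp add: zero_le_mult_iff)
    moreover have "1 - (corr Q 1 3)\<^sup>2 - corr_Delta Q
      = (corr Q 1 2 - corr Q 1 3 * corr Q 2 3)\<^sup>2 + (corr Q 2 3)\<^sup>2 * (1 - (corr Q 1 3)\<^sup>2)"
      by (simp add: corr_Delta_def power2_eq_square algebra_simps)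
    hence "corr_Delta Q \<le> 1 - (corr Q 1 3)\<^sup>2"
      using mult_nonneg_nonneg[OF zero_le_power2[of "corr Q 2 3"] less_imp_le[OF pos]]
        zero_le_power2[of "corr Q 1 2 - corr Q 1 3 * corr Q 2 3"] by linarith
    ultimately show ?thesis
      using pos P False by (simp add: f2_def Q22 divide_le_eq mult.commute)
  qed
  thus "0 \<le> f2 Q" "f2 Q \<le> P2" by auto
qed

text \<open>For fixed first entries \<open>s1\<close>, \<open>s2\<close> the correlation form is
  smallest at the third entry \<open>- (corr Q 1 3 * s1 + corr Q 2 3 * s2)\<close>, and this minimum
  is \<open>f3 Q\<close>, the variance of the sum of the inputs given \<open>T\<close>. The bound
  keeps the argument of the sum-rate logarithm positive, as monotonicity of \<open>ln\<close>
  requires.\<close>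

lemma f3_nonneg:
  assumes Q: "admissible P1 P2 Q" and P: "0 < P1" "0 < P2"
  shows "0 \<le> f3 Q"
proof -
  define s1 s2 where "s1 = sqrt P1" and "s2 = sqrt P2"
  have "Q $ 1 $ 1 = P1" "Q $ 2 $ 2 = P2" using Q by (auto simp: admissible_def)
  hence s: "Q $ 1 $ 1 = s1\<^sup>2" "Q $ 2 $ 2 = s2\<^sup>2" and s': "sqrt (Q $ 1 $ 1 * Q $ 2 $ 2) = s1 * s2"
    using P by (auto simp: s1_def s2_def real_sqrt_mult)
  have "f3 Q = s1\<^sup>2 + s2\<^sup>2 + (- (corr Q 1 3 * s1 + corr Q 2 3 * s2))\<^sup>2 + 2 * corr Q 1 2 * (s1 * s2)
    + 2 * corr Q 1 3 * (s1 * - (corr Q 1 3 * s1 + corr Q 2 3 * s2))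
    + 2 * corr Q 2 3 * (s2 * - (corr Q 1 3 * s1 + corr Q 2 3 * s2))"
    unfolding f3_def s' unfolding s by (simp add: power2_eq_square algebra_simps)
  thus ?thesis
    using admissible_corr_form_nonneg[OF Q P, of s1 s2 "- (corr Q 1 3 * s1 + corr Q 2 3 * s2)"] by simp
qed

section \<open>Letting the feedback noise grow\<close>

lemma filterlim_db_denominator:
  "filterlim (\<lambda>(N1, N2). N + N1 * N2 / (N1 + N2)) at_top (at_top \<times>\<^sub>F (at_top :: real filter))"
  unfolding filterlim_at_top
proof
  fix Z :: real
  \<comment> \<open>Once both variances are at least \<open>K\<close>,
    \<open>N1 * N2 / (N1 + N2)\<close> is at least \<open>K / 2\<close>, which accounts for the
    factor 2; the 1 keeps the divisor positive.\<close>
  define K where "K = max 1 (2 * (Z - N))"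
  have "\<forall>\<^sub>F p in (at_top :: real filter) \<times>\<^sub>F (at_top :: real filter). K \<le> fst p \<and> K \<le> snd p"
    unfolding eventually_prod_filter
    by (intro exI[of _ "\<lambda>x. K \<le> x"]) (auto intro: eventually_ge_at_top)
  thus "\<forall>\<^sub>F p in at_top \<times>\<^sub>F at_top. Z \<le> (case p of (N1, N2) \<Rightarrow> N + N1 * N2 / (N1 + N2))"
  proof (rule eventually_mono, clarsimp)
    fix x y :: real assume xy: "K \<le> x" "K \<le> y"
    have K: "0 < K" by (simp add: K_def)
    have "K * x \<le> y * x" "K * y \<le> x * y" using xy K by (auto intro!: mult_right_mono)
    hence "K * (x + y) \<le> x * y + x * y" by (simp add: distrib_left mult.commute)
    hence "K / 2 \<le> x * y / (x + y)" using xy K by (simp add: field_simps)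
    moreover have "2 * (Z - N) \<le> K" by (simp add: K_def)
    moreover have "Z \<le> N + q" if "K / 2 \<le> q" "2 * (Z - N) \<le> K" for q using that by simp
    ultimately show "Z \<le> N + x * y / (x + y)" by blast
  qed
qed

lemma tendsto_divide_db_denominator:
  "((\<lambda>(N1, N2). c / (N + N1 * N2 / (N1 + N2))) \<longlongrightarrow> (0 :: real)) (at_top \<times>\<^sub>F at_top)"
  using tendsto_divide_0[OF tendsto_const filterlim_at_top_imp_at_infinity[OF filterlim_db_denominator[of N]], of c]
  by (simp add: case_prod_unfold)

lemma db_rhs_tendsto:
  "((\<lambda>(N1, N2). db_rhs N N1 N2 Q) \<longlongrightarrow> f1 Q + f2 Q) (at_top \<times>\<^sub>F at_top)"
  using tendsto_add[OF tendsto_const tendsto_divide_db_denominator[of "f1 Q * f2 Q" N], of "f1 Q + f2 Q"]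
  by (simp add: db_rhs_def case_prod_unfold)

text \<open>The Lipschitz bound for \<open>ln\<close> beyond 1, by which an excess in
  \<open>f3\<close> costs at most a proportional excess in the sum rate.\<close>

lemma ln_add_le: 
  fixes x h :: real
  assumes "1 \<le> x" "0 \<le> h" shows "ln (x + h) \<le> ln x + h"
proof -
  have "ln (x + h) = ln x + ln (1 + h / x)"
    using assms by (subst ln_mult_pos[symmetric]) (auto simp: distrib_left add_pos_nonneg)
  also have "ln (1 + h / x) \<le> h / x"
    using assms by (intro ln_add_one_self_le_self) auto
  also have "h / x \<le> h" using assms by (simp add: divide_le_eq mult_le_cancel_left1)
  finally show ?thesis by simp
qed

text \<open>One estimate serves both constraints: \<open>\<eta> = 0\<close> gives the pentagon for
  the limiting constraint, and a positive \<open>\<eta>\<close> measures the overshoot for finite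
  feedback noise. Only the sum rate is affected, since \<open>f1\<close> and \<open>f2\<close> obey
  their bounds under any constraint.\<close>

lemma rate_union_bounds:
  assumes R: "(R1, R2) \<in> rate_union P1 P2 N C" and P: "0 < P1" "0 < P2" and N: "0 < N"
    and C: "\<And>Q. admissible P1 P2 Q \<Longrightarrow> C Q \<Longrightarrow> f3 Q \<le> P1 + P2 + \<eta>" and \<eta>: "0 \<le> \<eta>"
  shows "0 \<le> R1 \<and> 0 \<le> R2 \<and> R1 \<le> ln (1 + P1 / N) / 2 \<and> R2 \<le> ln (1 + P2 / N) / 2 \<and>
     R1 + R2 \<le> ln (1 + (P1 + P2) / N) / 2 + \<eta> / (2 * N)"
proof -
  from R obtain Q where Q: "admissible P1 P2 Q" "C Q" and R0: "0 \<le> R1" "0 \<le> R2"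
    and R1: "R1 \<le> 1/2 * ln (1 + f1 Q / N)" and R2: "R2 \<le> 1/2 * ln (1 + f2 Q / N)"
    and R12: "R1 + R2 \<le> 1/2 * ln (1 + f3 Q / N)"
    unfolding rate_union_def by blast
  note b = f1_bounds[OF Q(1) P] f2_bounds[OF Q(1) P]
  have pos: "0 < 1 + f3 Q / N"
    using f3_nonneg[OF Q(1) P] N by (simp add: add_pos_nonneg)
  have "ln (1 + f1 Q / N) \<le> ln (1 + P1 / N)" "ln (1 + f2 Q / N) \<le> ln (1 + P2 / N)"
    using b N P by (auto intro!: ln_mono divide_right_mono add_pos_nonneg simp: add_pos_nonneg)
  moreover have L3: "ln (1 + f3 Q / N) \<le> ln (1 + (P1 + P2) / N) + \<eta> / N"
  proof -
    have "f3 Q / N \<le> (P1 + P2 + \<eta>) / N" using C[OF Q] N by (simp add: divide_right_mono)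
    hence "ln (1 + f3 Q / N) \<le> ln ((1 + (P1 + P2) / N) + \<eta> / N)"
      using pos by (intro ln_mono) (auto simp: add_divide_distrib)
    also have "\<dots> \<le> ln (1 + (P1 + P2) / N) + \<eta> / N"
      using P N \<eta> by (intro ln_add_le) auto
    finally show ?thesis .
  qed
  ultimately have "R1 \<le> ln (1 + P1 / N) / 2" "R2 \<le> ln (1 + P2 / N) / 2"
    using R1 R2 by linarith+
  moreover have "R1 + R2 \<le> ln (1 + (P1 + P2) / N) / 2 + \<eta> / (2 * N)"
  proof -
    have "2 * (R1 + R2) \<le> ln (1 + (P1 + P2) / N) + \<eta> / N"
      by (rule order_trans[OF _ L3]) (use R12 in simp)
    hence "R1 + R2 \<le> (ln (1 + (P1 + P2) / N) + \<eta> / N) / 2" by simp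
    also have "\<dots> = ln (1 + (P1 + P2) / N) / 2 + \<eta> / (2 * N)"
      by (subst add_divide_distrib) (simp add: mult.commute)
    finally show ?thesis .
  qed
  ultimately show ?thesis using R0 by blast
qed


lemma mac_pentagon_subset_DB_limit:
  assumes P: "0 < P1" "0 < P2" and N: "0 < N"
  shows "mac_pentagon P1 P2 N \<subseteq> DB_limit P1 P2 N"
proof -
  \<comment> \<open>Independent \<open>X1\<close>, \<open>X2\<close>, \<open>T\<close>; the variance
    1 of \<open>T\<close> stands for any positive value, as only correlations with \<open>T\<close>
    enter.\<close>
  define Q :: "real^3^3" where
    "Q = (\<chi> i j. if i = j then (if i = 1 then P1 else if i = 2 then P2 else 1) else 0)"
  have neq: "(2::3) \<noteq> 1" "(1::3) \<noteq> 2" "(3::3) \<noteq> 1" "(3::3) \<noteq> 2" "(1::3) \<noteq> 3" "(2::3) \<noteq> 3" by simp_all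
  have "0 \<le> x \<bullet> (Q *v x)" for x :: "real^3"
  proof -
    have "x \<bullet> (Q *v x) = P1 * (x $ 1)\<^sup>2 + P2 * (x $ 2)\<^sup>2 + (x $ 3)\<^sup>2"
      by (simp add: Q_def inner_vec_def matrix_vector_mult_def sum_3 power2_eq_square neq)
    thus ?thesis using P by simp
  qed
  moreover have "transpose Q = Q"
    by (auto simp: Q_def transpose_def vec_eq_iff)
  ultimately have adm: "admissible P1 P2 Q"
    by (simp add: admissible_def covariance_matrix_def) (simp add: Q_def neq)
  have "corr Q 1 2 = 0" "corr Q 1 3 = 0" "corr Q 2 3 = 0" "Q $ 1 $ 1 = P1" "Q $ 2 $ 2 = P2"
    by (auto simp: corr_def Q_def neq)
  hence "f1 Q = P1" "f2 Q = P2" "f3 Q = P1 + P2"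
    by (simp_all add: f1_def f2_def f3_def corr_Delta_def)
  thus ?thesis
    using adm by (auto simp: mac_pentagon_def DB_limit_def rate_union_def)
qed

lemma DB_limit_eq_mac_pentagon:
  assumes P: "0 < P1" "0 < P2" and N: "0 < N"
  shows "DB_limit P1 P2 N = mac_pentagon P1 P2 N"
proof
  show "DB_limit P1 P2 N \<subseteq> mac_pentagon P1 P2 N"
  proof (rule subrelI)
    fix R1 R2 assume R: "(R1, R2) \<in> DB_limit P1 P2 N"
    have "f3 Q \<le> P1 + P2 + 0" if "admissible P1 P2 Q" "f3 Q \<le> f1 Q + f2 Q" for Q
      using that f1_bounds[OF that(1) P] f2_bounds[OF that(1) P] by simp
    from rate_union_bounds[OF R[unfolded DB_limit_def] P N this] show "(R1, R2) \<in> mac_pentagon P1 P2 N"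
      by (simp add: mac_pentagon_def)
  qed
qed (rule mac_pentagon_subset_DB_limit[OF assms])

text \<open>The product filter lets the two variances grow independently of each other. The regions
  contain the pentagon, so a point outside it exceeds only the sum-rate bound and can be pushed back
  by lowering the rates.\<close>

lemma hausdorff_tendsto_DB:
  assumes P: "0 < P1" "0 < P2" and N: "0 < N"
  shows "hausdorff_tendsto (\<lambda>(N1, N2). DB P1 P2 N N1 N2) (mac_pentagon P1 P2 N) (at_top \<times>\<^sub>F at_top)"
  unfolding hausdorff_tendsto_def
proof (intro allI impI)
  fix \<epsilon> :: real assume \<epsilon>: "0 < \<epsilon>"
  define \<eta> where "\<eta> = (\<lambda>(N1, N2). P1 * P2 / (N + N1 * N2 / (N1 + N2)))"
  \<comment> \<open>An excess \<open>\<eta>\<close> in \<open>f3\<close> costs at most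
    \<open>\<eta> / (2 * N)\<close> in sum rate, so this threshold keeps the cost below
    \<open>\<epsilon>\<close>.\<close>
  have "\<forall>\<^sub>F p in at_top \<times>\<^sub>F at_top. \<eta> p < 2 * N * \<epsilon>"
    unfolding \<eta>_def using N \<epsilon> by (intro order_tendstoD(2)[OF tendsto_divide_db_denominator]) auto
  \<comment> \<open>The parameters range over all reals, where the denominator may fail to be
    positive; it is positive eventually, which is all that the filter asks.\<close>
  moreover have "\<forall>\<^sub>F p in at_top \<times>\<^sub>F at_top. 0 < (case p of (N1, N2) \<Rightarrow> N + N1 * N2 / (N1 + N2))"
    using filterlim_db_denominator by (simp add: filterlim_at_top_dense)
  ultimately show "\<forall>\<^sub>F p in at_top \<times>\<^sub>F at_top.
     (\<forall>x\<in>case p of (N1, N2) \<Rightarrow> DB P1 P2 N N1 N2. \<exists>y\<in>mac_pentagon P1 P2 N. dist x y < \<epsilon>) \<and>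
     (\<forall>y\<in>mac_pentagon P1 P2 N. \<exists>x\<in>case p of (N1, N2) \<Rightarrow> DB P1 P2 N N1 N2. dist x y < \<epsilon>)"
  proof eventually_elim
    case (elim p)
    obtain N1 N2 where p: "p = (N1, N2)" by fastforce
    define D where "D = N + N1 * N2 / (N1 + N2)"
    have D: "0 < D" using elim by (simp add: D_def p)
    have \<eta>p: "\<eta> p = P1 * P2 / D" "0 \<le> \<eta> p" using P D by (auto simp: \<eta>_def p D_def)
    have "\<exists>y\<in>mac_pentagon P1 P2 N. dist x y < \<epsilon>" if "x \<in> DB P1 P2 N N1 N2" for x
    proof -
      obtain R1 R2 where x: "x = (R1, R2)" by fastforce
      have "f3 Q \<le> P1 + P2 + \<eta> p" if Q: "admissible P1 P2 Q" "f3 Q \<le> db_rhs N N1 N2 Q" for Q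
      proof -
        note b = f1_bounds[OF Q(1) P] f2_bounds[OF Q(1) P]
        have "f1 Q * f2 Q \<le> P1 * P2" using b P by (intro mult_mono) auto
        hence "f1 Q * f2 Q / D \<le> P1 * P2 / D" using D by (simp add: divide_right_mono)
        thus ?thesis using Q(2) b by (simp add: db_rhs_def \<eta>p D_def)
      qed
      from rate_union_bounds[OF that[unfolded x DB_def] P N this \<eta>p(2)]
      have R: "0 \<le> R1" "0 \<le> R2" "R1 \<le> ln (1 + P1 / N) / 2" "R2 \<le> ln (1 + P2 / N) / 2"
        and R12: "R1 + R2 \<le> ln (1 + (P1 + P2) / N) / 2 + \<eta> p / (2 * N)" by auto
      \<comment> \<open>\<open>t\<close> is the overshoot of the sum rate. It is taken from
        \<open>R1\<close> as far as that stays nonnegative and from \<open>R2\<close> for the rest,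
        so the point moves by at most \<open>t\<close>.\<close>
      define t where "t = max 0 (R1 + R2 - ln (1 + (P1 + P2) / N) / 2)"
      have C: "0 \<le> ln (1 + (P1 + P2) / N) / 2" using P N by simp
      have "\<eta> p / (2 * N) < \<epsilon>" using elim N by (simp add: field_simps)
      hence t: "0 \<le> t" "t < \<epsilon>" using R12 \<epsilon> by (auto simp: t_def)
      define d where "d = min t R1"
      have d: "d \<le> t" "d \<le> R1" "0 \<le> d" "d = t \<or> d = R1" using t R by (auto simp: d_def)
      have t': "R1 + R2 - ln (1 + (P1 + P2) / N) / 2 \<le> t" "t = 0 \<or> t = R1 + R2 - ln (1 + (P1 + P2) / N) / 2"
        by (auto simp: t_def)
      \<comment> \<open>If \<open>R1\<close> is used up entirely, what remains of \<open>R2\<close>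
        is the sum-rate bound itself, or \<open>R2\<close> when there is no overshoot.\<close>
      have "0 \<le> R2 - (t - d)" using d t' R C by linarith
      hence "(R1 - d, R2 - (t - d)) \<in> mac_pentagon P1 P2 N"
        using R t d t' unfolding mac_pentagon_def by simp
      moreover have "dist x (R1 - d, R2 - (t - d)) \<le> \<bar>d\<bar> + \<bar>t - d\<bar>"
        using sqrt_sum_squares_le_sum_abs[of d "t - d"] by (simp add: x dist_Pair_Pair dist_real_def)
      moreover have "\<bar>d\<bar> + \<bar>t - d\<bar> = t" using d by auto
      ultimately show ?thesis using t by (intro bexI) auto
    qed
    moreover have "mac_pentagon P1 P2 N \<subseteq> DB P1 P2 N N1 N2"
    proof -
      have "f3 Q \<le> db_rhs N N1 N2 Q" if "admissible P1 P2 Q" "f3 Q \<le> f1 Q + f2 Q" for Q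
      proof -
        have "0 \<le> f1 Q * f2 Q / D"
          using f1_bounds[OF that(1) P] f2_bounds[OF that(1) P] D by simp
        thus ?thesis using that(2) by (simp add: db_rhs_def D_def)
      qed
      hence "DB_limit P1 P2 N \<subseteq> DB P1 P2 N N1 N2"
        unfolding DB_limit_def DB_def rate_union_def by blast
      thus ?thesis using mac_pentagon_subset_DB_limit[OF P N] by blast
    qed
    ultimately show ?case using \<epsilon> by (auto simp: p intro!: bexI)
  qed
qed

section \<open>The converse\<close>

text \<open>Decoding regions of different messages are disjoint. Under a law that ignores the
  message this makes guessing among \<open>card A\<close> messages succeed with average probability
  at most \<open>1 / card A\<close>.\<close>

lemma (in prob_space) sum_prob_values_le_1:
  assumes g: "g \<in> M \<rightarrow>\<^sub>M count_space UNIV" and A: "finite A" and inj: "inj_on h A"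
  shows "(\<Sum>w\<in>A. prob {y \<in> space M. g y = h w}) \<le> 1"
proof -
  have "{y \<in> space M. g y = c} \<in> events" for c
    using measurable_sets[OF g, of "{c}"] by (simp add: vimage_def Int_def conj_commute)
  hence "(\<Sum>w\<in>A. prob {y \<in> space M. g y = h w}) = prob (\<Union>w\<in>A. {y \<in> space M. g y = h w})"
    using A inj by (intro finite_measure_finite_Union[symmetric])
      (auto simp: disjoint_family_on_def inj_on_def)
  thus ?thesis by simp
qed

text \<open>A Fano-type bound: \<open>K\<close> is the number of messages among which the decoder
  must choose, and \<open>ref\<close> says that under the reference laws it does no better than
  guessing. The reference mean \<open>b w\<close> may depend on \<open>w\<close>, which allows
  conditioning on the other sender's message.\<close>

lemma sum_correct_prob_le:
  fixes a b :: "'w \<Rightarrow> nat \<Rightarrow> real" and N S K :: real and g :: "(nat \<Rightarrow> real) \<Rightarrow> 'w"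
  assumes N: "0 < N" and S: "0 < S" and K: "1 \<le> K"
    and g: "g \<in> vec_space n \<rightarrow>\<^sub>M count_space UNIV"
    and power: "(\<Sum>w\<in>W. \<Sum>i<n. (a w i - b w i)\<^sup>2) \<le> card W * (n * S)"
    and ref: "(\<Sum>w\<in>W. measure (gauss n (b w) (S + N)) {y \<in> space (vec_space n). g y = w}) \<le> card W / K"
  shows "ln K * (\<Sum>w\<in>W. measure (noise n N) {z \<in> space (noise n N). g (\<lambda>i\<in>{..<n}. a w i + z i) = w})
    \<le> card W * (n * (ln (1 + S / N) / 2) + 1)"
proof -
  define V where "V = S + N"
  have V: "0 < V" using S N by (simp add: V_def)
  define B where "B w = {y \<in> space (vec_space n). g y = w}" for w
  have B: "B w \<in> sets (vec_space n)" for w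
  proof -
    have "B w = g -` {w} \<inter> space (vec_space n)" by (auto simp: B_def)
    thus ?thesis using measurable_sets[OF g, of "{w}"] by simp
  qed
  have transl: "measure (noise n N) {z \<in> space (noise n N). g (\<lambda>i\<in>{..<n}. a w i + z i) = w}
     = measure (gauss n (a w) N) (B w)" for w
  proof -
    have [measurable]: "(\<lambda>x. \<lambda>i\<in>{..<n}. a w i + x i) \<in> noise n N \<rightarrow>\<^sub>M vec_space n"
      unfolding noise_eq_gauss by measurable
    have "measure (gauss n (a w) N) (B w)
      = measure (distr (noise n N) (vec_space n) (\<lambda>x. \<lambda>i\<in>{..<n}. a w i + x i)) (B w)"
      unfolding noise_eq_gauss using distr_gauss_translate[OF N, of n "\<lambda>_. 0" "a w"] by simp
    also have "\<dots> = measure (noise n N) {z \<in> space (noise n N). g (\<lambda>i\<in>{..<n}. a w i + z i) = w}"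
      by (subst measure_distr[OF _ B])
         (auto simp: B_def space_PiM intro!: arg_cong[where f = "measure _"])
    finally show ?thesis by simp
  qed
  have D: "(\<Sum>i<n. ln (V / N) / 2 + (N + (a w i - b w i)\<^sup>2) / (2 * V) - 1 / 2)
    = n * (ln (V / N) / 2 + N / (2 * V) - 1 / 2) + (\<Sum>i<n. (a w i - b w i)\<^sup>2) / (2 * V)" for w
    by (simp add: sum.distrib sum_subtractf add_divide_distrib sum_divide_distrib algebra_simps)
  have "ln K * (\<Sum>w\<in>W. measure (gauss n (a w) N) (B w))
    \<le> (\<Sum>w\<in>W. (\<Sum>i<n. ln (V / N) / 2 + (N + (a w i - b w i)\<^sup>2) / (2 * V) - 1 / 2)
       + (K - 1) * measure (gauss n (b w) V) (B w))"
    unfolding sum_distrib_left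
    using K by (intro sum_mono ln_measure_gauss_le N V B) auto
  also have "\<dots> = card W * (n * (ln (V / N) / 2 + N / (2 * V) - 1 / 2))
     + (\<Sum>w\<in>W. \<Sum>i<n. (a w i - b w i)\<^sup>2) / (2 * V) + (K - 1) * (\<Sum>w\<in>W. measure (gauss n (b w) V) (B w))"
    by (simp only: D sum.distrib sum_constant sum_divide_distrib sum_distrib_left)
  also have "\<dots> \<le> card W * (n * (ln (V / N) / 2 + N / (2 * V) - 1 / 2))
     + (card W * (n * S)) / (2 * V) + (K - 1) * (card W / K)"
    using power ref K V unfolding B_def V_def
    by (intro add_mono order_refl divide_right_mono mult_left_mono) auto
  also have "\<dots> = card W * (n * (ln (V / N) / 2)) + (K - 1) * (card W / K)"
  proof -
    \<comment> \<open>This is where the reference variance \<open>V = S + N\<close> pays off: the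
      power term contributes \<open>S / (2 * V)\<close> per coordinate and cancels exactly.\<close>
    have "N / (2 * V) - 1 / 2 = - (S / (2 * V))"
      using V by (simp add: V_def field_simps)
    hence "ln (V / N) / 2 + N / (2 * V) - 1 / 2 = ln (V / N) / 2 - S / (2 * V)" by simp
    moreover have "(card W * (n * S)) / (2 * V) = card W * (n * (S / (2 * V)))"
      by simp
    ultimately show ?thesis
      by (simp only: add_diff_eq[symmetric]) (simp add: right_diff_distrib distrib_left)
  qed
  also have "(K - 1) * (card W / K) \<le> card W"
    using K by (simp add: field_simps)
  also have "V / N = 1 + S / N" using N by (simp add: V_def field_simps)
  finally show ?thesis by (simp only: transl) (simp add: algebra_simps)
qed

text \<open>Summing over all pairs kills the product of the two centred terms, and centring only
  lowers the energy of each sender. Uncentred codewords could add coherently, with energy beyond the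
  sum of the two powers.\<close>

lemma sum_square_centered_le:
  fixes u v :: "nat \<Rightarrow> real"
  assumes "0 < M1" "0 < M2"
  shows "(\<Sum>p\<in>{..<M1} \<times> {..<M2}. (u (fst p) + v (snd p) - ((\<Sum>w<M1. u w) / M1 + (\<Sum>w<M2. v w) / M2))\<^sup>2)
    \<le> M2 * (\<Sum>w<M1. (u w)\<^sup>2) + M1 * (\<Sum>w<M2. (v w)\<^sup>2)"
proof -
  define mu mv where "mu = (\<Sum>w<M1. u w) / M1" and "mv = (\<Sum>w<M2. v w) / M2"
  have z1: "(\<Sum>w<M1. u w - mu) = 0" and z2: "(\<Sum>w<M2. v w - mv) = 0"
    using assms by (simp_all add: mu_def mv_def sum_subtractf)
  have c1: "(\<Sum>w<M1. (u w - mu)\<^sup>2) \<le> (\<Sum>w<M1. (u w)\<^sup>2)"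
  proof -
    have "(\<Sum>w<M1. (u w)\<^sup>2) = (\<Sum>w<M1. (u w - mu)\<^sup>2 + 2 * mu * (u w - mu) + mu\<^sup>2)"
      by (intro sum.cong refl) (simp add: power2_eq_square algebra_simps)
    also have "\<dots> = (\<Sum>w<M1. (u w - mu)\<^sup>2) + M1 * mu\<^sup>2"
      by (simp only: sum.distrib sum_distrib_left[symmetric] z1) simp
    finally show ?thesis by simp
  qed
  have c2: "(\<Sum>w<M2. (v w - mv)\<^sup>2) \<le> (\<Sum>w<M2. (v w)\<^sup>2)"
  proof -
    have "(\<Sum>w<M2. (v w)\<^sup>2) = (\<Sum>w<M2. (v w - mv)\<^sup>2 + 2 * mv * (v w - mv) + mv\<^sup>2)"
      by (intro sum.cong refl) (simp add: power2_eq_square algebra_simps)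
    also have "\<dots> = (\<Sum>w<M2. (v w - mv)\<^sup>2) + M2 * mv\<^sup>2"
      by (simp only: sum.distrib sum_distrib_left[symmetric] z2) simp
    finally show ?thesis by simp
  qed
  have "(\<Sum>p\<in>{..<M1} \<times> {..<M2}. (u (fst p) + v (snd p) - (mu + mv))\<^sup>2)
    = (\<Sum>w1<M1. \<Sum>w2<M2. (u w1 - mu)\<^sup>2 + (2 * (u w1 - mu)) * (v w2 - mv) + (v w2 - mv)\<^sup>2)"
    unfolding sum.cartesian_product
    by (intro sum.cong refl) (auto simp: power2_eq_square algebra_simps)
  also have "\<dots> = M2 * (\<Sum>w<M1. (u w - mu)\<^sup>2) + M1 * (\<Sum>w<M2. (v w - mv)\<^sup>2)"
    by (simp only: sum.distrib sum_distrib_left[symmetric] z2) (simp add: sum_distrib_left)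
  also have "\<dots> \<le> M2 * (\<Sum>w<M1. (u w)\<^sup>2) + M1 * (\<Sum>w<M2. (v w)\<^sup>2)"
    by (intro add_mono mult_left_mono c1 c2) auto
  finally show ?thesis by (simp add: mu_def mv_def)
qed

lemma power_constraint_sum:
  assumes "power_constraint n M P x" "0 < M"
  shows "(\<Sum>w<M. \<Sum>i<n. (x w i)\<^sup>2) \<le> M * (n * P)"
proof -
  have "(\<Sum>w<M. \<Sum>i<n. (x w i)\<^sup>2) = M * (\<Sum>i<n. (\<Sum>w<M. (x w i)\<^sup>2) / M)"
    using assms(2) by (subst sum.swap) (simp add: sum_divide_distrib[symmetric])
  thus ?thesis using assms by (simp add: power_constraint_def)
qed

lemma sum_correct_prob:
  fixes g :: "(nat \<Rightarrow> real) \<Rightarrow> nat \<times> nat"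
  assumes N: "0 < N" and M: "0 < M1" "0 < M2" and g: "g \<in> vec_space n \<rightarrow>\<^sub>M count_space UNIV"
  shows "(\<Sum>w\<in>{..<M1} \<times> {..<M2}. measure (noise n N)
      {z \<in> space (noise n N). g (\<lambda>i\<in>{..<n}. (x1 (fst w) i + x2 (snd w) i) + z i) = w})
    = real M1 * real M2 * (1 - error_prob n N M1 M2 x1 x2 g)"
proof -
  interpret prob_space "noise n N"
    unfolding noise_eq_gauss by (rule prob_space_gauss) fact
  have ev: "{z \<in> space (noise n N). g (\<lambda>i\<in>{..<n}. a i + z i) = w} \<in> events" for a w
  proof -
    have "(\<lambda>z. \<lambda>i\<in>{..<n}. a i + z i) \<in> noise n N \<rightarrow>\<^sub>M vec_space n"
      unfolding noise_eq_gauss by measurable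
    from measurable_sets[OF measurable_compose[OF this g], of "{w}"] show ?thesis
      by (simp add: vimage_def Int_def conj_commute)
  qed
  have "prob {z \<in> space (noise n N). g (\<lambda>i\<in>{..<n}. a i + z i) = w}
      = 1 - prob {z \<in> space (noise n N). g (\<lambda>i\<in>{..<n}. a i + z i) \<noteq> w}" for a w
    using prob_neg[of "\<lambda>z. g (\<lambda>i\<in>{..<n}. a i + z i) = w"] ev[of a w] by simp
  hence "(\<Sum>w\<in>{..<M1} \<times> {..<M2}. prob
      {z \<in> space (noise n N). g (\<lambda>i\<in>{..<n}. (x1 (fst w) i + x2 (snd w) i) + z i) = w})
    = (\<Sum>w1<M1. \<Sum>w2<M2. 1 - prob {z \<in> space (noise n N). g (channel_output n (x1 w1) (x2 w2) z) \<noteq> (w1, w2)})"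
    unfolding sum.cartesian_product channel_output_eq by (intro sum.cong) auto
  also have "\<dots> = real M1 * real M2 * (1 - error_prob n N M1 M2 x1 x2 g)"
    using M by (simp add: error_prob_def sum_subtractf field_simps)
  finally show ?thesis .
qed

lemma mac_code_converse:
  assumes P: "0 < P1" "0 < P2" and N: "0 < N" and M: "0 < M1" "0 < M2"
    and code: "mac_code P1 P2 n M1 M2 x1 x2 g"
  defines "e \<equiv> error_prob n N M1 M2 x1 x2 g"
  shows "ln (real M1) * (1 - e) \<le> n * (ln (1 + P1 / N) / 2) + 1"
    and "ln (real M2) * (1 - e) \<le> n * (ln (1 + P2 / N) / 2) + 1"
    and "ln (real M1 * real M2) * (1 - e) \<le> n * (ln (1 + (P1 + P2) / N) / 2) + 1"
proof -
  let ?W = "{..<M1} \<times> {..<M2}"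
  from code have g: "g \<in> vec_space n \<rightarrow>\<^sub>M count_space UNIV"
    and pow: "(\<Sum>w<M1. \<Sum>i<n. (x1 w i)\<^sup>2) \<le> M1 * (n * P1)" "(\<Sum>w<M2. \<Sum>i<n. (x2 w i)\<^sup>2) \<le> M2 * (n * P2)"
    using power_constraint_sum M by (auto simp: mac_code_def)
  have g': "g \<in> gauss n b V \<rightarrow>\<^sub>M count_space UNIV" for b V
    using g by (simp cong: measurable_cong_sets)
  have step: "ln K * (1 - e) \<le> n * (ln (1 + S / N) / 2) + 1"
    if "0 < S" "1 \<le> K" "(\<Sum>w\<in>?W. \<Sum>i<n. ((x1 (fst w) i + x2 (snd w) i) - b w i)\<^sup>2) \<le> card ?W * (n * S)"
      "(\<Sum>w\<in>?W. measure (gauss n (b w) (S + N)) {y \<in> space (vec_space n). g y = w}) \<le> card ?W / K"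
    for K S :: real and b
  proof -
    have "ln K * (M1 * M2 * (1 - e)) \<le> card ?W * (n * (ln (1 + S / N) / 2) + 1)"
      using sum_correct_prob_le[OF N that(1,2) g that(3,4)] sum_correct_prob[OF N M g]
      by (simp add: e_def)
    hence "(real M1 * real M2) * (ln K * (1 - e)) \<le> (real M1 * real M2) * (n * (ln (1 + S / N) / 2) + 1)"
      by (simp add: algebra_simps)
    thus ?thesis using M by (subst (asm) mult_le_cancel_left_pos) auto
  qed
  have sum_prod: "(\<Sum>w\<in>?W. h w) = (\<Sum>w1<M1. \<Sum>w2<M2. h (w1, w2))" for h :: "nat \<times> nat \<Rightarrow> real"
    by (simp add: sum.cartesian_product)
  have swap: "(\<Sum>w\<in>?W. h w) = (\<Sum>w2<M2. \<Sum>w1<M1. h (w1, w2))" for h :: "nat \<times> nat \<Rightarrow> real"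
    by (subst sum.swap) (simp add: sum.cartesian_product)
  show "ln (real M1) * (1 - e) \<le> n * (ln (1 + P1 / N) / 2) + 1"
  proof (rule step[where b = "\<lambda>w. x2 (snd w)"])
    have "(\<Sum>w\<in>?W. \<Sum>i<n. ((x1 (fst w) i + x2 (snd w) i) - x2 (snd w) i)\<^sup>2)
      = (\<Sum>w2<M2. \<Sum>w1<M1. \<Sum>i<n. (x1 w1 i)\<^sup>2)"
      by (simp add: swap)
    also have "\<dots> \<le> M2 * (M1 * (n * P1))"
      using mult_left_mono[OF pow(1), of "real M2"] by simp
    finally show "(\<Sum>w\<in>?W. \<Sum>i<n. ((x1 (fst w) i + x2 (snd w) i) - x2 (snd w) i)\<^sup>2) \<le> card ?W * (n * P1)"
      by (simp add: mult_ac)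
    \<comment> \<open>With \<open>w2\<close> fixed the reference law no longer depends on
      \<open>w1\<close>, so the \<open>M1\<close> decoding regions carry total mass at most
      1.\<close>
    have "(\<Sum>w\<in>?W. measure (gauss n (x2 (snd w)) (P1 + N)) {y \<in> space (vec_space n). g y = w})
      = (\<Sum>w2<M2. \<Sum>w1<M1. measure (gauss n (x2 w2) (P1 + N)) {y \<in> space (vec_space n). g y = (w1, w2)})"
      by (simp add: swap)
    also have "\<dots> \<le> (\<Sum>w2<M2. 1)"
      using prob_space.sum_prob_values_le_1[OF prob_space_gauss g', of "P1 + N" "{..<M1}" "\<lambda>w1. (w1, _)"] P N
      by (intro sum_mono) (auto simp: space_gauss inj_on_def)
    finally show "(\<Sum>w\<in>?W. measure (gauss n (x2 (snd w)) (P1 + N)) {y \<in> space (vec_space n). g y = w})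
        \<le> card ?W / real M1"
      using M by simp
  qed (use P M in auto)
  show "ln (real M2) * (1 - e) \<le> n * (ln (1 + P2 / N) / 2) + 1"
  proof (rule step[where b = "\<lambda>w. x1 (fst w)"])
    have "(\<Sum>w\<in>?W. \<Sum>i<n. ((x1 (fst w) i + x2 (snd w) i) - x1 (fst w) i)\<^sup>2)
      = (\<Sum>w1<M1. \<Sum>w2<M2. \<Sum>i<n. (x2 w2 i)\<^sup>2)"
      by (simp add: sum_prod)
    also have "\<dots> \<le> M1 * (M2 * (n * P2))"
      using mult_left_mono[OF pow(2), of "real M1"] by simp
    finally show "(\<Sum>w\<in>?W. \<Sum>i<n. ((x1 (fst w) i + x2 (snd w) i) - x1 (fst w) i)\<^sup>2) \<le> card ?W * (n * P2)"
      by (simp add: mult_ac)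
    have "(\<Sum>w\<in>?W. measure (gauss n (x1 (fst w)) (P2 + N)) {y \<in> space (vec_space n). g y = w})
      = (\<Sum>w1<M1. \<Sum>w2<M2. measure (gauss n (x1 w1) (P2 + N)) {y \<in> space (vec_space n). g y = (w1, w2)})"
      by (simp add: sum_prod)
    also have "\<dots> \<le> (\<Sum>w1<M1. 1)"
      using prob_space.sum_prob_values_le_1[OF prob_space_gauss g', of "P2 + N" "{..<M2}" "\<lambda>w2. (_, w2)"] P N
      by (intro sum_mono) (auto simp: space_gauss inj_on_def)
    finally show "(\<Sum>w\<in>?W. measure (gauss n (x1 (fst w)) (P2 + N)) {y \<in> space (vec_space n). g y = w})
        \<le> card ?W / real M2"
      using M by simp
  qed (use P M in auto)
  show "ln (real M1 * real M2) * (1 - e) \<le> n * (ln (1 + (P1 + P2) / N) / 2) + 1"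
  proof (rule step)
    \<comment> \<open>A mean independent of both messages, so that the decoder has to guess the
      whole pair.\<close>
    let ?b = "\<lambda>(_::nat \<times> nat) i. (\<Sum>w<M1. x1 w i) / M1 + (\<Sum>w<M2. x2 w i) / M2"
    have "(\<Sum>w\<in>?W. \<Sum>i<n. ((x1 (fst w) i + x2 (snd w) i) - ?b w i)\<^sup>2)
      = (\<Sum>i<n. \<Sum>w\<in>?W. ((x1 (fst w) i + x2 (snd w) i) - ?b w i)\<^sup>2)"
      by (rule sum.swap)
    also have "\<dots> \<le> (\<Sum>i<n. M2 * (\<Sum>w<M1. (x1 w i)\<^sup>2) + M1 * (\<Sum>w<M2. (x2 w i)\<^sup>2))"
      by (intro sum_mono sum_square_centered_le M)
    also have "\<dots> = M2 * (\<Sum>w<M1. \<Sum>i<n. (x1 w i)\<^sup>2) + M1 * (\<Sum>w<M2. \<Sum>i<n. (x2 w i)\<^sup>2)"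
      by (subst (1 2) sum.swap) (simp add: sum.distrib sum_distrib_left)
    also have "\<dots> \<le> M2 * (M1 * (n * P1)) + M1 * (M2 * (n * P2))"
      by (intro add_mono mult_left_mono pow) auto
    finally show "(\<Sum>w\<in>?W. \<Sum>i<n. ((x1 (fst w) i + x2 (snd w) i) - ?b w i)\<^sup>2) \<le> card ?W * (n * (P1 + P2))"
      by (simp add: algebra_simps)
    have "(\<Sum>w\<in>?W. measure (gauss n (?b w) (P1 + P2 + N)) {y \<in> space (vec_space n). g y = w}) \<le> 1"
      using prob_space.sum_prob_values_le_1[OF prob_space_gauss g', of "P1 + P2 + N" ?W "\<lambda>w. w"] P N
      by (auto simp: space_gauss)
    thus "(\<Sum>w\<in>?W. measure (gauss n (?b w) (P1 + P2 + N)) {y \<in> space (vec_space n). g y = w})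
        \<le> card ?W / (real M1 * real M2)"
      using M by simp
    have "1 \<le> M1 * M2" using M by simp
    thus "1 \<le> real M1 * real M2" by (metis of_nat_1 of_nat_le_iff of_nat_mult)
  qed (use P in auto)
qed

lemma exp_le_message_count: "exp (real n * R) \<le> message_count n R"
  unfolding message_count_def by (meson of_nat_ceiling)

lemma message_count_pos: "0 < message_count n R"
  using less_le_trans[OF exp_gt_zero exp_le_message_count[of n R]] by simp

lemma rate_le_if_error_tendsto_0:
  fixes e :: "nat \<Rightarrow> real" and R C :: real
  assumes e: "e \<longlonglongrightarrow> 0" and le: "\<And>n. real n * R * (1 - e n) \<le> n * C + 1"
  shows "R \<le> C"
proof (rule LIMSEQ_le)
  show "(\<lambda>n. R * (1 - e n)) \<longlonglongrightarrow> R"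
    using tendsto_mult[OF tendsto_const tendsto_diff[OF tendsto_const e], of R 1] by simp
  show "(\<lambda>n. C + 1 / real n) \<longlonglongrightarrow> C"
    using tendsto_add[OF tendsto_const lim_1_over_n, of C] by simp
  have "R * (1 - e n) \<le> C + 1 / real n" if "n \<ge> 1" for n
    using le[of n] that by (simp add: field_simps)
  thus "\<exists>k. \<forall>n\<ge>k. R * (1 - e n) \<le> C + 1 / real n" by blast
qed

lemma mac_achievable_imp_pentagon:
  assumes P: "0 < P1" "0 < P2" and N: "0 < N" and ach: "mac_achievable P1 P2 N R1 R2"
  shows "(R1, R2) \<in> mac_pentagon P1 P2 N"
proof -
  let ?M = message_count
  from ach obtain x1 x2 g where R: "0 \<le> R1" "0 \<le> R2"
    and code: "\<And>n. mac_code P1 P2 n (?M n R1) (?M n R2) (x1 n) (x2 n) (g n)"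
    and err: "(\<lambda>n. error_prob n N (?M n R1) (?M n R2) (x1 n) (x2 n) (g n)) \<longlonglongrightarrow> 0"
    unfolding mac_achievable_def by blast
  define e where "e n = error_prob n N (?M n R1) (?M n R2) (x1 n) (x2 n) (g n)" for n
  have e: "e \<longlonglongrightarrow> 0" using err by (simp add: e_def[abs_def])
  \<comment> \<open>The lower bound on the logarithm of the message count is multiplied by
    \<open>1 - e n\<close>, which must therefore be nonnegative.\<close>
  have le1: "e n \<le> 1" for n
  proof -
    interpret prob_space "noise n N"
      unfolding noise_eq_gauss by (rule prob_space_gauss) fact
    have "(\<Sum>w1<?M n R1. \<Sum>w2<?M n R2. prob {z \<in> space (noise n N). g n (channel_output n (x1 n w1) (x2 n w2) z) \<noteq> (w1, w2)})
        \<le> (\<Sum>w1<?M n R1. \<Sum>w2<?M n R2. 1)"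
      by (intro sum_mono) simp
    thus ?thesis unfolding e_def error_prob_def
      by (simp add: divide_le_eq_1 message_count_pos)
  qed
  have ln_M: "real n * R \<le> ln (real (?M n R))" for n R
    using exp_le_message_count[of n R] message_count_pos[of n R]
    by (simp add: ln_ge_iff)
  note conv = mac_code_converse[OF P N message_count_pos message_count_pos code, folded e_def]
  have "R1 \<le> ln (1 + P1 / N) / 2"
  proof (rule rate_le_if_error_tendsto_0[OF e])
    fix n show "real n * R1 * (1 - e n) \<le> n * (ln (1 + P1 / N) / 2) + 1"
      using mult_right_mono[OF ln_M[of n R1], of "1 - e n"] conv(1)[of n] le1[of n] by simp
  qed
  moreover have "R2 \<le> ln (1 + P2 / N) / 2"
  proof (rule rate_le_if_error_tendsto_0[OF e])
    fix n show "real n * R2 * (1 - e n) \<le> n * (ln (1 + P2 / N) / 2) + 1"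
      using mult_right_mono[OF ln_M[of n R2], of "1 - e n"] conv(2)[of n] le1[of n] by simp
  qed
  moreover have "R1 + R2 \<le> ln (1 + (P1 + P2) / N) / 2"
  proof (rule rate_le_if_error_tendsto_0[OF e])
    fix n
    have "real n * (R1 + R2) \<le> ln (real (?M n R1) * real (?M n R2))"
      using ln_M[of n R1] ln_M[of n R2] by (simp add: ln_mult message_count_pos algebra_simps)
    thus "real n * (R1 + R2) * (1 - e n) \<le> n * (ln (1 + (P1 + P2) / N) / 2) + 1"
      using mult_right_mono[of "real n * (R1 + R2)" _ "1 - e n"] conv(3)[of n] le1[of n] by fastforce
  qed
  ultimately show ?thesis using R by (simp add: mac_pentagon_def)
qed

section \<open>Random coding for two senders\<close>

lemma nn_integral_triple_pair_measure:
  fixes f :: "'a \<times> 'b \<times> 'c \<Rightarrow> ennreal"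
  assumes B: "prob_space B" and C: "prob_space C"
    and f [measurable]: "f \<in> borel_measurable (A \<Otimes>\<^sub>M B \<Otimes>\<^sub>M C)"
  shows "(\<integral>\<^sup>+p. f p \<partial>(A \<Otimes>\<^sub>M B \<Otimes>\<^sub>M C)) = (\<integral>\<^sup>+x. \<integral>\<^sup>+y. \<integral>\<^sup>+z. f (x, y, z) \<partial>C \<partial>B \<partial>A)"
proof -
  interpret B: prob_space B by fact
  interpret C: prob_space C by fact
  interpret BC: pair_prob_space B C ..
  have "(\<integral>\<^sup>+p. f p \<partial>(A \<Otimes>\<^sub>M B \<Otimes>\<^sub>M C)) = (\<integral>\<^sup>+x. \<integral>\<^sup>+q. f (x, q) \<partial>(B \<Otimes>\<^sub>M C) \<partial>A)"
    by (rule BC.P.nn_integral_fst[symmetric]) measurable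
  also have "\<dots> = (\<integral>\<^sup>+x. \<integral>\<^sup>+y. \<integral>\<^sup>+z. f (x, y, z) \<partial>C \<partial>B \<partial>A)"
    by (intro nn_integral_cong C.nn_integral_fst[symmetric]) measurable
  finally show ?thesis .
qed

lemma nn_integral_PiM_component:
  assumes M: "\<And>i. i \<in> I \<Longrightarrow> prob_space (M i)" and i: "i \<in> I" and f: "f \<in> borel_measurable (M i)"
  shows "(\<integral>\<^sup>+c. f (c i) \<partial>PiM I M) = (\<integral>\<^sup>+x. f x \<partial>M i)"
proof -
  have "(\<integral>\<^sup>+x. f x \<partial>M i) = (\<integral>\<^sup>+x. f x \<partial>distr (PiM I M) (M i) (\<lambda>c. c i))"
    using distr_PiM_component[of I M i] M i by simp
  also have "\<dots> = (\<integral>\<^sup>+c. f (c i) \<partial>PiM I M)"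
    using i f by (intro nn_integral_distr) auto
  finally show ?thesis by simp
qed

text \<open>Distinct codewords of a random codebook are independent. The integral over the
  competitor \<open>c i\<close> comes out innermost, the order in which the confusion bounds are
  applied.\<close>

lemma nn_integral_PiM_two_components:
  fixes f :: "'a \<Rightarrow> 'a \<Rightarrow> ennreal"
  assumes A: "prob_space A" and I: "finite I" "i \<in> I" "j \<in> I" "i \<noteq> j"
    and f: "case_prod f \<in> borel_measurable (A \<Otimes>\<^sub>M A)"
  shows "(\<integral>\<^sup>+c. f (c i) (c j) \<partial>PiM I (\<lambda>_. A)) = (\<integral>\<^sup>+x. \<integral>\<^sup>+v. f v x \<partial>A \<partial>A)"
proof -
  interpret A: prob_space A by fact
  interpret product_prob_space "\<lambda>_. A" UNIV
    by (rule product_prob_spaceI) fact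
  note [measurable] = f
  define J where "J = I - {i}"
  have J: "finite J" "i \<notin> J" "I = insert i J" "j \<in> J" using I by (auto simp: J_def)
  have [measurable]: "(\<lambda>c. c i) \<in> PiM (insert i J) (\<lambda>_. A) \<rightarrow>\<^sub>M A"
    "(\<lambda>c. c j) \<in> PiM (insert i J) (\<lambda>_. A) \<rightarrow>\<^sub>M A"
    using J by (auto intro!: measurable_component_singleton)
  have [measurable]: "(\<lambda>c. f (c i) (c j)) \<in> borel_measurable (PiM (insert i J) (\<lambda>_. A))"
    using measurable_compose[OF _ f, of "\<lambda>c. (c i, c j)"] by simp
  have [measurable]: "(\<lambda>x. \<integral>\<^sup>+v. f v x \<partial>A) \<in> borel_measurable A"
    by measurable
  have "(\<integral>\<^sup>+c. f (c i) (c j) \<partial>PiM I (\<lambda>_. A))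
     = (\<integral>\<^sup>+c. \<integral>\<^sup>+v. f ((c(i := v)) i) ((c(i := v)) j) \<partial>A \<partial>PiM J (\<lambda>_. A))"
    unfolding J(3) by (rule product_nn_integral_insert[OF J(1,2)]) simp
  also have "\<dots> = (\<integral>\<^sup>+c. \<integral>\<^sup>+v. f v (c j) \<partial>A \<partial>PiM J (\<lambda>_. A))"
    using I by simp
  also have "\<dots> = (\<integral>\<^sup>+x. \<integral>\<^sup>+v. f v x \<partial>A \<partial>A)"
    by (rule nn_integral_PiM_component[where f = "\<lambda>x. \<integral>\<^sup>+v. f v x \<partial>A"]) (use A J in auto)
  finally show ?thesis .
qed

lemma (in prob_space) nn_integral_le_const_prob:
  assumes "\<And>x. x \<in> space M \<Longrightarrow> f x \<le> c" shows "(\<integral>\<^sup>+x. f x \<partial>M) \<le> c"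
proof -
  have "(\<integral>\<^sup>+x. f x \<partial>M) \<le> (\<integral>\<^sup>+x. c \<partial>M)" by (intro nn_integral_mono assms)
  thus ?thesis by (simp add: emeasure_space_1)
qed

lemma (in prob_space) const_le_nn_integral_prob:
  assumes "\<And>x. x \<in> space M \<Longrightarrow> c \<le> f x" shows "c \<le> (\<integral>\<^sup>+x. f x \<partial>M)"
proof -
  have "(\<integral>\<^sup>+x. c \<partial>M) \<le> (\<integral>\<^sup>+x. f x \<partial>M)" by (intro nn_integral_mono assms)
  thus ?thesis by (simp add: emeasure_space_1)
qed

text \<open>\<open>S0\<close> holds the atypical triples of two codewords and noise; \<open>S1\<close>, \<open>S2\<close>, \<open>S12\<close> hold the
  pairs of candidate codewords that remain plausible for an output when the first, the second or
  both of them are wrong.\<close>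

locale random_coding =
  A1: prob_space A1 + A2: prob_space A2 + Z: prob_space Z
  for A1 :: "'a measure" and A2 :: "'b measure" and Z :: "'z measure" +
  fixes Y :: "'y measure" and H :: "'a \<times> 'b \<times> 'z \<Rightarrow> 'y"
    and S0 :: "('a \<times> 'b \<times> 'z) set" and S1 S2 S12 :: "('a \<times> 'b \<times> 'y) set"
    and e0 e1 e2 e12 :: real
  assumes H [measurable]: "H \<in> A1 \<Otimes>\<^sub>M A2 \<Otimes>\<^sub>M Z \<rightarrow>\<^sub>M Y"
    and S0 [measurable]: "S0 \<in> sets (A1 \<Otimes>\<^sub>M A2 \<Otimes>\<^sub>M Z)"
    and S1 [measurable]: "S1 \<in> sets (A1 \<Otimes>\<^sub>M A2 \<Otimes>\<^sub>M Y)"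
    and S2 [measurable]: "S2 \<in> sets (A1 \<Otimes>\<^sub>M A2 \<Otimes>\<^sub>M Y)"
    and S12 [measurable]: "S12 \<in> sets (A1 \<Otimes>\<^sub>M A2 \<Otimes>\<^sub>M Y)"
    and nonneg: "0 \<le> e0" "0 \<le> e1" "0 \<le> e2" "0 \<le> e12"
    and e0: "(\<integral>\<^sup>+x1. \<integral>\<^sup>+x2. \<integral>\<^sup>+z. indicator S0 (x1, x2, z) \<partial>Z \<partial>A2 \<partial>A1) \<le> ennreal e0"
    and e1: "\<And>x2 y. x2 \<in> space A2 \<Longrightarrow> y \<in> space Y \<Longrightarrow> (\<integral>\<^sup>+v. indicator S1 (v, x2, y) \<partial>A1) \<le> ennreal e1"
    and e2: "\<And>x1 y. x1 \<in> space A1 \<Longrightarrow> y \<in> space Y \<Longrightarrow> (\<integral>\<^sup>+v. indicator S2 (x1, v, y) \<partial>A2) \<le> ennreal e2"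
    and e12: "\<And>y. y \<in> space Y \<Longrightarrow> (\<integral>\<^sup>+v1. \<integral>\<^sup>+v2. indicator S12 (v1, v2, y) \<partial>A2 \<partial>A1) \<le> ennreal e12"
begin

abbreviation "codebook1 M \<equiv> PiM {..<M} (\<lambda>_::nat. A1)"
abbreviation "codebook2 M \<equiv> PiM {..<M} (\<lambda>_::nat. A2)"

sublocale A2Z: pair_sigma_finite A2 Z ..
sublocale A12Z: pair_sigma_finite A1 "A2 \<Otimes>\<^sub>M Z"
proof -
  interpret pair_prob_space A2 Z ..
  show "pair_sigma_finite A1 (A2 \<Otimes>\<^sub>M Z)" ..
qed

text \<open>Competitors are sorted by which sent codeword they share, because this decides how much
  independent randomness is left: only the codewords that differ from the sent ones can be averaged
  out with the output held fixed.\<close>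

definition confusion ::
    "nat \<Rightarrow> nat \<Rightarrow> (nat \<Rightarrow> 'a) \<Rightarrow> (nat \<Rightarrow> 'b) \<Rightarrow> nat \<Rightarrow> nat \<Rightarrow> 'z \<Rightarrow> bool" where
  "confusion M1 M2 c1 c2 w1 w2 z \<longleftrightarrow>
     (let y = H (c1 w1, c2 w2, z) in
       (c1 w1, c2 w2, z) \<in> S0 \<or>
       (\<exists>v1\<in>{..<M1} - {w1}. (c1 v1, c2 w2, y) \<in> S1) \<or>
       (\<exists>v2\<in>{..<M2} - {w2}. (c1 w1, c2 v2, y) \<in> S2) \<or>
       (\<exists>v1\<in>{..<M1} - {w1}. \<exists>v2\<in>{..<M2} - {w2}. (c1 v1, c2 v2, y) \<in> S12))"

text \<open>The union bound, as a pointwise inequality of integrands so that it can be integrated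
  over codebooks and noise together.\<close>

lemma confusion_sum:
  fixes M1 M2
  defines "W1 \<equiv> \<lambda>w. {..<M1} - {w}" and "W2 \<equiv> \<lambda>w. {..<M2} - {w}"
  shows "indicator {z. confusion M1 M2 c1 c2 w1 w2 z} z
    \<le> indicator S0 (c1 w1, c2 w2, z)
      + (\<Sum>v1\<in>W1 w1. indicator S1 (c1 v1, c2 w2, H (c1 w1, c2 w2, z)))
      + (\<Sum>v2\<in>W2 w2. indicator S2 (c1 w1, c2 v2, H (c1 w1, c2 w2, z)))
      + (\<Sum>v1\<in>W1 w1. \<Sum>v2\<in>W2 w2. indicator S12 (c1 v1, c2 v2, H (c1 w1, c2 w2, z)) :: ennreal)"
    (is "_ \<le> ?s0 + ?s1 + ?s2 + ?s12")
proof (cases "confusion M1 M2 c1 c2 w1 w2 z")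
  case True
  have one: "1 \<le> (\<Sum>v\<in>V. f v)" if "finite V" "v \<in> V" "f v = (1 :: ennreal)" for V v and f :: "nat \<Rightarrow> ennreal"
    using member_le_sum[OF that(2) _ that(1), of f] that(3) by simp
  have fin: "finite (W1 w)" "finite (W2 w)" for w by (auto simp: W1_def W2_def)
  let ?y = "H (c1 w1, c2 w2, z)"
  consider "(c1 w1, c2 w2, z) \<in> S0" | v1 where "v1 \<in> W1 w1" "(c1 v1, c2 w2, ?y) \<in> S1"
    | v2 where "v2 \<in> W2 w2" "(c1 w1, c2 v2, ?y) \<in> S2"
    | v1 v2 where "v1 \<in> W1 w1" "v2 \<in> W2 w2" "(c1 v1, c2 v2, ?y) \<in> S12"
    using True unfolding confusion_def Let_def W1_def W2_def by blast
  hence "1 \<le> ?s0 \<or> 1 \<le> ?s1 \<or> 1 \<le> ?s2 \<or> 1 \<le> ?s12"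
  proof cases
    case 1 thus ?thesis by simp
  next
    case 2
    hence "1 \<le> ?s1" by (intro one[OF fin(1)]) auto
    thus ?thesis by blast
  next
    case 3
    hence "1 \<le> ?s2" by (intro one[OF fin(2)]) auto
    thus ?thesis by blast
  next
    case 4
    hence "1 \<le> (\<Sum>v2\<in>W2 w2. indicator S12 (c1 v1, c2 v2, ?y) :: ennreal)"
      by (intro one[OF fin(2)]) auto
    also have "\<dots> \<le> ?s12" using fin 4 by (intro member_le_sum) auto
    finally show ?thesis by blast
  qed
  hence "1 \<le> ?s0 + ?s1 + ?s2 + ?s12"
  proof -
    have "a \<le> a + b + c + d" "b \<le> a + b + c + d" "c \<le> a + b + c + d" "d \<le> a + b + c + d"
      for a b c d :: ennreal
      by (simp_all add: add_increasing add_increasing2)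
    with \<open>1 \<le> ?s0 \<or> 1 \<le> ?s1 \<or> 1 \<le> ?s2 \<or> 1 \<le> ?s12\<close> show ?thesis
      by (meson order_trans)
  qed
  thus ?thesis by (simp add: indicator_def)
qed simp

lemma typical_term:
  assumes w: "w1 < M1" "w2 < M2"
  shows "(\<integral>\<^sup>+c1. \<integral>\<^sup>+c2. \<integral>\<^sup>+z. indicator S0 (c1 w1, c2 w2, z) \<partial>Z \<partial>codebook2 M2 \<partial>codebook1 M1) \<le> ennreal e0"
proof -
  have "(\<integral>\<^sup>+c2. \<integral>\<^sup>+z. indicator S0 (x1, c2 w2, z) \<partial>Z \<partial>codebook2 M2)
      = (\<integral>\<^sup>+x2. \<integral>\<^sup>+z. indicator S0 (x1, x2, z) \<partial>Z \<partial>A2)" if "x1 \<in> space A1" for x1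
    using that w A2.prob_space_axioms
    by (intro nn_integral_PiM_component[where f = "\<lambda>x2. \<integral>\<^sup>+z. indicator S0 (x1, x2, z) \<partial>Z"]) auto
  hence "(\<integral>\<^sup>+c1. \<integral>\<^sup>+c2. \<integral>\<^sup>+z. indicator S0 (c1 w1, c2 w2, z) \<partial>Z \<partial>codebook2 M2 \<partial>codebook1 M1)
      = (\<integral>\<^sup>+c1. \<integral>\<^sup>+x2. \<integral>\<^sup>+z. indicator S0 (c1 w1, x2, z) \<partial>Z \<partial>A2 \<partial>codebook1 M1)"
    using w by (intro nn_integral_cong) (auto simp: space_PiM PiE_iff)
  also have "\<dots> = (\<integral>\<^sup>+x1. \<integral>\<^sup>+x2. \<integral>\<^sup>+z. indicator S0 (x1, x2, z) \<partial>Z \<partial>A2 \<partial>A1)"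
    using w A1.prob_space_axioms
    by (intro nn_integral_PiM_component[where f = "\<lambda>x1. \<integral>\<^sup>+x2. \<integral>\<^sup>+z. indicator S0 (x1, x2, z) \<partial>Z \<partial>A2"]) auto
  finally show ?thesis using e0 by simp
qed

text \<open>The output is a function of the sent codewords and the noise, all independent of the
  competitor \<open>c1 v1\<close>. Fubini moves the competitor's integral inside, where
  \<open>e1\<close> applies to each fixed output.\<close>

lemma confusion1_term:
  assumes w: "w1 < M1" "w2 < M2" "v1 < M1" "v1 \<noteq> w1"
  shows "(\<integral>\<^sup>+c1. \<integral>\<^sup>+c2. \<integral>\<^sup>+z. indicator S1 (c1 v1, c2 w2, H (c1 w1, c2 w2, z)) \<partial>Z \<partial>codebook2 M2 \<partial>codebook1 M1)
    \<le> ennreal e1"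
proof -
  let ?f = "\<lambda>v x1 x2. \<integral>\<^sup>+z. indicator S1 (v, x2, H (x1, x2, z)) \<partial>Z :: ennreal"
  have "(\<integral>\<^sup>+c2. ?f v x1 (c2 w2) \<partial>codebook2 M2) = (\<integral>\<^sup>+x2. ?f v x1 x2 \<partial>A2)"
    if "x1 \<in> space A1" "v \<in> space A1" for x1 v
    using that w A2.prob_space_axioms by (intro nn_integral_PiM_component[where f = "?f v x1"]) auto
  hence "(\<integral>\<^sup>+c1. \<integral>\<^sup>+c2. ?f (c1 v1) (c1 w1) (c2 w2) \<partial>codebook2 M2 \<partial>codebook1 M1)
      = (\<integral>\<^sup>+c1. \<integral>\<^sup>+x2. ?f (c1 v1) (c1 w1) x2 \<partial>A2 \<partial>codebook1 M1)"
    using w by (intro nn_integral_cong) (auto simp: space_PiM PiE_iff)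
  also have "\<dots> = (\<integral>\<^sup>+x1. \<integral>\<^sup>+v. \<integral>\<^sup>+x2. ?f v x1 x2 \<partial>A2 \<partial>A1 \<partial>A1)"
    using w A1.prob_space_axioms by (intro nn_integral_PiM_two_components) auto
  also have "\<dots> \<le> ennreal e1"
  proof (rule A1.nn_integral_le_const_prob)
    fix x1 assume [measurable]: "x1 \<in> space A1"
    have "(\<integral>\<^sup>+v. \<integral>\<^sup>+x2. ?f v x1 x2 \<partial>A2 \<partial>A1)
        = (\<integral>\<^sup>+v. \<integral>\<^sup>+p. indicator S1 (v, fst p, H (x1, fst p, snd p)) \<partial>(A2 \<Otimes>\<^sub>M Z) \<partial>A1)"
      by (intro nn_integral_cong, subst Z.nn_integral_fst[symmetric]) auto
    also have "\<dots> = (\<integral>\<^sup>+p. \<integral>\<^sup>+v. indicator S1 (v, fst p, H (x1, fst p, snd p)) \<partial>A1 \<partial>(A2 \<Otimes>\<^sub>M Z))"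
      by (rule A12Z.Fubini'[symmetric]) measurable
    also have "\<dots> \<le> ennreal e1"
    proof (rule prob_space.nn_integral_le_const_prob)
      interpret A2Z': pair_prob_space A2 Z ..
      show "prob_space (A2 \<Otimes>\<^sub>M Z)" by (rule A2Z'.P.prob_space_axioms)
      fix p assume "p \<in> space (A2 \<Otimes>\<^sub>M Z)"
      hence "fst p \<in> space A2" "H (x1, fst p, snd p) \<in> space Y"
        using \<open>x1 \<in> space A1\<close> by (auto simp: space_pair_measure intro!: measurable_space[OF H])
      thus "(\<integral>\<^sup>+v. indicator S1 (v, fst p, H (x1, fst p, snd p)) \<partial>A1) \<le> ennreal e1" by (rule e1)
    qed
    finally show "(\<integral>\<^sup>+v. \<integral>\<^sup>+x2. ?f v x1 x2 \<partial>A2 \<partial>A1) \<le> ennreal e1" .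
  qed
  finally show ?thesis .
qed

text \<open>Here the first codebook enters only through \<open>c1 w1\<close>, so it can be frozen
  and the bound holds uniformly in it.\<close>

lemma confusion2_term:
  assumes w: "w1 < M1" "w2 < M2" "v2 < M2" "v2 \<noteq> w2"
  shows "(\<integral>\<^sup>+c1. \<integral>\<^sup>+c2. \<integral>\<^sup>+z. indicator S2 (c1 w1, c2 v2, H (c1 w1, c2 w2, z)) \<partial>Z \<partial>codebook2 M2 \<partial>codebook1 M1)
    \<le> ennreal e2"
proof (rule prob_space.nn_integral_le_const_prob)
  show "prob_space (codebook1 M1)" by (intro prob_space_PiM A1.prob_space_axioms)
  fix c1 assume "c1 \<in> space (codebook1 M1)"
  hence x1 [measurable]: "c1 w1 \<in> space A1" using w by (auto simp: space_PiM)
  let ?f = "\<lambda>v x2. \<integral>\<^sup>+z. indicator S2 (c1 w1, v, H (c1 w1, x2, z)) \<partial>Z :: ennreal"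
  have "(\<integral>\<^sup>+c2. ?f (c2 v2) (c2 w2) \<partial>codebook2 M2) = (\<integral>\<^sup>+x2. \<integral>\<^sup>+v. ?f v x2 \<partial>A2 \<partial>A2)"
    using w A2.prob_space_axioms by (intro nn_integral_PiM_two_components) auto
  also have "\<dots> \<le> ennreal e2"
  proof (rule A2.nn_integral_le_const_prob)
    fix x2 assume x2 [measurable]: "x2 \<in> space A2"
    have "(\<integral>\<^sup>+v. ?f v x2 \<partial>A2) = (\<integral>\<^sup>+z. \<integral>\<^sup>+v. indicator S2 (c1 w1, v, H (c1 w1, x2, z)) \<partial>A2 \<partial>Z)"
      by (rule A2Z.Fubini'[symmetric]) measurable
    also have "\<dots> \<le> ennreal e2"
    proof (rule Z.nn_integral_le_const_prob)
      fix z assume "z \<in> space Z"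
      hence "H (c1 w1, x2, z) \<in> space Y"
        using x1 x2 by (auto simp: space_pair_measure intro!: measurable_space[OF H])
      thus "(\<integral>\<^sup>+v. indicator S2 (c1 w1, v, H (c1 w1, x2, z)) \<partial>A2) \<le> ennreal e2" by (rule e2[OF x1])
    qed
    finally show "(\<integral>\<^sup>+v. ?f v x2 \<partial>A2) \<le> ennreal e2" .
  qed
  finally show "(\<integral>\<^sup>+c2. ?f (c2 v2) (c2 w2) \<partial>codebook2 M2) \<le> ennreal e2" .
qed

lemma confusion12_term:
  assumes w: "w1 < M1" "w2 < M2" "v1 < M1" "v1 \<noteq> w1" "v2 < M2" "v2 \<noteq> w2"
  shows "(\<integral>\<^sup>+c1. \<integral>\<^sup>+c2. \<integral>\<^sup>+z. indicator S12 (c1 v1, c2 v2, H (c1 w1, c2 w2, z)) \<partial>Z \<partial>codebook2 M2 \<partial>codebook1 M1)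
    \<le> ennreal e12"
proof -
  \<comment> \<open>\<open>?g\<close> has the second wrong codeword already integrated out; moving
    the integral over the first one inside then gives the double integral bounded by
    \<open>e12\<close>.\<close>
  let ?g = "\<lambda>u y. \<integral>\<^sup>+v. indicator S12 (u, v, y) \<partial>A2 :: ennreal"
  let ?f = "\<lambda>u x1 v x2. \<integral>\<^sup>+z. indicator S12 (u, v, H (x1, x2, z)) \<partial>Z :: ennreal"
  have "(\<integral>\<^sup>+c2. ?f u x1 (c2 v2) (c2 w2) \<partial>codebook2 M2) = (\<integral>\<^sup>+x2. \<integral>\<^sup>+z. ?g u (H (x1, x2, z)) \<partial>Z \<partial>A2)"
    if [measurable]: "x1 \<in> space A1" "u \<in> space A1" for x1 u
  proof -
    have "(\<integral>\<^sup>+c2. ?f u x1 (c2 v2) (c2 w2) \<partial>codebook2 M2) = (\<integral>\<^sup>+x2. \<integral>\<^sup>+v. ?f u x1 v x2 \<partial>A2 \<partial>A2)"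
      using w A2.prob_space_axioms by (intro nn_integral_PiM_two_components) auto
    also have "\<dots> = (\<integral>\<^sup>+x2. \<integral>\<^sup>+z. ?g u (H (x1, x2, z)) \<partial>Z \<partial>A2)"
    proof (rule nn_integral_cong)
      fix x2 assume [measurable]: "x2 \<in> space A2"
      show "(\<integral>\<^sup>+v. ?f u x1 v x2 \<partial>A2) = (\<integral>\<^sup>+z. ?g u (H (x1, x2, z)) \<partial>Z)"
        by (rule A2Z.Fubini'[symmetric]) measurable
    qed
    finally show ?thesis .
  qed
  hence "(\<integral>\<^sup>+c1. \<integral>\<^sup>+c2. ?f (c1 v1) (c1 w1) (c2 v2) (c2 w2) \<partial>codebook2 M2 \<partial>codebook1 M1)
      = (\<integral>\<^sup>+c1. \<integral>\<^sup>+x2. \<integral>\<^sup>+z. ?g (c1 v1) (H (c1 w1, x2, z)) \<partial>Z \<partial>A2 \<partial>codebook1 M1)"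
    using w by (intro nn_integral_cong) (auto simp: space_PiM PiE_iff)
  also have "\<dots> = (\<integral>\<^sup>+x1. \<integral>\<^sup>+u. \<integral>\<^sup>+x2. \<integral>\<^sup>+z. ?g u (H (x1, x2, z)) \<partial>Z \<partial>A2 \<partial>A1 \<partial>A1)"
    using w A1.prob_space_axioms by (intro nn_integral_PiM_two_components) auto
  also have "\<dots> \<le> ennreal e12"
  proof (rule A1.nn_integral_le_const_prob)
    fix x1 assume [measurable]: "x1 \<in> space A1"
    have "(\<integral>\<^sup>+u. \<integral>\<^sup>+x2. \<integral>\<^sup>+z. ?g u (H (x1, x2, z)) \<partial>Z \<partial>A2 \<partial>A1)
        = (\<integral>\<^sup>+u. \<integral>\<^sup>+p. ?g u (H (x1, fst p, snd p)) \<partial>(A2 \<Otimes>\<^sub>M Z) \<partial>A1)"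
      by (intro nn_integral_cong, subst Z.nn_integral_fst[symmetric]) auto
    also have "\<dots> = (\<integral>\<^sup>+p. \<integral>\<^sup>+u. ?g u (H (x1, fst p, snd p)) \<partial>A1 \<partial>(A2 \<Otimes>\<^sub>M Z))"
      by (rule A12Z.Fubini'[symmetric]) measurable
    also have "\<dots> \<le> ennreal e12"
    proof (rule prob_space.nn_integral_le_const_prob)
      interpret A2Z': pair_prob_space A2 Z ..
      show "prob_space (A2 \<Otimes>\<^sub>M Z)" by (rule A2Z'.P.prob_space_axioms)
      fix p assume "p \<in> space (A2 \<Otimes>\<^sub>M Z)"
      hence "H (x1, fst p, snd p) \<in> space Y"
        using \<open>x1 \<in> space A1\<close> by (auto simp: space_pair_measure intro!: measurable_space[OF H])
      thus "(\<integral>\<^sup>+u. ?g u (H (x1, fst p, snd p)) \<partial>A1) \<le> ennreal e12" by (rule e12)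
    qed
    finally show "(\<integral>\<^sup>+u. \<integral>\<^sup>+x2. \<integral>\<^sup>+z. ?g u (H (x1, x2, z)) \<partial>Z \<partial>A2 \<partial>A1) \<le> ennreal e12" .
  qed
  finally show ?thesis .
qed

text \<open>The majorant \<open>G\<close> comes from the union bound and is visibly measurable in
  the codebooks, so the dependence of the confusion probability itself on them never has to be shown
  measurable.\<close>

lemma average_confusion:
  assumes w: "w1 < M1" "w2 < M2"
  obtains G where "G \<in> borel_measurable (codebook1 M1 \<Otimes>\<^sub>M codebook2 M2)"
    and "\<And>c1 c2. emeasure Z {z \<in> space Z. confusion M1 M2 c1 c2 w1 w2 z} \<le> G (c1, c2)"
    and "(\<integral>\<^sup>+p. G p \<partial>(codebook1 M1 \<Otimes>\<^sub>M codebook2 M2)) \<le> ennreal (e0 + M1 * e1 + M2 * e2 + M1 * (M2 * e12))"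
proof -
  let ?C1 = "codebook1 M1" and ?C2 = "codebook2 M2"
  define W1 W2 where "W1 = {..<M1} - {w1}" and "W2 = {..<M2} - {w2}"
  have m1: "(\<lambda>c. c v) \<in> ?C1 \<rightarrow>\<^sub>M A1" if "v < M1" for v
    using that by (auto intro!: measurable_component_singleton)
  have m2: "(\<lambda>c. c v) \<in> ?C2 \<rightarrow>\<^sub>M A2" if "v < M2" for v
    using that by (auto intro!: measurable_component_singleton)
  note [measurable] = m1[OF w(1)] m2[OF w(2)]
  interpret C1: prob_space ?C1 by (intro prob_space_PiM A1.prob_space_axioms)
  interpret C2: prob_space ?C2 by (intro prob_space_PiM A2.prob_space_axioms)
  define F0 where "F0 = (\<lambda>(c1, c2, z). indicator S0 (c1 w1, c2 w2, z) :: ennreal)"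
  define F1 where "F1 v1 = (\<lambda>(c1, c2, z). indicator S1 (c1 v1, c2 w2, H (c1 w1, c2 w2, z)) :: ennreal)" for v1
  define F2 where "F2 v2 = (\<lambda>(c1, c2, z). indicator S2 (c1 w1, c2 v2, H (c1 w1, c2 w2, z)) :: ennreal)" for v2
  define F12 where "F12 v1 v2 = (\<lambda>(c1, c2, z). indicator S12 (c1 v1, c2 v2, H (c1 w1, c2 w2, z)) :: ennreal)" for v1 v2
  define F where "F p = F0 p + (\<Sum>v1\<in>W1. F1 v1 p) + (\<Sum>v2\<in>W2. F2 v2 p) + (\<Sum>v1\<in>W1. \<Sum>v2\<in>W2. F12 v1 v2 p)" for p
  let ?O = "?C1 \<Otimes>\<^sub>M ?C2 \<Otimes>\<^sub>M Z"
  have F0 [measurable]: "F0 \<in> borel_measurable ?O"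
    unfolding F0_def by measurable
  have F1 [measurable]: "F1 v1 \<in> borel_measurable ?O" if "v1 \<in> W1" for v1
  proof -
    have lt: "v1 < M1" using that by (auto simp: W1_def W2_def)
    note [measurable] = m1[OF lt(1)]
    show ?thesis unfolding F1_def by measurable
  qed
  have F2 [measurable]: "F2 v2 \<in> borel_measurable ?O" if "v2 \<in> W2" for v2
  proof -
    have lt: "v2 < M2" using that by (auto simp: W1_def W2_def)
    note [measurable] = m2[OF lt(1)]
    show ?thesis unfolding F2_def by measurable
  qed
  have F12 [measurable]: "F12 v1 v2 \<in> borel_measurable ?O" if "v1 \<in> W1" "v2 \<in> W2" for v1 v2
  proof -
    have lt: "v1 < M1" "v2 < M2" using that by (auto simp: W1_def W2_def)
    note [measurable] = m1[OF lt(1)] m2[OF lt(2)]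
    show ?thesis unfolding F12_def by measurable
  qed
  have F [measurable]: "F \<in> borel_measurable ?O" unfolding F_def by measurable
  note iter = nn_integral_triple_pair_measure[OF C2.prob_space_axioms Z.prob_space_axioms, where A = ?C1]
  define G where "G = (\<lambda>(c1, c2). \<integral>\<^sup>+z. F (c1, c2, z) \<partial>Z)"
  have F' [measurable]: "(\<lambda>q. F (fst (fst q), snd (fst q), snd q)) \<in> borel_measurable ((?C1 \<Otimes>\<^sub>M ?C2) \<Otimes>\<^sub>M Z)"
    by measurable
  have G: "G \<in> borel_measurable (?C1 \<Otimes>\<^sub>M ?C2)"
    using Z.borel_measurable_nn_integral_fst[OF F'] by (simp add: G_def case_prod_unfold)
  have emeasure_le: "emeasure Z {z \<in> space Z. confusion M1 M2 c1 c2 w1 w2 z} \<le> G (c1, c2)" for c1 c2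
  proof -
    let ?B = "{z \<in> space Z. confusion M1 M2 c1 c2 w1 w2 z}"
    show "emeasure Z ?B \<le> G (c1, c2)"
    \<comment> \<open>For codewords outside the codeword spaces \<open>?B\<close> may fail to be
      measurable; then \<open>emeasure\<close> is 0 by default and the bound holds
      trivially.\<close>
    proof (cases "?B \<in> sets Z")
      case True
      hence "emeasure Z ?B = (\<integral>\<^sup>+z. indicator ?B z \<partial>Z)" by simp
      also have "\<dots> \<le> (\<integral>\<^sup>+z. F (c1, c2, z) \<partial>Z)"
      proof (rule nn_integral_mono)
        fix z
        have "indicator ?B z \<le> (indicator {z. confusion M1 M2 c1 c2 w1 w2 z} z :: ennreal)"
          by (simp add: indicator_def)
        also have "\<dots> \<le> F (c1, c2, z)"
          using confusion_sum[of M1 M2 c1 c2 w1 w2 z]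
          by (simp add: F_def F0_def F1_def F2_def F12_def W1_def W2_def)
        finally show "indicator ?B z \<le> F (c1, c2, z)" .
      qed
      also have "\<dots> = G (c1, c2)" by (simp add: G_def)
      finally show ?thesis .
    qed (simp add: emeasure_notin_sets)
  qed
  have "(\<integral>\<^sup>+p. G p \<partial>(?C1 \<Otimes>\<^sub>M ?C2)) = (\<integral>\<^sup>+c1. \<integral>\<^sup>+c2. G (c1, c2) \<partial>?C2 \<partial>?C1)"
    by (rule C2.nn_integral_fst[symmetric]) fact
  also have "\<dots> = (\<integral>\<^sup>+p. F p \<partial>?O)" unfolding G_def prod.case by (rule iter[symmetric]) measurable
  also have "\<dots> = (\<integral>\<^sup>+p. F0 p \<partial>?O) + (\<Sum>v1\<in>W1. \<integral>\<^sup>+p. F1 v1 p \<partial>?O) + (\<Sum>v2\<in>W2. \<integral>\<^sup>+p. F2 v2 p \<partial>?O)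
      + (\<Sum>v1\<in>W1. \<Sum>v2\<in>W2. \<integral>\<^sup>+p. F12 v1 v2 p \<partial>?O)"
  proof -
    have sums: "(\<integral>\<^sup>+p. (\<Sum>v1\<in>W1. F1 v1 p) \<partial>?O) = (\<Sum>v1\<in>W1. \<integral>\<^sup>+p. F1 v1 p \<partial>?O)"
      "(\<integral>\<^sup>+p. (\<Sum>v2\<in>W2. F2 v2 p) \<partial>?O) = (\<Sum>v2\<in>W2. \<integral>\<^sup>+p. F2 v2 p \<partial>?O)"
      "(\<integral>\<^sup>+p. (\<Sum>v1\<in>W1. \<Sum>v2\<in>W2. F12 v1 v2 p) \<partial>?O) = (\<Sum>v1\<in>W1. \<integral>\<^sup>+p. (\<Sum>v2\<in>W2. F12 v1 v2 p) \<partial>?O)"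
      by (intro nn_integral_sum borel_measurable_sum F1 F2 F12; assumption)+
    have "(\<integral>\<^sup>+p. (\<Sum>v2\<in>W2. F12 v1 v2 p) \<partial>?O) = (\<Sum>v2\<in>W2. \<integral>\<^sup>+p. F12 v1 v2 p \<partial>?O)" if "v1 \<in> W1" for v1
      by (intro nn_integral_sum F12 that)
    hence "(\<Sum>v1\<in>W1. \<integral>\<^sup>+p. (\<Sum>v2\<in>W2. F12 v1 v2 p) \<partial>?O) = (\<Sum>v1\<in>W1. \<Sum>v2\<in>W2. \<integral>\<^sup>+p. F12 v1 v2 p \<partial>?O)"
      by (intro sum.cong refl)
    note sums' = sums(1,2) sums(3)[unfolded this]
    have m: "(\<lambda>p. \<Sum>v1\<in>W1. F1 v1 p) \<in> borel_measurable ?O" "(\<lambda>p. \<Sum>v2\<in>W2. F2 v2 p) \<in> borel_measurable ?O"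
      "(\<lambda>p. \<Sum>v1\<in>W1. \<Sum>v2\<in>W2. F12 v1 v2 p) \<in> borel_measurable ?O"
      by (intro borel_measurable_sum F1 F2 F12; assumption)+
    have "(\<integral>\<^sup>+p. F p \<partial>?O) = (\<integral>\<^sup>+p. F0 p \<partial>?O) + (\<integral>\<^sup>+p. (\<Sum>v1\<in>W1. F1 v1 p) \<partial>?O)
        + (\<integral>\<^sup>+p. (\<Sum>v2\<in>W2. F2 v2 p) \<partial>?O) + (\<integral>\<^sup>+p. (\<Sum>v1\<in>W1. \<Sum>v2\<in>W2. F12 v1 v2 p) \<partial>?O)"
      unfolding F_def by (simp only: nn_integral_add borel_measurable_add m F0)
    thus ?thesis unfolding sums' .
  qed
  also have "\<dots> \<le> ennreal e0 + (\<Sum>v1\<in>W1. ennreal e1) + (\<Sum>v2\<in>W2. ennreal e2) + (\<Sum>v1\<in>W1. \<Sum>v2\<in>W2. ennreal e12)"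
  proof (intro add_mono sum_mono)
    show "(\<integral>\<^sup>+p. F0 p \<partial>?O) \<le> ennreal e0"
      by (subst iter[OF F0]) (simp add: F0_def typical_term w)
    show "(\<integral>\<^sup>+p. F1 v1 p \<partial>?O) \<le> ennreal e1" if "v1 \<in> W1" for v1
      by (subst iter[OF F1[OF that]]) (use that in \<open>simp add: F1_def confusion1_term w W1_def\<close>)
    show "(\<integral>\<^sup>+p. F2 v2 p \<partial>?O) \<le> ennreal e2" if "v2 \<in> W2" for v2
      by (subst iter[OF F2[OF that]]) (use that in \<open>simp add: F2_def confusion2_term w W2_def\<close>)
    show "(\<integral>\<^sup>+p. F12 v1 v2 p \<partial>?O) \<le> ennreal e12" if "v1 \<in> W1" "v2 \<in> W2" for v1 v2
      by (subst iter[OF F12[OF that]]) (use that in \<open>simp add: F12_def confusion12_term w W1_def W2_def\<close>)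
  qed
  also have "\<dots> = ennreal (e0 + card W1 * e1 + card W2 * e2 + card W1 * (card W2 * e12))"
    using nonneg by (simp add: ennreal_of_nat_eq_real_of_nat ennreal_mult)
  also have "\<dots> \<le> ennreal (e0 + M1 * e1 + M2 * e2 + M1 * (M2 * e12))"
    using nonneg w by (intro ennreal_leI add_mono mult_mono) (auto simp: W1_def W2_def)
  finally show ?thesis using that[OF G emeasure_le] by blast
qed

lemma confusion_sets:
  assumes c: "\<And>w. w < M1 \<Longrightarrow> c1 w \<in> space A1" "\<And>w. w < M2 \<Longrightarrow> c2 w \<in> space A2"
    and w: "w1 < M1" "w2 < M2"
  shows "{z \<in> space Z. confusion M1 M2 c1 c2 w1 w2 z} \<in> sets Z"
proof -
  note [measurable] = c(1)[OF w(1)] c(2)[OF w(2)]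
  have Hm [measurable]: "(\<lambda>z. H (c1 w1, c2 w2, z)) \<in> Z \<rightarrow>\<^sub>M Y" by measurable
  have m0: "Measurable.pred Z (\<lambda>z. (c1 w1, c2 w2, z) \<in> S0)" by measurable
  have m: "Measurable.pred Z (\<lambda>z. (c1 v1, c2 v2, H (c1 w1, c2 w2, z)) \<in> T)"
    if "v1 < M1" "v2 < M2" and [measurable]: "T \<in> sets (A1 \<Otimes>\<^sub>M A2 \<Otimes>\<^sub>M Y)" for v1 v2 T
  proof -
    note [measurable] = c(1)[OF that(1)] c(2)[OF that(2)]
    show ?thesis by measurable
  qed
  have "Measurable.pred Z (\<lambda>z. confusion M1 M2 c1 c2 w1 w2 z)"
    unfolding confusion_def Let_def
    by (intro pred_intros_logic pred_intros_finite m0 m S1 S2 S12) (use w in auto)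
  thus ?thesis by (simp add: pred_def)
qed

text \<open>Some codebooks do no worse than the average, simultaneously averaged over all message
  pairs. The slack \<open>\<eta>\<close> turns the weak inequality between integrals into a
  contradiction.\<close>

lemma exists_codebooks:
  assumes \<eta>: "0 < \<eta>" and M: "0 < M1" "0 < M2"
  shows "\<exists>c1 c2. (\<forall>w<M1. c1 w \<in> space A1) \<and> (\<forall>w<M2. c2 w \<in> space A2) \<and>
     (\<Sum>w1<M1. \<Sum>w2<M2. measure Z {z \<in> space Z. confusion M1 M2 c1 c2 w1 w2 z})
       \<le> real M1 * real M2 * (e0 + M1 * e1 + M2 * e2 + M1 * (M2 * e12) + \<eta>)"
proof (rule ccontr)
  let ?C1 = "codebook1 M1" and ?C2 = "codebook2 M2"
  interpret C1: prob_space ?C1 by (intro prob_space_PiM A1.prob_space_axioms)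
  interpret C2: prob_space ?C2 by (intro prob_space_PiM A2.prob_space_axioms)
  interpret C: pair_prob_space ?C1 ?C2 ..
  define E where "E = e0 + M1 * e1 + M2 * e2 + M1 * (M2 * e12)"
  have E: "0 \<le> E" using nonneg by (simp add: E_def)
  assume neg: "\<not> ?thesis"
  let ?m = "\<lambda>c1 c2 w1 w2. emeasure Z {z \<in> space Z. confusion M1 M2 c1 c2 w1 w2 z}"
  define bound where "bound w1 w2 G \<longleftrightarrow> G \<in> borel_measurable (?C1 \<Otimes>\<^sub>M ?C2) \<and>
      (\<forall>c1 c2. ?m c1 c2 w1 w2 \<le> G (c1, c2)) \<and> (\<integral>\<^sup>+p. G p \<partial>(?C1 \<Otimes>\<^sub>M ?C2)) \<le> ennreal E" for w1 w2 G
  have "\<exists>G. w1 < M1 \<longrightarrow> w2 < M2 \<longrightarrow> bound w1 w2 G" for w1 w2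
  proof (cases "w1 < M1 \<and> w2 < M2")
    case True
    hence w: "w1 < M1" "w2 < M2" by auto
    show ?thesis
    proof (rule average_confusion[OF w])
      fix G assume "G \<in> borel_measurable (?C1 \<Otimes>\<^sub>M ?C2)" "\<And>c1 c2. ?m c1 c2 w1 w2 \<le> G (c1, c2)"
        "(\<integral>\<^sup>+p. G p \<partial>(?C1 \<Otimes>\<^sub>M ?C2)) \<le> ennreal (e0 + M1 * e1 + M2 * e2 + M1 * (M2 * e12))"
      hence "bound w1 w2 G" by (simp add: bound_def E_def)
      thus "\<exists>G. w1 < M1 \<longrightarrow> w2 < M2 \<longrightarrow> bound w1 w2 G" by blast
    qed
  qed blast
  hence "\<forall>w1 w2. \<exists>G. w1 < M1 \<longrightarrow> w2 < M2 \<longrightarrow> bound w1 w2 G" by blast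
  then obtain G where "\<forall>w1 w2. w1 < M1 \<longrightarrow> w2 < M2 \<longrightarrow> bound w1 w2 (G w1 w2)"
    unfolding choice_iff by blast
  hence G: "\<And>w1 w2. w1 < M1 \<Longrightarrow> w2 < M2 \<Longrightarrow> G w1 w2 \<in> borel_measurable (?C1 \<Otimes>\<^sub>M ?C2)"
    and G_ge: "\<And>w1 w2 c1 c2. w1 < M1 \<Longrightarrow> w2 < M2 \<Longrightarrow> ?m c1 c2 w1 w2 \<le> G w1 w2 (c1, c2)"
    and G_int: "\<And>w1 w2. w1 < M1 \<Longrightarrow> w2 < M2 \<Longrightarrow> (\<integral>\<^sup>+p. G w1 w2 p \<partial>(?C1 \<Otimes>\<^sub>M ?C2)) \<le> ennreal E"
    unfolding bound_def by simp_all
  have "ennreal (real M1 * real M2 * (E + \<eta>)) \<le> (\<integral>\<^sup>+p. (\<Sum>w1<M1. \<Sum>w2<M2. G w1 w2 p) \<partial>(?C1 \<Otimes>\<^sub>M ?C2))"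
  proof (rule C.P.const_le_nn_integral_prob)
    fix p assume p: "p \<in> space (?C1 \<Otimes>\<^sub>M ?C2)"
    obtain c1 c2 where c: "p = (c1, c2)" by fastforce
    have "\<forall>w<M1. c1 w \<in> space A1" "\<forall>w<M2. c2 w \<in> space A2"
      using p by (auto simp: c space_pair_measure space_PiM)
    note c1c2 = this
    have "real M1 * real M2 * (E + \<eta>) \<le> (\<Sum>w1<M1. \<Sum>w2<M2. measure Z {z \<in> space Z. confusion M1 M2 c1 c2 w1 w2 z})"
    proof (rule less_imp_le[OF not_le_imp_less], rule notI)
      assume "(\<Sum>w1<M1. \<Sum>w2<M2. measure Z {z \<in> space Z. confusion M1 M2 c1 c2 w1 w2 z}) \<le> real M1 * real M2 * (E + \<eta>)"
      note good = conjI[OF c1c2(1) conjI[OF c1c2(2) this[unfolded E_def]]]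
      show False by (rule notE[OF neg], rule exI[of _ c1], rule exI[of _ c2], rule good)
    qed
    hence "ennreal (real M1 * real M2 * (E + \<eta>))
        \<le> ennreal (\<Sum>w1<M1. \<Sum>w2<M2. measure Z {z \<in> space Z. confusion M1 M2 c1 c2 w1 w2 z})"
      by (rule ennreal_leI)
    also have "\<dots> = (\<Sum>w1<M1. \<Sum>w2<M2. ?m c1 c2 w1 w2)"
      by (simp only: Z.emeasure_eq_measure sum_ennreal sum_nonneg measure_nonneg)
    also have "\<dots> \<le> (\<Sum>w1<M1. \<Sum>w2<M2. G w1 w2 p)"
      unfolding c by (intro sum_mono G_ge) auto
    finally show "ennreal (real M1 * real M2 * (E + \<eta>)) \<le> (\<Sum>w1<M1. \<Sum>w2<M2. G w1 w2 p)" .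
  qed
  also have "\<dots> = (\<Sum>w1<M1. \<Sum>w2<M2. \<integral>\<^sup>+p. G w1 w2 p \<partial>(?C1 \<Otimes>\<^sub>M ?C2))"
  proof -
    have "(\<integral>\<^sup>+p. (\<Sum>w1<M1. \<Sum>w2<M2. G w1 w2 p) \<partial>(?C1 \<Otimes>\<^sub>M ?C2))
        = (\<Sum>w1<M1. \<integral>\<^sup>+p. (\<Sum>w2<M2. G w1 w2 p) \<partial>(?C1 \<Otimes>\<^sub>M ?C2))"
      by (intro nn_integral_sum borel_measurable_sum G) auto
    also have "\<dots> = (\<Sum>w1<M1. \<Sum>w2<M2. \<integral>\<^sup>+p. G w1 w2 p \<partial>(?C1 \<Otimes>\<^sub>M ?C2))"
      by (intro sum.cong refl nn_integral_sum G) auto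
    finally show ?thesis .
  qed
  also have "\<dots> \<le> (\<Sum>w1<M1. \<Sum>w2<M2. ennreal E)"
    by (intro sum_mono G_int) auto
  also have "\<dots> = ennreal (real M1 * real M2 * E)"
    using E by (simp add: ennreal_of_nat_eq_real_of_nat ennreal_mult mult.assoc)
  finally have "real M1 * real M2 * (E + \<eta>) \<le> real M1 * real M2 * E"
    using E by (subst (asm) ennreal_le_iff) auto
  thus False using M \<eta> by simp
qed

end

section \<open>Achievability\<close>

abbreviation gauss0 :: "nat \<Rightarrow> real \<Rightarrow> (nat \<Rightarrow> real) measure" where
  "gauss0 n V \<equiv> gauss n (\<lambda>_. 0) V"

section \<open>Concentration of the squared norm\<close>

lemma gauss1_square_deviation:
  assumes V: "0 < V"
  shows "has_bochner_integral (gauss1 0 V) (\<lambda>y. y\<^sup>2 - V) 0"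
    and "has_bochner_integral (gauss1 0 V) (\<lambda>y. (y\<^sup>2 - V)\<^sup>2) (2 * V\<^sup>2)"
proof -
  interpret prob_space "gauss1 0 V" by (rule prob_space_gauss1) fact
  have m2: "has_bochner_integral (gauss1 0 V) (\<lambda>y. y\<^sup>2) V"
    using has_bochner_integral_gauss1_square[OF V, of 0 0] by simp
  have m0: "has_bochner_integral (gauss1 0 V) (\<lambda>y. c) c" for c :: real
    by (simp add: has_bochner_integral_iff prob_space[simplified])
  show "has_bochner_integral (gauss1 0 V) (\<lambda>y. y\<^sup>2 - V) 0"
    using has_bochner_integral_diff[OF m2 m0[of V]] by simp
  have "has_bochner_integral lborel (\<lambda>x. normal_density 0 (sqrt V) x *\<^sub>R x ^ 4) (3 * V\<^sup>2)"
    using normal_moment_even[of "sqrt V" 0 2] V by (simp add: fact_numeral power2_eq_square)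
  hence m4: "has_bochner_integral (gauss1 0 V) (\<lambda>y. y ^ 4) (3 * V\<^sup>2)"
    unfolding gauss1_def by (intro has_bochner_integral_density) auto
  have "has_bochner_integral (gauss1 0 V) (\<lambda>y. y ^ 4 - (2 * V) * y\<^sup>2 + V\<^sup>2) (3 * V\<^sup>2 - (2 * V) * V + V\<^sup>2)"
    by (intro has_bochner_integral_add has_bochner_integral_diff has_bochner_integral_mult_right m0 m2 m4)
  moreover have "(\<lambda>y. y ^ 4 - (2 * V) * y\<^sup>2 + V\<^sup>2) = (\<lambda>y. (y\<^sup>2 - V)\<^sup>2)"
    by (auto simp: fun_eq_iff power2_eq_square power4_eq_xxxx algebra_simps)
  ultimately show "has_bochner_integral (gauss1 0 V) (\<lambda>y. (y\<^sup>2 - V)\<^sup>2) (2 * V\<^sup>2)"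
    by (simp add: power2_eq_square)
qed

lemma gauss_norm_deviation:
  assumes V: "0 < V" and \<delta>: "0 < \<delta>" and n: "0 < n"
  shows "emeasure (gauss0 n V) {x \<in> space (gauss0 n V). n * \<delta> \<le> \<bar>(\<Sum>i<n. (x i)\<^sup>2) - n * V\<bar>}
    \<le> ennreal (2 * V\<^sup>2 / (n * \<delta>\<^sup>2))"
proof -
  let ?M = "gauss0 n V"
  interpret prob_space ?M by (rule prob_space_gauss) fact
  interpret P: product_prob_space "\<lambda>i. gauss1 0 V" UNIV
    by (rule product_prob_space_gauss1) fact
  define h where "h y = y\<^sup>2 - V" for y :: real
  note h1 = gauss1_square_deviation(1)[OF V, folded h_def]
  note h2 = gauss1_square_deviation(2)[OF V, folded h_def]
  have cross: "has_bochner_integral ?M (\<lambda>x. h (x i) * h (x j)) (if i = j then 2 * V\<^sup>2 else 0)"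
    if ij: "i < n" "j < n" for i j
  proof (cases "i = j")
    case True
    thus ?thesis
      using has_bochner_integral_gauss_component[OF V ij(1), where m = "\<lambda>_. 0", OF h2]
      by (simp add: power2_eq_square)
  next
    case False
    \<comment> \<open>\<open>h (x i) * h (x j)\<close> is padded with factors 1 to a product over
      all coordinates; its integral then factors and vanishes with the mean of
      \<open>h\<close>.\<close>
    define f where "f k = (if k = i \<or> k = j then h else (\<lambda>_. 1))" for k
    have int: "integrable (gauss1 0 V) (f k)" for k
      using h1 by (auto simp: f_def has_bochner_integral_iff)
    have prod: "(\<Prod>k<n. f k (x k)) = h (x i) * h (x j)" for x
    proof -
      have "(\<Prod>k<n. f k (x k)) = (\<Prod>k\<in>{i, j}. f k (x k))"
        using ij by (intro prod.mono_neutral_right) (auto simp: f_def)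
      thus ?thesis using False by (simp add: f_def)
    qed
    have "integrable ?M (\<lambda>x. \<Prod>k<n. f k (x k))"
      unfolding gauss_def by (rule P.product_integrable_prod) (use int in auto)
    moreover have "integral\<^sup>L ?M (\<lambda>x. \<Prod>k<n. f k (x k)) = (\<Prod>k<n. integral\<^sup>L (gauss1 0 V) (f k))"
      unfolding gauss_def by (rule P.product_integral_prod) (use int in auto)
    moreover have "(\<Prod>k<n. integral\<^sup>L (gauss1 0 V) (f k)) = 0"
      using ij h1 by (intro prod_zero bexI[of _ i]) (auto simp: f_def has_bochner_integral_iff)
    ultimately show ?thesis using False by (simp add: prod has_bochner_integral_iff)
  qed
  define S where "S x = (\<Sum>i<n. (x i)\<^sup>2) - n * V" for x :: "nat \<Rightarrow> real"
  have S_eq: "S x = (\<Sum>i<n. h (x i))" for x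
    by (simp add: S_def h_def sum_subtractf)
  have "has_bochner_integral ?M (\<lambda>x. (S x)\<^sup>2) (\<Sum>i<n. \<Sum>j<n. if i = j then 2 * V\<^sup>2 else 0)"
    unfolding S_eq power2_eq_square[of "sum _ _"] sum_product
    by (intro has_bochner_integral_sum cross) auto
  hence S2: "has_bochner_integral ?M (\<lambda>x. (S x)\<^sup>2) (n * (2 * V\<^sup>2))"
    by (simp add: sum.delta)
  have S_meas [measurable]: "S \<in> borel_measurable ?M"
    unfolding S_def by measurable
  have "emeasure ?M {x \<in> space ?M. (n * \<delta>)\<^sup>2 \<le> (S x)\<^sup>2} \<le> ennreal (1 / (n * \<delta>)\<^sup>2 * integral\<^sup>L ?M (\<lambda>x. (S x)\<^sup>2))"
    using S2 n \<delta> by (intro integral_Markov_inequality) (auto simp: has_bochner_integral_iff)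
  \<comment> \<open>Only the \<open>n\<close> diagonal terms survive, each equal to the variance
    \<open>2 * V\<^sup>2\<close> of a squared Gaussian; one factor \<open>n\<close> of the threshold
    is left in the denominator.\<close>
  also have "1 / (n * \<delta>)\<^sup>2 * integral\<^sup>L ?M (\<lambda>x. (S x)\<^sup>2) = 2 * V\<^sup>2 / (n * \<delta>\<^sup>2)"
    using S2 n \<delta> by (simp add: has_bochner_integral_iff power2_eq_square)
  also have "{x \<in> space ?M. (n * \<delta>)\<^sup>2 \<le> (S x)\<^sup>2} = {x \<in> space ?M. n * \<delta> \<le> \<bar>S x\<bar>}"
    using \<delta> by (auto simp: abs_le_square_iff[symmetric])
  finally show ?thesis by (simp add: S_def)
qed

lemma nn_integral_gauss_conv:
  assumes P: "0 < P" and N: "0 < N" and F [measurable]: "F \<in> borel_measurable (vec_space n)"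
  shows "(\<integral>\<^sup>+x. \<integral>\<^sup>+z. F (\<lambda>i\<in>{..<n}. x i + z i) \<partial>gauss0 n N \<partial>gauss0 n P) = (\<integral>\<^sup>+y. F y \<partial>gauss0 n (P + N))"
proof -
  interpret Z: prob_space "gauss0 n N" by (rule prob_space_gauss) fact
  have "(\<integral>\<^sup>+y. F y \<partial>gauss0 n (P + N))
    = (\<integral>\<^sup>+p. F ((\<lambda>(x, z). \<lambda>i\<in>{..<n}. x i + z i) p) \<partial>(gauss0 n P \<Otimes>\<^sub>M gauss0 n N))"
    by (subst distr_gauss_conv[OF P N, symmetric], rule nn_integral_distr) auto
  also have "\<dots> = (\<integral>\<^sup>+x. \<integral>\<^sup>+z. F (\<lambda>i\<in>{..<n}. x i + z i) \<partial>gauss0 n N \<partial>gauss0 n P)"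
    by (subst Z.nn_integral_fst[symmetric]) auto
  finally show ?thesis by simp
qed

section \<open>Gaussian densities and the likelihood ratio tests\<close>

definition gauss_pdf :: "nat \<Rightarrow> real \<Rightarrow> (nat \<Rightarrow> real) \<Rightarrow> real" where
  "gauss_pdf n V u = (\<Prod>i<n. normal_density 0 (sqrt V) (u i))"

lemma gauss_pdf_pos: "0 < V \<Longrightarrow> 0 < gauss_pdf n V u"
  unfolding gauss_pdf_def by (intro prod_pos) (auto intro: normal_density_pos)

lemma nn_integral_gauss_pdf:
  assumes P: "0 < P" and N: "0 < N"
  shows "(\<integral>\<^sup>+v. ennreal (gauss_pdf n N (\<lambda>i. u i - v i)) \<partial>gauss0 n P) = ennreal (gauss_pdf n (P + N) u)"
proof -
  have "(\<integral>\<^sup>+v. ennreal (gauss_pdf n N (\<lambda>i. u i - v i)) \<partial>gauss0 n P)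
    = (\<integral>\<^sup>+v. (\<Prod>i<n. ennreal (normal_density 0 (sqrt N) (u i - v i))) \<partial>gauss0 n P)"
    unfolding gauss_pdf_def by (simp add: prod_ennreal)
  also have "\<dots> = (\<Prod>i<n. \<integral>\<^sup>+v. ennreal (normal_density 0 (sqrt N) (u i - v)) \<partial>gauss1 0 P)"
    using P by (intro nn_integral_gauss_prod) auto
  also have "\<dots> = ennreal (gauss_pdf n (P + N) u)"
    unfolding gauss_pdf_def using P N by (simp add: nn_integral_gauss1_conv_density prod_ennreal)
  finally show ?thesis .
qed

lemma measurable_gauss_pdf [measurable (raw)]:
  assumes "\<And>i. i < n \<Longrightarrow> (\<lambda>x. f x i) \<in> borel_measurable M"
  shows "(\<lambda>x. gauss_pdf n V (f x)) \<in> borel_measurable M"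
  unfolding gauss_pdf_def using assms by (intro borel_measurable_prod) auto

lemma gauss_pdf_cong: "(\<And>i. i < n \<Longrightarrow> u i = v i) \<Longrightarrow> gauss_pdf n V u = gauss_pdf n V v"
  unfolding gauss_pdf_def by (intro prod.cong) auto

lemma ln_gauss_pdf:
  assumes "0 < V"
  shows "ln (gauss_pdf n V u) = - (n * (ln (2 * pi * V) / 2)) - (\<Sum>i<n. (u i)\<^sup>2) / (2 * V)"
proof -
  have "ln (gauss_pdf n V u) = (\<Sum>i<n. ln (normal_density 0 (sqrt V) (u i)))"
    unfolding gauss_pdf_def
    using normal_density_pos[of "sqrt V" 0] assms by (intro ln_prod) (auto simp: less_imp_neq[symmetric])
  also have "\<dots> = (\<Sum>i<n. - ln (2 * pi * V) / 2 - (u i)\<^sup>2 / (2 * V))"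
    by (intro sum.cong refl) (use ln_normal_density[OF assms, of 0] in simp)
  also have "\<dots> = - (n * (ln (2 * pi * V) / 2)) - (\<Sum>i<n. (u i)\<^sup>2) / (2 * V)"
    by (simp add: sum_subtractf sum_divide_distrib)
  finally show ?thesis .
qed

text \<open>The log likelihood ratio is n C(S) plus the squared norm of \<open>u\<close> over
  \<open>2 * (S + N)\<close> minus that of \<open>z\<close> over \<open>2 * N\<close>. At the
  expected norms the last two cancel; deviations by \<open>n * \<delta>\<close> cost at most
  \<open>n * \<delta> / (2 * N)\<close> each, hence the loss \<open>\<delta> / N\<close> per
  letter.\<close>

lemma gauss_pdf_ratio_ge:
  assumes S: "0 < S" and N: "0 < N" and \<delta>: "0 \<le> \<delta>"
    and z: "(\<Sum>i<n. (z i)\<^sup>2) \<le> n * (N + \<delta>)" and u: "n * (S + N - \<delta>) \<le> (\<Sum>i<n. (u i)\<^sup>2)"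
  shows "exp (n * (ln (1 + S / N) / 2 - \<delta> / N)) * gauss_pdf n (S + N) u \<le> gauss_pdf n N z"
proof -
  define a b where "a = (\<Sum>i<n. (z i)\<^sup>2)" and "b = (\<Sum>i<n. (u i)\<^sup>2)"
  define V where "V = S + N"
  have V: "0 < V" "N \<le> V" using S N by (auto simp: V_def)
  have pos: "0 < gauss_pdf n V u" "0 < gauss_pdf n N z"
    using V N by (auto intro: gauss_pdf_pos)
  have "a / (2 * N) \<le> n * (N + \<delta>) / (2 * N)" using z N by (simp add: a_def divide_right_mono)
  also have "\<dots> = n * (1 / 2 + \<delta> / (2 * N))" using N by (simp add: field_simps)
  finally have a: "a / (2 * N) \<le> n * (1 / 2 + \<delta> / (2 * N))" .
  have "\<delta> / (2 * V) \<le> \<delta> / (2 * N)" using V N \<delta> by (simp add: frac_le)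
  hence "n * (1 / 2 - \<delta> / (2 * N)) \<le> n * (1 / 2 - \<delta> / (2 * V))" by (intro mult_left_mono) auto
  also have "\<dots> = n * (V - \<delta>) / (2 * V)" using V by (simp add: field_simps)
  also have "\<dots> \<le> b / (2 * V)" using u V by (simp add: b_def V_def divide_right_mono)
  finally have b: "n * (1 / 2 - \<delta> / (2 * N)) \<le> b / (2 * V)" .
  have "1 + S / N = V / N" using N by (simp add: V_def field_simps)
  hence ln: "ln (1 + S / N) = ln (2 * pi * V) - ln (2 * pi * N)"
    using V N by (simp add: ln_div ln_mult)
  have "n * (ln (1 + S / N) / 2 - \<delta> / N) + ln (gauss_pdf n V u) \<le> ln (gauss_pdf n N z)"
    unfolding ln ln_gauss_pdf[OF V(1)] ln_gauss_pdf[OF N] a_def[symmetric] b_def[symmetric]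
    using a b by (simp add: algebra_simps add_divide_distrib diff_divide_distrib)
  hence "exp (n * (ln (1 + S / N) / 2 - \<delta> / N) + ln (gauss_pdf n V u)) \<le> exp (ln (gauss_pdf n N z))"
    by simp
  thus ?thesis using pos by (simp add: exp_add V_def)
qed

text \<open>Markov's inequality with threshold a multiple \<open>K\<close> of the mean. The mean
  \<open>c\<close> will be the Gaussian output density at the received word, so the bound
  \<open>1 / K\<close> is the same for all outputs.\<close>

lemma nn_Markov_ratio:
  assumes f: "f \<in> borel_measurable M" and int: "(\<integral>\<^sup>+x. ennreal (f x) \<partial>M) = ennreal c"
    and c: "0 < c" and K: "0 < K" and f0: "\<And>x. 0 \<le> f x"
  shows "(\<integral>\<^sup>+x. indicator {x. K * c \<le> f x} x \<partial>M) \<le> ennreal (1 / K)"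
proof -
  have "(\<integral>\<^sup>+x. indicator {x. K * c \<le> f x} x \<partial>M) \<le> (\<integral>\<^sup>+x. ennreal (1 / (K * c)) * ennreal (f x) \<partial>M)"
    using c K f0 by (intro nn_integral_mono)
      (auto simp: indicator_def ennreal_mult'[symmetric] field_simps simp flip: ennreal_1 intro!: ennreal_leI)
  also have "\<dots> = ennreal (1 / (K * c)) * ennreal c"
    using f by (subst nn_integral_cmult) (auto simp: int)
  also have "\<dots> = ennreal (1 / K)"
    using c K by (simp add: ennreal_mult'[symmetric])
  finally show ?thesis .
qed

lemma single_confusion_le:
  assumes P: "0 < P" and N: "0 < N" and K: "0 < K"
  shows "(\<integral>\<^sup>+v. indicator {v. K * gauss_pdf n (P + N) u \<le> gauss_pdf n N (\<lambda>i. u i - v i)} v \<partial>gauss0 n P)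
    \<le> ennreal (1 / K)"
proof (rule nn_Markov_ratio)
  show "(\<lambda>v. gauss_pdf n N (\<lambda>i. u i - v i)) \<in> borel_measurable (gauss0 n P)"
    by (intro measurable_gauss_pdf borel_measurable_diff measurable_component_gauss) auto
qed (use P N K gauss_pdf_pos nn_integral_gauss_pdf in \<open>auto simp: less_imp_le\<close>)

text \<open>Integrating out the second and then the first wrong codeword raises the variance of the
  density from \<open>N\<close> to \<open>P2 + N\<close> and on to \<open>P1 + P2 + N\<close>, which
  is the denominator of the test.\<close>

lemma double_confusion_le:
  assumes P: "0 < P1" "0 < P2" and N: "0 < N" and K: "0 < K"
  shows "(\<integral>\<^sup>+v1. \<integral>\<^sup>+v2. indicator {p. K * gauss_pdf n (P1 + P2 + N) y
      \<le> gauss_pdf n N (\<lambda>i. y i - fst p i - snd p i)} (v1, v2) \<partial>gauss0 n P2 \<partial>gauss0 n P1) \<le> ennreal (1 / K)"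
proof -
  let ?c = "gauss_pdf n (P1 + P2 + N) y"
  let ?f = "\<lambda>p. gauss_pdf n N (\<lambda>i. y i - fst p i - snd p i)"
  interpret A2: prob_space "gauss0 n P2" by (rule prob_space_gauss) (use P in auto)
  have f: "?f \<in> borel_measurable (gauss0 n P1 \<Otimes>\<^sub>M gauss0 n P2)"
    by measurable
  have "(\<integral>\<^sup>+p. ennreal (?f p) \<partial>(gauss0 n P1 \<Otimes>\<^sub>M gauss0 n P2))
    = (\<integral>\<^sup>+v1. \<integral>\<^sup>+v2. ennreal (gauss_pdf n N (\<lambda>i. (y i - v1 i) - v2 i)) \<partial>gauss0 n P2 \<partial>gauss0 n P1)"
    using f by (subst A2.nn_integral_fst[symmetric]) auto
  also have "\<dots> = (\<integral>\<^sup>+v1. ennreal (gauss_pdf n (P2 + N) (\<lambda>i. y i - v1 i)) \<partial>gauss0 n P1)"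
    using P N by (subst nn_integral_gauss_pdf) auto
  also have "\<dots> = ennreal ?c"
    using P N by (subst nn_integral_gauss_pdf) (auto simp: add.assoc)
  finally have "(\<integral>\<^sup>+p. indicator {p. K * ?c \<le> ?f p} p \<partial>(gauss0 n P1 \<Otimes>\<^sub>M gauss0 n P2)) \<le> ennreal (1 / K)"
    using P N K f gauss_pdf_pos by (intro nn_Markov_ratio) (auto simp: less_imp_le)
  moreover have "(\<integral>\<^sup>+p. indicator {p. K * ?c \<le> ?f p} p \<partial>(gauss0 n P1 \<Otimes>\<^sub>M gauss0 n P2))
     = (\<integral>\<^sup>+v1. \<integral>\<^sup>+v2. indicator {p. K * ?c \<le> ?f p} (v1, v2) \<partial>gauss0 n P2 \<partial>gauss0 n P1)"
  proof (rule A2.nn_integral_fst[symmetric])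
    have "(\<lambda>p. indicator {p \<in> space (gauss0 n P1 \<Otimes>\<^sub>M gauss0 n P2). K * ?c \<le> ?f p} p :: ennreal)
        \<in> borel_measurable (gauss0 n P1 \<Otimes>\<^sub>M gauss0 n P2)"
      using f by measurable
    thus "indicator {p. K * ?c \<le> ?f p} \<in> borel_measurable (gauss0 n P1 \<Otimes>\<^sub>M gauss0 n P2)"
      by (subst measurable_cong[of _ _ "indicator {p \<in> space (gauss0 n P1 \<Otimes>\<^sub>M gauss0 n P2). K * ?c \<le> ?f p}"])
         (auto simp: indicator_def)
  qed
  ultimately show ?thesis by simp
qed

section \<open>Typical inputs, noise and outputs\<close>

definition deviates :: "nat \<Rightarrow> real \<Rightarrow> real \<Rightarrow> (nat \<Rightarrow> real) \<Rightarrow> bool" where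
  "deviates n \<delta> V u \<longleftrightarrow> n * \<delta> \<le> \<bar>(\<Sum>i<n. (u i)\<^sup>2) - n * V\<bar>"

lemma deviates_restrict: "deviates n \<delta> V (restrict u {..<n}) \<longleftrightarrow> deviates n \<delta> V u"
  by (simp add: deviates_def)

lemma measurable_deviates [measurable]: "Measurable.pred (vec_space n) (deviates n \<delta> V)"
  unfolding deviates_def[abs_def] by measurable

lemma nn_integral_deviates_le:
  assumes V: "0 < V" "V \<le> W" and \<delta>: "0 < \<delta>" and n: "0 < n"
  shows "(\<integral>\<^sup>+u. indicator {u. deviates n \<delta> V u} u \<partial>gauss0 n V) \<le> ennreal (2 * W\<^sup>2 / (n * \<delta>\<^sup>2))"
proof -
  have "(\<integral>\<^sup>+u. indicator {u. deviates n \<delta> V u} u \<partial>gauss0 n V)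
      = (\<integral>\<^sup>+u. indicator {u \<in> space (gauss0 n V). deviates n \<delta> V u} u \<partial>gauss0 n V)"
    by (intro nn_integral_cong) (simp add: indicator_def)
  also have "\<dots> = emeasure (gauss0 n V) {u \<in> space (gauss0 n V). deviates n \<delta> V u}"
    by (intro nn_integral_indicator) measurable
  also have "\<dots> \<le> ennreal (2 * V\<^sup>2 / (n * \<delta>\<^sup>2))"
    unfolding deviates_def by (rule gauss_norm_deviation) fact+
  also have "\<dots> \<le> ennreal (2 * W\<^sup>2 / (n * \<delta>\<^sup>2))"
    using V by (intro ennreal_leI divide_right_mono mult_left_mono power_mono) auto
  finally show ?thesis .
qed

text \<open>A union bound over six norms: the two inputs for the power constraints, the noise for
  the numerators of the three tests, and the three Gaussian sums for their denominators. All six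
  variances are at most \<open>W\<close>, so one Chebyshev bound fits them all.\<close>

lemma atypical_le:
  assumes Q: "0 < Q1" "0 < Q2" and N: "0 < N" and \<delta>: "0 < \<delta>" and n: "0 < n" and W: "Q1 + Q2 + N \<le> W"
    and S0: "S0 \<in> sets (gauss0 n Q1 \<Otimes>\<^sub>M gauss0 n Q2 \<Otimes>\<^sub>M gauss0 n N)"
    and sub: "\<And>x1 x2 z. (x1, x2, z) \<in> S0 \<Longrightarrow> deviates n \<delta> Q1 x1 \<or> deviates n \<delta> Q2 x2 \<or> deviates n \<delta> N z \<or>
      deviates n \<delta> (Q1 + N) (\<lambda>i. x1 i + z i) \<or> deviates n \<delta> (Q2 + N) (\<lambda>i. x2 i + z i) \<or>
      deviates n \<delta> (Q1 + Q2 + N) (\<lambda>i. x1 i + (x2 i + z i))"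
  shows "(\<integral>\<^sup>+x1. \<integral>\<^sup>+x2. \<integral>\<^sup>+z. indicator S0 (x1, x2, z) \<partial>gauss0 n N \<partial>gauss0 n Q2 \<partial>gauss0 n Q1)
    \<le> ennreal (6 * (2 * W\<^sup>2 / (n * \<delta>\<^sup>2)))"
proof -
  let ?A1 = "gauss0 n Q1" and ?A2 = "gauss0 n Q2" and ?Z = "gauss0 n N"
  let ?O = "?A1 \<Otimes>\<^sub>M ?A2 \<Otimes>\<^sub>M ?Z"
  define \<beta> where "\<beta> = 2 * W\<^sup>2 / (n * \<delta>\<^sup>2)"
  have \<beta>: "0 \<le> \<beta>" by (simp add: \<beta>_def)
  interpret A1: prob_space ?A1 by (rule prob_space_gauss) fact
  interpret A2: prob_space ?A2 by (rule prob_space_gauss) fact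
  interpret Z: prob_space ?Z by (rule prob_space_gauss) fact
  \<comment> \<open>The restriction brings pointwise sums, which need not be extensional, back into
    \<open>vec_space n\<close>, where measurability and the convolution law apply.\<close>
  define d where "d V u = (indicator {u. deviates n \<delta> V u} (restrict u {..<n}) :: ennreal)" for V u
  have dm: "indicator {u. deviates n \<delta> V u} \<in> borel_measurable (vec_space n)" for V
    by (subst measurable_cong[of _ _ "indicator {u \<in> space (vec_space n). deviates n \<delta> V u}"])
       (auto simp: indicator_def)
  have d_le: "(\<integral>\<^sup>+u. d V u \<partial>gauss0 n V) \<le> ennreal \<beta>" if "0 < V" "V \<le> W" for V
  proof -
    have "d V u = indicator {u. deviates n \<delta> V u} u" for u
      unfolding d_def indicator_def mem_Collect_eq deviates_restrict ..
    hence "(\<integral>\<^sup>+u. d V u \<partial>gauss0 n V) = (\<integral>\<^sup>+u. indicator {u. deviates n \<delta> V u} u \<partial>gauss0 n V)"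
      by (rule nn_integral_cong)
    also have "\<dots> \<le> ennreal \<beta>"
      unfolding \<beta>_def by (rule nn_integral_deviates_le[OF that \<delta> n])
    finally show ?thesis .
  qed
  have conv: "(\<integral>\<^sup>+x. \<integral>\<^sup>+z. d V (\<lambda>i. x i + z i) \<partial>?Z \<partial>gauss0 n P) = (\<integral>\<^sup>+u. d V u \<partial>gauss0 n (P + N))"
    if "0 < P" for P V
    unfolding d_def using nn_integral_gauss_conv[OF that N dm[of V]]
    by (simp add: indicator_def deviates_restrict)
  define U :: "((nat \<Rightarrow> real) \<times> (nat \<Rightarrow> real) \<times> (nat \<Rightarrow> real)) \<Rightarrow> ennreal" where
    "U = (\<lambda>(x1, x2, z). d Q1 x1 + d Q2 x2 + d N z + d (Q1 + N) (\<lambda>i. x1 i + z i) + d (Q2 + N) (\<lambda>i. x2 i + z i)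
       + d (Q1 + Q2 + N) (\<lambda>i. x1 i + (x2 i + z i)))"
  note iter = nn_integral_triple_pair_measure[OF A2.prob_space_axioms Z.prob_space_axioms, where A = ?A1]
  have m: "(\<lambda>p. d V (f p)) \<in> borel_measurable ?O" if "\<And>i. i < n \<Longrightarrow> (\<lambda>p. f p i) \<in> borel_measurable ?O" for V f
  proof -
    have "(\<lambda>p. restrict (f p) {..<n}) \<in> ?O \<rightarrow>\<^sub>M vec_space n"
      using that by (intro measurable_restrict) auto
    thus ?thesis unfolding d_def by (rule measurable_compose[OF _ dm])
  qed
  have m1: "(\<lambda>p. d V (fst p)) \<in> borel_measurable ?O" for V by (rule m) measurable
  have m2: "(\<lambda>p. d V (fst (snd p))) \<in> borel_measurable ?O" for V by (rule m) measurable
  have m3: "(\<lambda>p. d V (snd (snd p))) \<in> borel_measurable ?O" for V by (rule m) measurable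
  have m4: "(\<lambda>p. d V (\<lambda>i. fst p i + snd (snd p) i)) \<in> borel_measurable ?O" for V by (rule m) measurable
  have m5: "(\<lambda>p. d V (\<lambda>i. fst (snd p) i + snd (snd p) i)) \<in> borel_measurable ?O" for V by (rule m) measurable
  have m6: "(\<lambda>p. d V (\<lambda>i. fst p i + (fst (snd p) i + snd (snd p) i))) \<in> borel_measurable ?O" for V
    by (rule m) measurable
  have "indicator S0 (x1, x2, z) \<le> U (x1, x2, z)" for x1 x2 z
  proof (cases "(x1, x2, z) \<in> S0")
    case True
    have one: "1 \<le> a + b + c + d + e + f"
      if "a = 1 \<or> b = 1 \<or> c = 1 \<or> d = 1 \<or> e = 1 \<or> f = 1" for a b c d e f :: ennreal
      using that by (elim disjE) (simp_all add: add_increasing add_increasing2)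
    have d1: "d V u = 1" if "deviates n \<delta> V u" for V u
      using that by (simp add: d_def deviates_restrict)
    have "1 \<le> U (x1, x2, z)"
      unfolding U_def prod.case by (rule one) (use sub[OF True] d1 in blast)
    thus ?thesis using True by simp
  qed simp
  hence "(\<integral>\<^sup>+x1. \<integral>\<^sup>+x2. \<integral>\<^sup>+z. indicator S0 (x1, x2, z) \<partial>?Z \<partial>?A2 \<partial>?A1)
    \<le> (\<integral>\<^sup>+x1. \<integral>\<^sup>+x2. \<integral>\<^sup>+z. U (x1, x2, z) \<partial>?Z \<partial>?A2 \<partial>?A1)"
    by (intro nn_integral_mono)
  also have "\<dots> = (\<integral>\<^sup>+p. U p \<partial>?O)"
    unfolding U_def case_prod_unfold by (rule iter[symmetric]) (intro borel_measurable_add m1 m2 m3 m4 m5 m6)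
  also have "\<dots> = (\<integral>\<^sup>+p. d Q1 (fst p) \<partial>?O) + (\<integral>\<^sup>+p. d Q2 (fst (snd p)) \<partial>?O) + (\<integral>\<^sup>+p. d N (snd (snd p)) \<partial>?O)
     + (\<integral>\<^sup>+p. d (Q1 + N) (\<lambda>i. fst p i + snd (snd p) i) \<partial>?O)
     + (\<integral>\<^sup>+p. d (Q2 + N) (\<lambda>i. fst (snd p) i + snd (snd p) i) \<partial>?O)
     + (\<integral>\<^sup>+p. d (Q1 + Q2 + N) (\<lambda>i. fst p i + (fst (snd p) i + snd (snd p) i)) \<partial>?O)"
    unfolding U_def case_prod_unfold
    by (simp only: nn_integral_add borel_measurable_add m1 m2 m3 m4 m5 m6)
  also have "\<dots> \<le> ennreal \<beta> + ennreal \<beta> + ennreal \<beta> + ennreal \<beta> + ennreal \<beta> + ennreal \<beta>"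
  proof (intro add_mono)
    show "(\<integral>\<^sup>+p. d Q1 (fst p) \<partial>?O) \<le> ennreal \<beta>"
      using d_le[of Q1] Q N W by (simp add: iter[OF m1] A2.emeasure_space_1 Z.emeasure_space_1)
    show "(\<integral>\<^sup>+p. d Q2 (fst (snd p)) \<partial>?O) \<le> ennreal \<beta>"
      using d_le[of Q2] Q N W by (simp add: iter[OF m2] A1.emeasure_space_1 Z.emeasure_space_1)
    show "(\<integral>\<^sup>+p. d N (snd (snd p)) \<partial>?O) \<le> ennreal \<beta>"
      using d_le[of N] Q N W by (simp add: iter[OF m3] A1.emeasure_space_1 A2.emeasure_space_1)
    show "(\<integral>\<^sup>+p. d (Q1 + N) (\<lambda>i. fst p i + snd (snd p) i) \<partial>?O) \<le> ennreal \<beta>"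
      using d_le[of "Q1 + N"] Q N W by (simp add: iter[OF m4] A2.emeasure_space_1 conv)
    show "(\<integral>\<^sup>+p. d (Q2 + N) (\<lambda>i. fst (snd p) i + snd (snd p) i) \<partial>?O) \<le> ennreal \<beta>"
      using d_le[of "Q2 + N"] Q N W by (simp add: iter[OF m5] A1.emeasure_space_1 conv)
    \<comment> \<open>The threefold sum is handled by convolving twice: second codeword with noise,
      then first codeword with the result.\<close>
    have "(\<integral>\<^sup>+x2. \<integral>\<^sup>+z. d V (\<lambda>i. x1 i + (x2 i + z i)) \<partial>?Z \<partial>?A2) = (\<integral>\<^sup>+u. d V (\<lambda>i. x1 i + u i) \<partial>gauss0 n (Q2 + N))"
      for V x1
    proof -
      have "(\<lambda>u. d V (\<lambda>i. x1 i + u i)) \<in> borel_measurable (vec_space n)"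
      proof -
        have "(\<lambda>u. \<lambda>i\<in>{..<n}. x1 i + u i) \<in> vec_space n \<rightarrow>\<^sub>M vec_space n" by measurable
        thus ?thesis unfolding d_def by (rule measurable_compose[OF _ dm])
      qed
      from nn_integral_gauss_conv[OF Q(2) N this] show ?thesis
        by (simp add: d_def indicator_def deviates_restrict deviates_def)
    qed
    moreover have "(\<integral>\<^sup>+x1. \<integral>\<^sup>+u. d V (\<lambda>i. x1 i + u i) \<partial>gauss0 n (Q2 + N) \<partial>?A1) = (\<integral>\<^sup>+u. d V u \<partial>gauss0 n (Q1 + (Q2 + N)))" for V
      unfolding d_def using nn_integral_gauss_conv[OF Q(1) _ dm[of V], of "Q2 + N"] Q N
      by (simp add: indicator_def deviates_restrict)
    ultimately show "(\<integral>\<^sup>+p. d (Q1 + Q2 + N) (\<lambda>i. fst p i + (fst (snd p) i + snd (snd p) i)) \<partial>?O) \<le> ennreal \<beta>"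
      using d_le[of "Q1 + Q2 + N"] Q N W by (simp add: iter[OF m6] add.assoc)
  qed
  also have "\<dots> = ennreal (6 * \<beta>)"
    using \<beta> by (simp add: ennreal_plus[symmetric] del: ennreal_plus)
  finally show ?thesis by (simp add: \<beta>_def)
qed

section \<open>Tests, decoder and power truncation\<close>

text \<open>Likelihood ratio tests against the output law with one codeword (\<open>passes1\<close>) or both codewords
  (\<open>passes2\<close>) replaced by Gaussian noise of variance \<open>Q\<close>.\<close>

definition passes1 :: "nat \<Rightarrow> real \<Rightarrow> real \<Rightarrow> real \<Rightarrow> (nat \<Rightarrow> real) \<Rightarrow> (nat \<Rightarrow> real) \<Rightarrow> (nat \<Rightarrow> real) \<Rightarrow> bool" where
  "passes1 n N Q K x x' y \<longleftrightarrow> K * gauss_pdf n (Q + N) (\<lambda>i. y i - x' i) \<le> gauss_pdf n N (\<lambda>i. y i - x' i - x i)"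

definition passes2 :: "nat \<Rightarrow> real \<Rightarrow> real \<Rightarrow> real \<Rightarrow> (nat \<Rightarrow> real) \<Rightarrow> (nat \<Rightarrow> real) \<Rightarrow> (nat \<Rightarrow> real) \<Rightarrow> bool" where
  "passes2 n N Q K x x' y \<longleftrightarrow> K * gauss_pdf n (Q + N) y \<le> gauss_pdf n N (\<lambda>i. y i - x i - x' i)"

lemma measurable_passes:
  assumes "\<And>i. i < n \<Longrightarrow> (\<lambda>p. x p i) \<in> borel_measurable L" "\<And>i. i < n \<Longrightarrow> (\<lambda>p. x' p i) \<in> borel_measurable L"
    "\<And>i. i < n \<Longrightarrow> (\<lambda>p. y p i) \<in> borel_measurable L"
  shows "Measurable.pred L (\<lambda>p. passes1 n N Q K (x p) (x' p) (y p))"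
    and "Measurable.pred L (\<lambda>p. passes2 n N Q K (x p) (x' p) (y p))"
proof -
  have [measurable]: "(\<lambda>p. gauss_pdf n V (\<lambda>i. y p i - x' p i)) \<in> borel_measurable L"
    "(\<lambda>p. gauss_pdf n V (\<lambda>i. y p i - x' p i - x p i)) \<in> borel_measurable L"
    "(\<lambda>p. gauss_pdf n V (y p)) \<in> borel_measurable L"
    "(\<lambda>p. gauss_pdf n V (\<lambda>i. y p i - x p i - x' p i)) \<in> borel_measurable L" for V
    by (intro measurable_gauss_pdf borel_measurable_diff assms; assumption)+
  show "Measurable.pred L (\<lambda>p. passes1 n N Q K (x p) (x' p) (y p))"
    unfolding passes1_def by measurable
  show "Measurable.pred L (\<lambda>p. passes2 n N Q K (x p) (x' p) (y p))"
    unfolding passes2_def by measurable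
qed

text \<open>The choice runs through the pairing function as a \<open>LEAST\<close> over the naturals
  because such a choice is measurable whenever the tests are. The tie-breaking order is immaterial
  on the event that exactly one pair passes.\<close>

definition joint_decoder :: "nat \<Rightarrow> nat \<Rightarrow> (nat \<Rightarrow> nat \<Rightarrow> 'y \<Rightarrow> bool) \<Rightarrow> 'y \<Rightarrow> nat \<times> nat" where
  "joint_decoder M1 M2 T y =
     prod_decode (LEAST k. case prod_decode k of (w1, w2) \<Rightarrow> w1 < M1 \<and> w2 < M2 \<and> T w1 w2 y)"

lemma joint_decoder_eq:
  assumes "w1 < M1" "w2 < M2" "T w1 w2 y"
    and "\<And>v1 v2. v1 < M1 \<Longrightarrow> v2 < M2 \<Longrightarrow> T v1 v2 y \<Longrightarrow> v1 = w1 \<and> v2 = w2"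
  shows "joint_decoder M1 M2 T y = (w1, w2)"
proof -
  have "(LEAST k. case prod_decode k of (w1, w2) \<Rightarrow> w1 < M1 \<and> w2 < M2 \<and> T w1 w2 y) = prod_encode (w1, w2)"
  proof (rule Least_equality)
    fix k assume k: "case prod_decode k of (w1, w2) \<Rightarrow> w1 < M1 \<and> w2 < M2 \<and> T w1 w2 y"
    obtain v1 v2 where v: "prod_decode k = (v1, v2)" by fastforce
    have "v1 = w1 \<and> v2 = w2" by (rule assms(4)) (use k v in auto)
    hence "prod_encode (w1, w2) = k" using v prod_decode_inverse[of k] by simp
    thus "prod_encode (w1, w2) \<le> k" by simp
  qed (simp add: assms(1-3))
  thus ?thesis by (simp add: joint_decoder_def)
qed

lemma measurable_joint_decoder:
  assumes "\<And>w1 w2. w1 < M1 \<Longrightarrow> w2 < M2 \<Longrightarrow> Measurable.pred L (T w1 w2)"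
  shows "joint_decoder M1 M2 T \<in> L \<rightarrow>\<^sub>M count_space UNIV"
proof -
  have "Measurable.pred L (\<lambda>y. case prod_decode k of (w1, w2) \<Rightarrow> w1 < M1 \<and> w2 < M2 \<and> T w1 w2 y)" for k
  proof (cases "prod_decode k")
    case (Pair w1 w2)
    show ?thesis
    proof (cases "w1 < M1 \<and> w2 < M2")
      case True
      with assms[of w1 w2] Pair show ?thesis by simp
    next
      case False
      hence "(\<lambda>y. case prod_decode k of (w1, w2) \<Rightarrow> w1 < M1 \<and> w2 < M2 \<and> T w1 w2 y) = (\<lambda>_. False)"
        using Pair by auto
      thus ?thesis by simp
    qed
  qed
  hence "(\<lambda>y. LEAST k. case prod_decode k of (w1, w2) \<Rightarrow> w1 < M1 \<and> w2 < M2 \<and> T w1 w2 y) \<in> L \<rightarrow>\<^sub>M count_space UNIV"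
    by (rule measurable_Least)
  thus ?thesis
    unfolding joint_decoder_def[abs_def] by (rule measurable_compose) simp
qed

text \<open>Truncation acts on each codeword separately, so the average power constraint holds for
  every codebook, not merely for typical ones.\<close>

definition truncate_power :: "nat \<Rightarrow> real \<Rightarrow> (nat \<Rightarrow> real) \<Rightarrow> nat \<Rightarrow> real" where
  "truncate_power n P c = (if (\<Sum>i<n. (c i)\<^sup>2) \<le> n * P then c else (\<lambda>_. 0))"

lemma power_constraint_truncate_power:
  assumes P: "0 \<le> P"
  shows "power_constraint n M P (\<lambda>w. truncate_power n P (c w))"
proof (cases "M = 0")
  case False
  have "(\<Sum>i<n. (truncate_power n P (c w) i)\<^sup>2) \<le> n * P" for w
    using P by (simp add: truncate_power_def)
  hence "(\<Sum>w<M. \<Sum>i<n. (truncate_power n P (c w) i)\<^sup>2) \<le> (\<Sum>w<M. n * P)"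
    by (intro sum_mono)
  hence "(\<Sum>w<M. \<Sum>i<n. (truncate_power n P (c w) i)\<^sup>2) / M \<le> n * P"
    using False by (simp add: field_simps)
  thus ?thesis
    unfolding power_constraint_def by (simp add: sum_divide_distrib[symmetric]) (subst sum.swap)
qed (use P in \<open>simp add: power_constraint_def\<close>)

lemma not_deviatesD:
  assumes "\<not> deviates n \<delta> V u"
  shows "(\<Sum>i<n. (u i)\<^sup>2) \<le> n * (V + \<delta>)" "n * (V - \<delta>) \<le> (\<Sum>i<n. (u i)\<^sup>2)"
proof -
  have "\<bar>(\<Sum>i<n. (u i)\<^sup>2) - n * V\<bar> < n * \<delta>" using assms by (simp add: deviates_def)
  hence "(\<Sum>i<n. (u i)\<^sup>2) - n * V < n * \<delta>" "- ((\<Sum>i<n. (u i)\<^sup>2) - n * V) < n * \<delta>"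
    by (simp_all only: abs_less_iff)
  thus "(\<Sum>i<n. (u i)\<^sup>2) \<le> n * (V + \<delta>)" "n * (V - \<delta>) \<le> (\<Sum>i<n. (u i)\<^sup>2)"
    by (simp_all add: distrib_left right_diff_distrib)
qed

text \<open>The 12 is six typicality conditions times the 2 in the variance of a squared Gaussian,
  the exponential terms are the numbers of competitors times \<open>1 / K\<close>, and
  \<open>1 / n\<close> is the slack of the averaging argument. The gap \<open>\<delta>\<close>
  between \<open>Qk\<close> and \<open>Pk\<close> makes typical codewords meet the power
  constraint.\<close>

lemma exists_mac_code:
  assumes Q: "0 < Q1" "0 < Q2" and N: "0 < N" and \<delta>: "0 < \<delta>" and slack: "Q1 + \<delta> \<le> P1" "Q2 + \<delta> \<le> P2"
    and n: "0 < n" and M: "0 < M1" "0 < M2"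
  defines "\<gamma> \<equiv> \<lambda>S. ln (1 + S / N) / 2 - \<delta> / N"
  shows "\<exists>x1 x2 g. mac_code P1 P2 n M1 M2 x1 x2 g \<and> error_prob n N M1 M2 x1 x2 g
    \<le> 12 * (P1 + P2 + N)\<^sup>2 / (n * \<delta>\<^sup>2) + real M1 * exp (- (n * \<gamma> Q1)) + real M2 * exp (- (n * \<gamma> Q2))
       + real M1 * (real M2 * exp (- (n * \<gamma> (Q1 + Q2)))) + 1 / n"
proof -
  let ?A1 = "gauss0 n Q1" and ?A2 = "gauss0 n Q2" and ?Z = "gauss0 n N" and ?Y = "vec_space n"
  define K where "K S = exp (n * \<gamma> S)" for S
  have K: "0 < K S" "1 / K S = exp (- (n * \<gamma> S))" for S by (simp_all add: K_def exp_minus field_simps)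
  define T1 where "T1 x1 x2 y = passes1 n N Q1 (K Q1) x1 x2 y" for x1 x2 y
  define T2 where "T2 x1 x2 y = passes1 n N Q2 (K Q2) x2 x1 y" for x1 x2 y
  define T12 where "T12 x1 x2 y = passes2 n N (Q1 + Q2) (K (Q1 + Q2)) x1 x2 y" for x1 x2 y
  define H where "H = (\<lambda>(x1, x2, z). channel_output n x1 x2 z)"
  define ok where "ok x1 x2 z \<longleftrightarrow> (\<Sum>i<n. (x1 i)\<^sup>2) \<le> n * P1 \<and> (\<Sum>i<n. (x2 i)\<^sup>2) \<le> n * P2 \<and>
    T1 x1 x2 (H (x1, x2, z)) \<and> T2 x1 x2 (H (x1, x2, z)) \<and> T12 x1 x2 (H (x1, x2, z))" for x1 x2 z
  define S0 where "S0 = {p \<in> space (?A1 \<Otimes>\<^sub>M ?A2 \<Otimes>\<^sub>M ?Z). \<not> ok (fst p) (fst (snd p)) (snd (snd p))}"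
  define S where "S T = {p \<in> space (?A1 \<Otimes>\<^sub>M ?A2 \<Otimes>\<^sub>M ?Y). T (fst p) (fst (snd p)) (snd (snd p))}"
    for T :: "(nat \<Rightarrow> real) \<Rightarrow> (nat \<Rightarrow> real) \<Rightarrow> (nat \<Rightarrow> real) \<Rightarrow> bool"
  have H_meas: "H \<in> ?A1 \<Otimes>\<^sub>M ?A2 \<Otimes>\<^sub>M ?Z \<rightarrow>\<^sub>M ?Y"
    unfolding H_def channel_output_def case_prod_unfold by measurable
  have T_meas: "Measurable.pred L (\<lambda>p. T1 (x1 p) (x2 p) (y p))" "Measurable.pred L (\<lambda>p. T2 (x1 p) (x2 p) (y p))"
    "Measurable.pred L (\<lambda>p. T12 (x1 p) (x2 p) (y p))"
    if "\<And>i. i < n \<Longrightarrow> (\<lambda>p. x1 p i) \<in> borel_measurable L" "\<And>i. i < n \<Longrightarrow> (\<lambda>p. x2 p i) \<in> borel_measurable L"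
      "\<And>i. i < n \<Longrightarrow> (\<lambda>p. y p i) \<in> borel_measurable L" for x1 x2 y and L :: "'l measure"
    unfolding T1_def T2_def T12_def by (intro measurable_passes that; assumption)+
  have S_sets: "S T1 \<in> sets (?A1 \<Otimes>\<^sub>M ?A2 \<Otimes>\<^sub>M ?Y)" "S T2 \<in> sets (?A1 \<Otimes>\<^sub>M ?A2 \<Otimes>\<^sub>M ?Y)"
    "S T12 \<in> sets (?A1 \<Otimes>\<^sub>M ?A2 \<Otimes>\<^sub>M ?Y)"
    unfolding S_def by (intro predE T_meas; measurable)+
  have S0_sets: "S0 \<in> sets (?A1 \<Otimes>\<^sub>M ?A2 \<Otimes>\<^sub>M ?Z)"
  proof -
    have Hi: "(\<lambda>p. H (fst p, fst (snd p), snd (snd p)) i) \<in> borel_measurable (?A1 \<Otimes>\<^sub>M ?A2 \<Otimes>\<^sub>M ?Z)" if "i < n" for i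
      using measurable_compose[OF H_meas measurable_component_singleton[of i "{..<n}"]] that by simp
    have [measurable]: "Measurable.pred (?A1 \<Otimes>\<^sub>M ?A2 \<Otimes>\<^sub>M ?Z) (\<lambda>p. T1 (fst p) (fst (snd p)) (H (fst p, fst (snd p), snd (snd p))))"
      "Measurable.pred (?A1 \<Otimes>\<^sub>M ?A2 \<Otimes>\<^sub>M ?Z) (\<lambda>p. T2 (fst p) (fst (snd p)) (H (fst p, fst (snd p), snd (snd p))))"
      "Measurable.pred (?A1 \<Otimes>\<^sub>M ?A2 \<Otimes>\<^sub>M ?Z) (\<lambda>p. T12 (fst p) (fst (snd p)) (H (fst p, fst (snd p), snd (snd p))))"
      by (intro T_meas Hi; measurable)+
    show ?thesis unfolding S0_def ok_def by measurable
  qed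
  interpret A1: prob_space ?A1 by (rule prob_space_gauss) fact
  interpret A2: prob_space ?A2 by (rule prob_space_gauss) fact
  interpret Z: prob_space ?Z by (rule prob_space_gauss) fact
  interpret random_coding ?A1 ?A2 ?Z ?Y H S0 "S T1" "S T2" "S T12"
    "6 * (2 * (P1 + P2 + N)\<^sup>2 / (n * \<delta>\<^sup>2))" "1 / K Q1" "1 / K Q2" "1 / K (Q1 + Q2)"
  proof
    show "(\<integral>\<^sup>+x1. \<integral>\<^sup>+x2. \<integral>\<^sup>+z. indicator S0 (x1, x2, z) \<partial>?Z \<partial>?A2 \<partial>?A1)
        \<le> ennreal (6 * (2 * (P1 + P2 + N)\<^sup>2 / (n * \<delta>\<^sup>2)))"
    proof (rule atypical_le[OF Q N \<delta> n _ S0_sets])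
      show "Q1 + Q2 + N \<le> P1 + P2 + N" using slack \<delta> by simp
      fix x1 x2 z assume "(x1, x2, z) \<in> S0"
      hence not_ok: "\<not> ok x1 x2 z" by (simp add: S0_def)
      show "deviates n \<delta> Q1 x1 \<or> deviates n \<delta> Q2 x2 \<or> deviates n \<delta> N z \<or>
        deviates n \<delta> (Q1 + N) (\<lambda>i. x1 i + z i) \<or> deviates n \<delta> (Q2 + N) (\<lambda>i. x2 i + z i) \<or>
        deviates n \<delta> (Q1 + Q2 + N) (\<lambda>i. x1 i + (x2 i + z i))"
      proof (rule ccontr)
        assume none: "\<not> ?thesis"
        have near: "(\<Sum>i<n. (u i)\<^sup>2) \<le> n * (V + \<delta>)" "n * (V - \<delta>) \<le> (\<Sum>i<n. (u i)\<^sup>2)"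
          if "(V, u) \<in> {(Q1, x1), (Q2, x2), (N, z), (Q1 + N, \<lambda>i. x1 i + z i), (Q2 + N, \<lambda>i. x2 i + z i),
            (Q1 + Q2 + N, \<lambda>i. x1 i + (x2 i + z i))}" for V u
        proof -
          have "\<not> deviates n \<delta> V u" using that none by (elim insertE) simp_all
          from not_deviatesD[OF this] show "(\<Sum>i<n. (u i)\<^sup>2) \<le> n * (V + \<delta>)" "n * (V - \<delta>) \<le> (\<Sum>i<n. (u i)\<^sup>2)" .
        qed
        have y: "H (x1, x2, z) i = x1 i + x2 i + z i" if "i < n" for i
          using that by (simp add: H_def channel_output_def)
        \<comment> \<open>For the sent pair, subtracting codewords from the output leaves the noise,
          or noise plus a codeword, but only on the block; outside it the output is undefined, hence
          agreement is asked only below \<open>n\<close>.\<close>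
        have ratio: "exp (n * \<gamma> S) * gauss_pdf n (S + N) u \<le> gauss_pdf n N v"
          if "0 < S" "\<And>i. i < n \<Longrightarrow> v i = z i" "\<And>i. i < n \<Longrightarrow> u i = u' i" "n * (S + N - \<delta>) \<le> (\<Sum>i<n. (u' i)\<^sup>2)"
          for S u v u'
        proof -
          have "gauss_pdf n (S + N) u = gauss_pdf n (S + N) u'" "gauss_pdf n N v = gauss_pdf n N z"
            using that by (auto intro: gauss_pdf_cong)
          thus ?thesis
            unfolding \<gamma>_def using gauss_pdf_ratio_ge[OF that(1) N less_imp_le[OF \<delta>] near(1)[of N z] that(4)] by simp
        qed
        have "T1 x1 x2 (H (x1, x2, z))"
          unfolding T1_def passes1_def K_def
          by (rule ratio[OF Q(1) _ _ near(2)[of "Q1 + N" "\<lambda>i. x1 i + z i"]]) (auto simp: y)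
        moreover have "T2 x1 x2 (H (x1, x2, z))"
          unfolding T2_def passes1_def K_def
          by (rule ratio[OF Q(2) _ _ near(2)[of "Q2 + N" "\<lambda>i. x2 i + z i"]]) (auto simp: y)
        moreover have "T12 x1 x2 (H (x1, x2, z))"
          unfolding T12_def passes2_def K_def
          by (rule ratio[OF _ _ _ near(2)[of "Q1 + Q2 + N" "\<lambda>i. x1 i + (x2 i + z i)"]]) (use Q in \<open>auto simp: y\<close>)
        moreover have "(\<Sum>i<n. (x1 i)\<^sup>2) \<le> n * P1"
          by (rule order_trans[OF near(1)[of Q1 x1]]) (use slack in \<open>auto intro!: mult_left_mono\<close>)
        moreover have "(\<Sum>i<n. (x2 i)\<^sup>2) \<le> n * P2"
          by (rule order_trans[OF near(1)[of Q2 x2]]) (use slack in \<open>auto intro!: mult_left_mono\<close>)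
        ultimately show False using not_ok by (simp add: ok_def)
      qed
    qed
    show "(\<integral>\<^sup>+v. indicator (S T1) (v, x2, y) \<partial>?A1) \<le> ennreal (1 / K Q1)" for x2 y
    proof (rule order_trans[OF nn_integral_mono single_confusion_le[OF Q(1) N K(1), where u = "\<lambda>i. y i - x2 i"]])
      show "indicator (S T1) (v, x2, y) \<le> (indicator {v. K Q1 * gauss_pdf n (Q1 + N) (\<lambda>i. y i - x2 i)
          \<le> gauss_pdf n N (\<lambda>i. y i - x2 i - v i)} v :: ennreal)" for v
        by (auto simp: S_def T1_def passes1_def indicator_def)
    qed
    show "(\<integral>\<^sup>+v. indicator (S T2) (x1, v, y) \<partial>?A2) \<le> ennreal (1 / K Q2)" for x1 y
    proof (rule order_trans[OF nn_integral_mono single_confusion_le[OF Q(2) N K(1), where u = "\<lambda>i. y i - x1 i"]])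
      show "indicator (S T2) (x1, v, y) \<le> (indicator {v. K Q2 * gauss_pdf n (Q2 + N) (\<lambda>i. y i - x1 i)
          \<le> gauss_pdf n N (\<lambda>i. y i - x1 i - v i)} v :: ennreal)" for v
        by (auto simp: S_def T2_def passes1_def indicator_def)
    qed
    show "(\<integral>\<^sup>+v1. \<integral>\<^sup>+v2. indicator (S T12) (v1, v2, y) \<partial>?A2 \<partial>?A1) \<le> ennreal (1 / K (Q1 + Q2))" for y
      by (rule order_trans[OF nn_integral_mono[OF nn_integral_mono] double_confusion_le[OF Q N K(1), where y = y]])
         (auto simp: S_def T12_def passes2_def indicator_def)
  qed (rule H_meas S0_sets S_sets | simp add: less_imp_le[OF K(1)])+
  obtain c1 c2 where c: "\<forall>w<M1. c1 w \<in> space ?A1" "\<forall>w<M2. c2 w \<in> space ?A2"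
    and conf: "(\<Sum>w1<M1. \<Sum>w2<M2. measure ?Z {z \<in> space ?Z. confusion M1 M2 c1 c2 w1 w2 z})
       \<le> real M1 * real M2 * (6 * (2 * (P1 + P2 + N)\<^sup>2 / (n * \<delta>\<^sup>2)) + M1 * (1 / K Q1) + M2 * (1 / K Q2)
          + M1 * (M2 * (1 / K (Q1 + Q2))) + 1 / n)"
    using exists_codebooks[OF _ M, of "1 / n"] n by auto
  \<comment> \<open>The decoder tests the original codewords \<open>c1\<close>, \<open>c2\<close>;
    the truncated \<open>x1\<close>, \<open>x2\<close> are only what is transmitted.\<close>
  define T where "T w1 w2 y \<longleftrightarrow> T1 (c1 w1) (c2 w2) y \<and> T2 (c1 w1) (c2 w2) y \<and> T12 (c1 w1) (c2 w2) y" for w1 w2 y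
  define g where "g = joint_decoder M1 M2 T"
  define x1 where "x1 w = truncate_power n P1 (c1 w)" for w
  define x2 where "x2 w = truncate_power n P2 (c2 w)" for w
  have "Measurable.pred ?Y (T w1 w2)" for w1 w2
    unfolding T_def[abs_def] by (intro pred_intros_logic T_meas; measurable)
  hence g: "g \<in> ?Y \<rightarrow>\<^sub>M count_space UNIV"
    unfolding g_def by (intro measurable_joint_decoder)
  have P: "0 \<le> P1" "0 \<le> P2" using Q slack \<delta> by auto
  have code: "mac_code P1 P2 n M1 M2 x1 x2 g"
    unfolding mac_code_def x1_def x2_def using g P by (auto intro: power_constraint_truncate_power)
  have "measure ?Z {z \<in> space ?Z. g (channel_output n (x1 w1) (x2 w2) z) \<noteq> (w1, w2)}
      \<le> measure ?Z {z \<in> space ?Z. confusion M1 M2 c1 c2 w1 w2 z}" if w: "w1 < M1" "w2 < M2" for w1 w2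
  proof (rule Z.finite_measure_mono)
    show "{z \<in> space ?Z. confusion M1 M2 c1 c2 w1 w2 z} \<in> sets ?Z"
      using c w by (intro confusion_sets) auto
    show "{z \<in> space ?Z. g (channel_output n (x1 w1) (x2 w2) z) \<noteq> (w1, w2)}
        \<subseteq> {z \<in> space ?Z. confusion M1 M2 c1 c2 w1 w2 z}"
    proof (clarify, rule ccontr)
      fix z assume z: "z \<in> space ?Z" and err: "g (channel_output n (x1 w1) (x2 w2) z) \<noteq> (w1, w2)"
        and "\<not> confusion M1 M2 c1 c2 w1 w2 z"
      note no_conf = this(3)[unfolded confusion_def Let_def]
      define y where "y = H (c1 w1, c2 w2, z)"
      have y: "y \<in> space ?Y"
        unfolding y_def using c w z by (intro measurable_space[OF H_meas]) (auto simp: space_pair_measure)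
      have "ok (c1 w1) (c2 w2) z"
        using no_conf c w z by (auto simp: S0_def space_pair_measure)
      hence x: "x1 w1 = c1 w1" "x2 w2 = c2 w2" and Tw: "T w1 w2 y"
        by (auto simp: ok_def x1_def x2_def truncate_power_def T_def y_def)
      have "g y = (w1, w2)"
        unfolding g_def
      proof (rule joint_decoder_eq[where T = T, OF w Tw])
        fix v1 v2 assume v: "v1 < M1" "v2 < M2" and Tv: "T v1 v2 y"
        \<comment> \<open>A competitor must pass all three tests; the one matching the codewords in
          which it differs from the sent pair is excluded by the absence of confusion.\<close>
        have "(c1 v1, c2 v2, y) \<in> S T1" "(c1 v1, c2 v2, y) \<in> S T2" "(c1 v1, c2 v2, y) \<in> S T12"
          using c v y Tv by (auto simp: S_def space_pair_measure T_def)
        thus "v1 = w1 \<and> v2 = w2"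
          using no_conf v unfolding y_def[symmetric] by blast
      qed
      thus False using err by (simp add: x y_def H_def)
    qed
  qed
  hence "(\<Sum>w1<M1. \<Sum>w2<M2. measure ?Z {z \<in> space ?Z. g (channel_output n (x1 w1) (x2 w2) z) \<noteq> (w1, w2)})
     \<le> (\<Sum>w1<M1. \<Sum>w2<M2. measure ?Z {z \<in> space ?Z. confusion M1 M2 c1 c2 w1 w2 z})"
    by (intro sum_mono) auto
  also note conf
  finally have "error_prob n N M1 M2 x1 x2 g
      \<le> 6 * (2 * (P1 + P2 + N)\<^sup>2 / (n * \<delta>\<^sup>2)) + M1 * (1 / K Q1) + M2 * (1 / K Q2)
          + M1 * (M2 * (1 / K (Q1 + Q2))) + 1 / n"
    using M by (simp add: error_prob_def noise_eq_gauss divide_le_eq mult.commute)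
  hence "error_prob n N M1 M2 x1 x2 g
      \<le> 12 * (P1 + P2 + N)\<^sup>2 / (n * \<delta>\<^sup>2) + real M1 * exp (- (n * \<gamma> Q1)) + real M2 * exp (- (n * \<gamma> Q2))
       + real M1 * (real M2 * exp (- (n * \<gamma> (Q1 + Q2)))) + 1 / n"
    unfolding K(2) by (simp add: mult.assoc[symmetric])
  with code show ?thesis by blast
qed

section \<open>Achievable rates and the capacity region\<close>

lemma message_count_le:
  assumes "0 \<le> R" shows "real (message_count n R) \<le> 2 * exp (real n * R)"
proof -
  have "real (message_count n R) \<le> exp (real n * R) + 1"
    using of_int_ceiling_le_add_one[of "exp (real n * R)"] by (simp add: message_count_def)
  also have "1 \<le> exp (real n * R)" using assms by simp
  finally show ?thesis by simp
qed

lemma exp_neg_linear_tendsto_0: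
  fixes c :: real
  assumes "0 < c" shows "(\<lambda>n. exp (- (real n * c))) \<longlonglongrightarrow> 0"
proof -
  have "(\<lambda>n. exp (- c) ^ n) \<longlonglongrightarrow> 0" using assms by (intro LIMSEQ_power_zero) simp
  thus ?thesis by (simp add: exp_of_nat_mult[symmetric])
qed

text \<open>Strict inequalities leave room for a small power reduction \<open>\<theta>\<close> and
  test margin. All three exponents are then positive, so the error bound tends to 0.\<close>

lemma mac_achievable_if_strict:
  assumes P: "0 < P1" "0 < P2" and N: "0 < N" and R: "0 \<le> R1" "0 \<le> R2"
    and R1: "R1 < ln (1 + P1 / N) / 2" and R2: "R2 < ln (1 + P2 / N) / 2"
    and R12: "R1 + R2 < ln (1 + (P1 + P2) / N) / 2"
  shows "mac_achievable P1 P2 N R1 R2"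
proof -
  define m where "m = min P1 P2"
  have m: "0 < m" "m \<le> P1" "m \<le> P2" using P by (auto simp: m_def)
  \<comment> \<open>The exponent left after scaling the powers by \<open>1 - \<theta>\<close> and
    paying the margin \<open>\<delta> = \<theta> * m\<close>. Taking \<open>m\<close> as the smaller
    power makes \<open>\<delta>\<close> fit into the power gap \<open>\<theta> * Pk\<close> of both
    senders.\<close>
  define F where "F S \<theta> = ln (1 + (1 - \<theta>) * S / N) / 2 - \<theta> * m / N" for S \<theta>
  have F: "(F S \<longlongrightarrow> ln (1 + S / N) / 2) (at_right 0)" if "0 < S" for S
  proof -
    have "1 + S / N \<noteq> 0" using that N by (simp add: add_pos_pos less_imp_neq[symmetric])
    hence "((\<lambda>\<theta>. ln (1 + (1 - \<theta>) * S / N) / 2 - \<theta> * m / N)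
        \<longlongrightarrow> ln (1 + (1 - 0) * S / N) / 2 - 0 * m / N) (at_right 0)"
      using N by (intro tendsto_intros) auto
    thus ?thesis unfolding F_def by simp
  qed
  have "\<forall>\<^sub>F \<theta> in at_right 0. R1 < F P1 \<theta> \<and> R2 < F P2 \<theta> \<and> R1 + R2 < F (P1 + P2) \<theta> \<and> 0 < \<theta> \<and> \<theta> < 1"
    using P R1 R2 R12 by (intro eventually_conj order_tendstoD(1)[OF F] eventually_at_right_less
        eventually_at_right_real[of 0 1, THEN eventually_mono]) auto
  then obtain \<theta> where \<theta>: "0 < \<theta>" "\<theta> < 1"
    and F1: "R1 < F P1 \<theta>" and F2: "R2 < F P2 \<theta>" and F12: "R1 + R2 < F (P1 + P2) \<theta>"
    using eventually_happens'[OF trivial_limit_at_right_real] by blast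
  define Q1 Q2 \<delta> where "Q1 = (1 - \<theta>) * P1" and "Q2 = (1 - \<theta>) * P2" and "\<delta> = \<theta> * m"
  have Q: "0 < Q1" "0 < Q2" using \<theta> P by (auto simp: Q1_def Q2_def)
  have \<delta>: "0 < \<delta>" using \<theta> m by (simp add: \<delta>_def)
  have slack: "Q1 + \<delta> \<le> P1" "Q2 + \<delta> \<le> P2"
    using m \<theta> by (simp_all add: Q1_def Q2_def \<delta>_def algebra_simps)
  define \<gamma> where "\<gamma> S = ln (1 + S / N) / 2 - \<delta> / N" for S
  have \<gamma>: "R1 < \<gamma> Q1" "R2 < \<gamma> Q2" "R1 + R2 < \<gamma> (Q1 + Q2)"
    using F1 F2 F12 by (simp_all add: \<gamma>_def F_def Q1_def Q2_def \<delta>_def distrib_left)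
  define M1 M2 where "M1 n = message_count n R1" and "M2 n = message_count n R2" for n
  have M: "0 < M1 n" "0 < M2 n" for n by (simp_all add: M1_def M2_def message_count_pos)
  define W where "W = 12 * (P1 + P2 + N)\<^sup>2 / \<delta>\<^sup>2"
  \<comment> \<open>The factors 2, 2 and 4 absorb the rounding up of one or both message counts,
    each at most twice its exponential.\<close>
  define b where "b n = W * (1 / real n) + 2 * exp (- (real n * (\<gamma> Q1 - R1))) + 2 * exp (- (real n * (\<gamma> Q2 - R2)))
     + 4 * exp (- (real n * (\<gamma> (Q1 + Q2) - (R1 + R2)))) + 1 / real n" for n
  define good where "good n t \<longleftrightarrow> mac_code P1 P2 n (M1 n) (M2 n) (fst t) (fst (snd t)) (snd (snd t)) \<and>
     (0 < n \<longrightarrow> error_prob n N (M1 n) (M2 n) (fst t) (fst (snd t)) (snd (snd t)) \<le> b n)" for n t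
  have "\<exists>t. good n t" for n
  proof (cases "n = 0")
    case True
    \<comment> \<open>Achievability asks for a code at every block length; at length 0 any decoder
      will do, and its error does not affect the limit.\<close>
    have "good n ((\<lambda>_ _. 0), (\<lambda>_ _. 0), (\<lambda>_. (0, 0)))"
      using True by (simp add: good_def mac_code_def power_constraint_def)
    thus ?thesis by blast
  next
    case False
    hence n: "0 < n" by simp
    obtain x1 x2 g where code: "mac_code P1 P2 n (M1 n) (M2 n) x1 x2 g"
      and err: "error_prob n N (M1 n) (M2 n) x1 x2 g
        \<le> 12 * (P1 + P2 + N)\<^sup>2 / (n * \<delta>\<^sup>2) + real (M1 n) * exp (- (n * \<gamma> Q1)) + real (M2 n) * exp (- (n * \<gamma> Q2))
         + real (M1 n) * (real (M2 n) * exp (- (n * \<gamma> (Q1 + Q2)))) + 1 / n"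
      using exists_mac_code[OF Q N \<delta> slack n M] unfolding \<gamma>_def by blast
    have le1: "real (M1 n) \<le> 2 * exp (real n * R1)" and le2: "real (M2 n) \<le> 2 * exp (real n * R2)"
      unfolding M1_def M2_def using R by (auto intro: message_count_le)
    have "real (M1 n) * exp (- (n * \<gamma> Q1)) \<le> 2 * exp (real n * R1) * exp (- (n * \<gamma> Q1))"
      by (intro mult_right_mono le1) simp
    also have "\<dots> = 2 * exp (- (real n * (\<gamma> Q1 - R1)))"
      by (simp add: exp_add[symmetric] algebra_simps)
    finally have 1: "real (M1 n) * exp (- (n * \<gamma> Q1)) \<le> 2 * exp (- (real n * (\<gamma> Q1 - R1)))" .
    have "real (M2 n) * exp (- (n * \<gamma> Q2)) \<le> 2 * exp (real n * R2) * exp (- (n * \<gamma> Q2))"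
      by (intro mult_right_mono le2) simp
    also have "\<dots> = 2 * exp (- (real n * (\<gamma> Q2 - R2)))"
      by (simp add: exp_add[symmetric] algebra_simps)
    finally have 2: "real (M2 n) * exp (- (n * \<gamma> Q2)) \<le> 2 * exp (- (real n * (\<gamma> Q2 - R2)))" .
    have "real (M1 n) * (real (M2 n) * exp (- (n * \<gamma> (Q1 + Q2))))
        \<le> (2 * exp (real n * R1)) * ((2 * exp (real n * R2)) * exp (- (n * \<gamma> (Q1 + Q2))))"
      by (intro mult_mono le1 le2) auto
    also have "\<dots> = 4 * exp (- (real n * (\<gamma> (Q1 + Q2) - (R1 + R2))))"
      by (simp add: exp_add[symmetric] algebra_simps)
    finally have 3: "real (M1 n) * (real (M2 n) * exp (- (n * \<gamma> (Q1 + Q2))))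
      \<le> 4 * exp (- (real n * (\<gamma> (Q1 + Q2) - (R1 + R2))))" .
    have "12 * (P1 + P2 + N)\<^sup>2 / (n * \<delta>\<^sup>2) = W * (1 / real n)" by (simp add: W_def)
    hence "error_prob n N (M1 n) (M2 n) x1 x2 g \<le> b n"
      unfolding b_def using err 1 2 3 by linarith
    hence "good n (x1, x2, g)" using code by (simp add: good_def)
    thus ?thesis by blast
  qed
  hence "\<forall>n. \<exists>t. good n t" by blast
  then obtain t where t: "\<forall>n. good n (t n)" unfolding choice_iff by blast
  define x1 x2 g where "x1 n = fst (t n)" and "x2 n = fst (snd (t n))" and "g n = snd (snd (t n))" for n
  have code: "mac_code P1 P2 n (M1 n) (M2 n) (x1 n) (x2 n) (g n)"
    and err: "0 < n \<Longrightarrow> error_prob n N (M1 n) (M2 n) (x1 n) (x2 n) (g n) \<le> b n" for n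
    using t by (simp_all add: good_def x1_def x2_def g_def)
  have "b \<longlonglongrightarrow> W * 0 + 2 * 0 + 2 * 0 + 4 * 0 + 0"
    unfolding b_def using \<gamma>
    by (intro tendsto_add tendsto_mult tendsto_const lim_1_over_n exp_neg_linear_tendsto_0) auto
  hence b: "b \<longlonglongrightarrow> 0" by simp
  have "(\<lambda>n. error_prob n N (M1 n) (M2 n) (x1 n) (x2 n) (g n)) \<longlonglongrightarrow> 0"
  proof (rule tendsto_sandwich[OF _ _ tendsto_const b])
    show "\<forall>\<^sub>F n in sequentially. 0 \<le> error_prob n N (M1 n) (M2 n) (x1 n) (x2 n) (g n)"
      unfolding error_prob_def by (intro always_eventually allI divide_nonneg_nonneg sum_nonneg) auto
    show "\<forall>\<^sub>F n in sequentially. error_prob n N (M1 n) (M2 n) (x1 n) (x2 n) (g n) \<le> b n"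
      using eventually_gt_at_top[of 0] by eventually_elim (rule err)
  qed
  thus ?thesis
    unfolding mac_achievable_def using R code unfolding M1_def M2_def by blast
qed

theorem mac_capacity_region_eq_pentagon:
  assumes P: "0 < P1" "0 < P2" and N: "0 < N"
  shows "mac_capacity_region P1 P2 N = mac_pentagon P1 P2 N"
proof
  show "mac_capacity_region P1 P2 N \<subseteq> mac_pentagon P1 P2 N"
    unfolding mac_capacity_region_def
    by (intro closure_minimal closed_mac_pentagon) (auto intro: mac_achievable_imp_pentagon[OF P N])
  show "mac_pentagon P1 P2 N \<subseteq> mac_capacity_region P1 P2 N"
  proof (rule subrelI)
    fix R1 R2 assume "(R1, R2) \<in> mac_pentagon P1 P2 N"
    hence R: "0 \<le> R1" "0 \<le> R2" "R1 \<le> ln (1 + P1 / N) / 2" "R2 \<le> ln (1 + P2 / N) / 2"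
      "R1 + R2 \<le> ln (1 + (P1 + P2) / N) / 2"
      by (auto simp: mac_pentagon_def)
    \<comment> \<open>Scaling towards the origin makes every upper bound strict, because the bounds
      are positive, while nonnegativity survives even for a rate equal to 0. Closure then recovers
      the boundary.\<close>
    define t where "t k = 1 - 1 / real (Suc k)" for k
    have t: "0 \<le> t k" "t k < 1" for k by (auto simp: t_def)
    have scale: "t k * r < C" if "r \<le> C" "0 < C" for r C k
    proof -
      have "t k * r \<le> t k * C" using that t by (intro mult_left_mono)
      also have "\<dots> < 1 * C" using that t by (intro mult_strict_right_mono)
      finally show ?thesis by simp
    qed
    have pos: "0 < ln (1 + P1 / N) / 2" "0 < ln (1 + P2 / N) / 2" "0 < ln (1 + (P1 + P2) / N) / 2"
      using P N by (simp_all add: add_pos_pos)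
    have sum_less: "t k * R1 + t k * R2 < ln (1 + (P1 + P2) / N) / 2" for k
      using scale[OF R(5) pos(3)] by (simp add: distrib_left)
    have ach: "mac_achievable P1 P2 N (t k * R1) (t k * R2)" for k
      by (rule mac_achievable_if_strict[OF P N _ _ scale[OF R(3) pos(1)] scale[OF R(4) pos(2)]])
         (use R t sum_less in auto)
    have "t \<longlonglongrightarrow> 1 - 0"
      unfolding t_def by (intro tendsto_diff tendsto_const LIMSEQ_Suc lim_1_over_n)
    hence "(\<lambda>k. (t k * R1, t k * R2)) \<longlonglongrightarrow> ((1 - 0) * R1, (1 - 0) * R2)"
      by (intro tendsto_Pair tendsto_mult tendsto_const)
    thus "(R1, R2) \<in> mac_capacity_region P1 P2 N"
      unfolding mac_capacity_region_def closure_sequential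
      using ach by (intro exI[of _ "\<lambda>k. (t k * R1, t k * R2)"]) auto
  qed
qed

text \<open>The three conjuncts separate the possible readings of the limit: the constraint
  converges for each \<open>Q\<close>, the region cut out by the limiting constraint is the capacity
  region, and the outer bounds for finite feedback noise converge to it as sets. The last is not
  implied by the first two, since it needs an estimate uniform in \<open>Q\<close>.\<close>

theorem mainTheorem7:
  fixes P1 P2 N :: real
  assumes "0 < P1" and "0 < P2" and "0 < N"
  shows "(\<forall>Q. admissible P1 P2 Q \<longrightarrow>
            ((\<lambda>(N1, N2). db_rhs N N1 N2 Q) \<longlongrightarrow> f1 Q + f2 Q) (at_top \<times>\<^sub>F at_top))
       \<and> DB_limit P1 P2 N = mac_capacity_region P1 P2 N
       \<and> hausdorff_tendsto (\<lambda>(N1, N2). DB P1 P2 N N1 N2)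
            (mac_capacity_region P1 P2 N) (at_top \<times>\<^sub>F at_top)"
  unfolding mac_capacity_region_eq_pentagon[OF assms]
  using db_rhs_tendsto DB_limit_eq_mac_pentagon[OF assms] hausdorff_tendsto_DB[OF assms] by blast

end
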